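(* Let $S$ be a one-ended finitely generated right cancellative hyperbolic semigroup. Then the quasi-geodesic boundary $\partial S$ has either exactly one or infinitely many elements.
   Context: The (right) Cayley digraph of a semigroup $S$ with respect to a finite generating set $A$ has vertex set $S$ and an edge from $x$ to $xa$ for all $x\in S$, $a\in A$. A finitely generated semigroup is hyperbolic if its Cayley digraph with respect to some finite generating set is hyperbolic in the sense below. For right cancellative finitely generated semigroups, hyperbolicity, the (order and homeomorphism type of the) boundary and the number of ends do not depend on the chosen finite generating set. $\partial S$ denotes the quasi-geodesic boundary $\partial D$ of the Cayley digraph $D$ of $S$ with respect to a finite generating set, and $S$ is one-ended if $D$ has exactly one end. (These Cayley digraphs are of bounded in- and out-degree.) In a digraph $D$, a directed path is a sequence $x_0\ldots x_n$ of vertices with every $x_ix_{i+1}$ an edge; its length $\ell$ is $n$. $d(x,y)$ is the length of a shortest directed path from $x$ to $y$, or $\infty$ if there is none. A directed path from $x$ to $y$ is a geodesic if its length is $d(x,y)$. $\mathcal B^+_r(x)=\{y: d(x,y)\le r\}$, $\mathcal B^-_r(x)=\{y:d(y,x)\le r\}$, and $\mathcal B^\pm_r(Y)=\bigcup_{y\in Y}\mathcal B^\pm_r(y)$. A geodesic triangle consists of three points and three geodesics (its sides), one between every two of these points (in one of the two directions). It is $\delta$-thin if for every labelling $P,Q,R$ of its sides such that the starting point of $P$ is the starting or the end point of $Q$ and the end point of $P$ is the starting or the end point of $R$, we have $P\subseteq\mathcal B^+_\delta(Q)\cup\mathcal B^-_\delta(R)$. $D$ is hyperbolic if for some $\delta\ge0$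 all geodesic triangles are $\delta$-thin. A ray is a sequence $x_0x_1\ldots$ of distinct vertices with edges $x_ix_{i+1}$; an anti-ray is such a sequence with edges $x_{i+1}x_i$. For rays or anti-rays write $R_1\preccurlyeq R_2$ if there are infinitely many pairwise disjoint directed paths from $R_1$ to $R_2$; $R_1\sim R_2$ means $R_1\preccurlyeq R_2\preccurlyeq R_1$. The ends of $D$ are the classes of $\sim$ on all rays and anti-rays. A directed path $P$ is a $(\gamma,c)$-quasi-geodesic if $\ell(uPv)\le\gamma d(u,v)+c$ for every directed subpath $uPv$ of $P$; a (anti-)ray is quasi-geodesic if for some $\gamma\ge1,c\ge0$ all its finite directed subpaths are $(\gamma,c)$-quasi-geodesics. For quasi-geodesic rays or anti-rays write $R_1\le R_2$ if there is $M\ge0$ such that for every $r\ge0$ and every vertex $x$ there is a directed path from $R_1$ to $R_2$ of length at most $M$ outside of $\mathcal B^+_r(x)\cup\mathcal B^-_r(x)$; $R_1\approx R_2$ means $R_1\le R_2\le R_1$, an equivalence relation in this setting. $\partial D$ is the set of its classes. *)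

theory Defs
  imports Complex_Main "HOL-Library.Extended_Real" "HOL-Library.Multiset"
begin

text \<open>A digraph is given by its edge relation \<open>E\<close>; its vertex set is the whole type.
  Paths are nonempty vertex lists, in which vertices may be repeated.\<close>

definition dipath :: "'a rel \<Rightarrow> 'a list \<Rightarrow> bool" where
  "dipath E p \<longleftrightarrow> p \<noteq> [] \<and> successively (\<lambda>x y. (x, y) \<in> E) p"

definition dipath_betw :: "'a rel \<Rightarrow> 'a \<Rightarrow> 'a list \<Rightarrow> 'a \<Rightarrow> bool" where
  "dipath_betw E x p y \<longleftrightarrow> dipath E p \<and> hd p = x \<and> last p = y"

definition plen :: "'a list \<Rightarrow> nat" where
  "plen p = length p - 1"

text \<open>The infimum of the empty set in \<^typ>\<open>enat\<close> is \<open>\<infinity>\<close>.\<close>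

definition ddist :: "'a rel \<Rightarrow> 'a \<Rightarrow> 'a \<Rightarrow> enat" where
  "ddist E x y = (INF p \<in> {p. dipath_betw E x p y}. enat (plen p))"

definition out_ball :: "'a rel \<Rightarrow> real \<Rightarrow> 'a \<Rightarrow> 'a set" where
  "out_ball E r x = {y. ereal_of_enat (ddist E x y) \<le> ereal r}"

definition in_ball :: "'a rel \<Rightarrow> real \<Rightarrow> 'a \<Rightarrow> 'a set" where
  "in_ball E r x = {y. ereal_of_enat (ddist E y x) \<le> ereal r}"

definition out_ball_set :: "'a rel \<Rightarrow> real \<Rightarrow> 'a set \<Rightarrow> 'a set" where
  "out_ball_set E r Y = (\<Union>y\<in>Y. out_ball E r y)"

definition in_ball_set :: "'a rel \<Rightarrow> real \<Rightarrow> 'a set \<Rightarrow> 'a set" where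
  "in_ball_set E r Y = (\<Union>y\<in>Y. in_ball E r y)"

definition geodesic :: "'a rel \<Rightarrow> 'a list \<Rightarrow> bool" where
  "geodesic E p \<longleftrightarrow> dipath E p \<and> enat (plen p) = ddist E (hd p) (last p)"

definition geodesic_side :: "'a rel \<Rightarrow> 'a \<Rightarrow> 'a \<Rightarrow> 'a list \<Rightarrow> bool" where
  "geodesic_side E x y p \<longleftrightarrow>
     geodesic E p \<and> (hd p = x \<and> last p = y \<or> hd p = y \<and> last p = x)"

definition geodesic_triangle ::
  "'a rel \<Rightarrow> 'a \<Rightarrow> 'a \<Rightarrow> 'a \<Rightarrow> 'a list \<Rightarrow> 'a list \<Rightarrow> 'a list \<Rightarrow> bool" where
  "geodesic_triangle E x y z s t u \<longleftrightarrow>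
     geodesic_side E x y s \<and> geodesic_side E y z t \<and> geodesic_side E z x u"

text \<open>The multiset equation lets \<open>P, Q, R\<close> range over all labellings of the sides \<open>s, t, u\<close>.\<close>

definition thin_triangle :: "'a rel \<Rightarrow> real \<Rightarrow> 'a list \<Rightarrow> 'a list \<Rightarrow> 'a list \<Rightarrow> bool" where
  "thin_triangle E \<delta> s t u \<longleftrightarrow>
     (\<forall>P Q R. {#P, Q, R#} = {#s, t, u#} \<longrightarrow>
        hd P \<in> {hd Q, last Q} \<longrightarrow> last P \<in> {hd R, last R} \<longrightarrow>
        set P \<subseteq> out_ball_set E \<delta> (set Q) \<union> in_ball_set E \<delta> (set R))"

definition hyperbolic_digraph :: "'a rel \<Rightarrow> bool" where
  "hyperbolic_digraph E \<longleftrightarrow>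
     (\<exists>\<delta>\<ge>0. \<forall>x y z s t u. geodesic_triangle E x y z s t u \<longrightarrow> thin_triangle E \<delta> s t u)"

text \<open>An anti-ray is enumerated from its last vertex, against the direction of its edges.\<close>

definition ray :: "'a rel \<Rightarrow> (nat \<Rightarrow> 'a) \<Rightarrow> bool" where
  "ray E R \<longleftrightarrow> inj R \<and> (\<forall>i. (R i, R (Suc i)) \<in> E)"

definition anti_ray :: "'a rel \<Rightarrow> (nat \<Rightarrow> 'a) \<Rightarrow> bool" where
  "anti_ray E R \<longleftrightarrow> inj R \<and> (\<forall>i. (R (Suc i), R i) \<in> E)"

definition dipath_betw_sets :: "'a rel \<Rightarrow> 'a set \<Rightarrow> 'a list \<Rightarrow> 'a set \<Rightarrow> bool" where
  "dipath_betw_sets E X p Y \<longleftrightarrow> dipath E p \<and> hd p \<in> X \<and> last p \<in> Y"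

definition end_le :: "'a rel \<Rightarrow> (nat \<Rightarrow> 'a) \<Rightarrow> (nat \<Rightarrow> 'a) \<Rightarrow> bool" where
  "end_le E R1 R2 \<longleftrightarrow>
     (\<exists>\<P>. infinite \<P> \<and> (\<forall>p\<in>\<P>. dipath_betw_sets E (range R1) p (range R2)) \<and>
        pairwise (\<lambda>p q. disjnt (set p) (set q)) \<P>)"

definition all_rays :: "'a rel \<Rightarrow> (nat \<Rightarrow> 'a) set" where
  "all_rays E = {R. ray E R \<or> anti_ray E R}"

definition end_rel :: "'a rel \<Rightarrow> (nat \<Rightarrow> 'a) rel" where
  "end_rel E = {(R1, R2). R1 \<in> all_rays E \<and> R2 \<in> all_rays E \<and> end_le E R1 R2 \<and> end_le E R2 R1}"

definition digraph_ends :: "'a rel \<Rightarrow> (nat \<Rightarrow> 'a) set set" where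
  "digraph_ends E = all_rays E // end_rel E"

definition quasi_geodesic :: "'a rel \<Rightarrow> real \<Rightarrow> real \<Rightarrow> 'a list \<Rightarrow> bool" where
  "quasi_geodesic E \<gamma> c p \<longleftrightarrow> dipath E p \<and>
     (\<forall>i j. i \<le> j \<longrightarrow> j < length p \<longrightarrow>
        ereal (real (j - i)) \<le> ereal \<gamma> * ereal_of_enat (ddist E (p ! i) (p ! j)) + ereal c)"

definition quasi_geodesic_ray :: "'a rel \<Rightarrow> (nat \<Rightarrow> 'a) \<Rightarrow> bool" where
  "quasi_geodesic_ray E R \<longleftrightarrow> ray E R \<and>
     (\<exists>\<gamma>\<ge>1. \<exists>c\<ge>0. \<forall>i j. i \<le> j \<longrightarrow> quasi_geodesic E \<gamma> c (map R [i..<Suc j]))"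

definition quasi_geodesic_anti_ray :: "'a rel \<Rightarrow> (nat \<Rightarrow> 'a) \<Rightarrow> bool" where
  "quasi_geodesic_anti_ray E R \<longleftrightarrow> anti_ray E R \<and>
     (\<exists>\<gamma>\<ge>1. \<exists>c\<ge>0. \<forall>i j. i \<le> j \<longrightarrow> quasi_geodesic E \<gamma> c (rev (map R [i..<Suc j])))"

definition qg_rays :: "'a rel \<Rightarrow> (nat \<Rightarrow> 'a) set" where
  "qg_rays E = {R. quasi_geodesic_ray E R \<or> quasi_geodesic_anti_ray E R}"

definition bd_le :: "'a rel \<Rightarrow> (nat \<Rightarrow> 'a) \<Rightarrow> (nat \<Rightarrow> 'a) \<Rightarrow> bool" where
  "bd_le E R1 R2 \<longleftrightarrow>
     (\<exists>M\<ge>0. \<forall>r\<ge>0. \<forall>x. \<exists>p. dipath_betw_sets E (range R1) p (range R2) \<and>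
        real (plen p) \<le> M \<and> set p \<inter> (out_ball E r x \<union> in_ball E r x) = {})"

definition bd_rel :: "'a rel \<Rightarrow> (nat \<Rightarrow> 'a) rel" where
  "bd_rel E = {(R1, R2). R1 \<in> qg_rays E \<and> R2 \<in> qg_rays E \<and> bd_le E R1 R2 \<and> bd_le E R2 R1}"

definition qg_boundary :: "'a rel \<Rightarrow> (nat \<Rightarrow> 'a) set set" where
  "qg_boundary E = qg_rays E // bd_rel E"

inductive_set subsemigroup_span :: "'a::semigroup_mult set \<Rightarrow> 'a set" for A where
  base: "a \<in> A \<Longrightarrow> a \<in> subsemigroup_span A"
| mult: "x \<in> subsemigroup_span A \<Longrightarrow> y \<in> subsemigroup_span A \<Longrightarrow> x * y \<in> subsemigroup_span A"

definition finite_generating_set :: "'a::semigroup_mult set \<Rightarrow> bool" where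
  "finite_generating_set A \<longleftrightarrow> finite A \<and> subsemigroup_span A = UNIV"

definition cayley_digraph :: "'a::semigroup_mult set \<Rightarrow> 'a rel" where
  "cayley_digraph A = {(x, x * a) | x a. a \<in> A}"

definition right_cancellative :: "'a::semigroup_mult itself \<Rightarrow> bool" where
  "right_cancellative _ \<longleftrightarrow> (\<forall>x y z :: 'a. x * z = y * z \<longrightarrow> x = y)"

definition hyperbolic_semigroup :: "'a::semigroup_mult itself \<Rightarrow> bool" where
  "hyperbolic_semigroup _ \<longleftrightarrow>
     (\<exists>A :: 'a set. finite_generating_set A \<and> hyperbolic_digraph (cayley_digraph A))"

text \<open>For right cancellative semigroups the number of ends does not depend on \<open>A\<close>.\<close>

definition one_ended_semigroup :: "'a::semigroup_mult itself \<Rightarrow> bool" where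
  "one_ended_semigroup _ \<longleftrightarrow>
     (\<exists>A :: 'a set. finite_generating_set A \<and> card (digraph_ends (cayley_digraph A)) = 1)"

end

theory Submission imports Defs begin

text \<open>
  In a hyperbolic digraph of bounded degree the geodesics that leave a fixed vertex \<open>b\<close> behave as
  in a tree: geodesics from \<open>b\<close> to the two ends of an edge run close together until shortly before
  that edge. Suppose that the geodesic rays from \<open>b\<close> have only finitely many directions, that is,
  classes under running close to each other. Then every vertex far from \<open>b\<close> has exactly one
  direction (\<open>far_vertices_tracked\<close>, \<open>tracks_adjacent\<close>), and adjacent far vertices have the same
  one. A digraph with one end connects any two rays outside every finite set, so there is only one
  direction (\<open>far_connected_below\<close>). Hence either some vertex, in the digraph or in its reversal, has
  infinitely many directions, and they give infinitely many boundary points, or any two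
  quasi-geodesic rays or anti-rays are related.

  Three points need care.

  \<^item> Distances are directed. Bounded degree compensates for this: if two vertices reach, or are
    reached from, a common vertex within \<open>r\<close> steps, and one of them reaches the other at all, then
    it does so within linearly many steps (\<open>reaches_of_common_target\<close>). Consequently
    distances within a strong component are symmetric up to a linear factor, and \<open>d(b, \<cdot>)\<close> changes
    by a bounded amount along an edge, also against its direction (\<open>dst_edge_le\<close>).

  \<^item> The boundary is made of quasi-geodesics, which are compared with geodesics by
    \<open>quasi_geodesic_stability\<close>. The pair of distances \<open>(d(x, \<cdot>), d(\<cdot>, y))\<close> is there a
    substitute for an undirected metric on the vertices between \<open>x\<close> and \<open>y\<close>: it is Lipschitz for
    steps in both directions, and a vertex whose coordinates are close to those of a vertex of a
    geodesic from \<open>x\<close> to \<open>y\<close> reaches that geodesic, and is reached from it, in few steps.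

  \<^item> Boundary, hyperbolicity and ends may be given by three different generating sets. A geodesic
    ray of one Cayley digraph is replaced by a geodesic ray of another one that stays within
    bounded distance of it in both directions (\<open>geodesic_ray_change_digraph\<close>), again by stability
    and a compactness argument.

  Two anti-rays are treated by reversing all edges. A ray and an anti-ray that are joined by paths
  in both directions outside every finite set force the anti-ray to stay eventually in one strong
  component, where it can be traversed backwards as a quasi-geodesic ray.
\<close>

section \<open>Directed distance by step counting\<close>

definition reaches :: "'a rel \<Rightarrow> nat \<Rightarrow> 'a \<Rightarrow> 'a \<Rightarrow> bool" where
  "reaches E n x y \<longleftrightarrow> (\<exists>m\<le>n. (x, y) \<in> E ^^ m)"

definition dst :: "'a rel \<Rightarrow> 'a \<Rightarrow> 'a \<Rightarrow> nat" where
  "dst E x y = (LEAST n. (x, y) \<in> E ^^ n)"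

lemma reaches_refl [simp]: "reaches E n x x"
  unfolding reaches_def by (intro exI[of _ 0]) auto

lemma reaches_trans: "reaches E n x y \<Longrightarrow> reaches E m y z \<Longrightarrow> reaches E (n + m) x z"
  unfolding reaches_def by (meson add_mono relpow_trans)

lemma reaches_mono: "reaches E n x y \<Longrightarrow> n \<le> m \<Longrightarrow> reaches E m x y"
  unfolding reaches_def by (meson le_trans)

lemma reaches_trans_le: "reaches E n x y \<Longrightarrow> reaches E m y z \<Longrightarrow> n + m \<le> k \<Longrightarrow> reaches E k x z"
  using reaches_trans reaches_mono by metis

lemma reaches_edge: "(x, y) \<in> E \<Longrightarrow> reaches E (Suc 0) x y"
  unfolding reaches_def by (intro exI[of _ "Suc 0"]) simp

lemma reaches_0 [simp]: "reaches E 0 x y \<longleftrightarrow> x = y"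
  unfolding reaches_def by simp

lemma reaches_rtrancl: "reaches E n x y \<Longrightarrow> (x, y) \<in> E\<^sup>*"
  unfolding reaches_def by (meson relpow_imp_rtrancl)

lemma dst_relpow: "(x, y) \<in> E\<^sup>* \<Longrightarrow> (x, y) \<in> E ^^ dst E x y"
  unfolding dst_def by (drule rtrancl_imp_relpow, erule exE, rule LeastI)

lemma reaches_dst: "(x, y) \<in> E\<^sup>* \<Longrightarrow> reaches E (dst E x y) x y"
  unfolding reaches_def by (intro exI[of _ "dst E x y"] conjI order_refl dst_relpow)

lemma dst_le_relpow: "(x, y) \<in> E ^^ n \<Longrightarrow> dst E x y \<le> n"
  unfolding dst_def by (rule Least_le)

lemma dst_le: "reaches E n x y \<Longrightarrow> dst E x y \<le> n"
  unfolding reaches_def by (auto dest: dst_le_relpow)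

lemma reaches_iff: "reaches E n x y \<longleftrightarrow> (x, y) \<in> E\<^sup>* \<and> dst E x y \<le> n"
  using dst_le reaches_rtrancl reaches_dst reaches_mono by metis

lemma dst_refl [simp]: "dst E x x = 0"
  using dst_le[of E 0 x x] by simp

lemma dst_triangle: "(x, y) \<in> E\<^sup>* \<Longrightarrow> (y, z) \<in> E\<^sup>* \<Longrightarrow> dst E x z \<le> dst E x y + dst E y z"
  by (intro dst_le reaches_trans[of _ _ _ y] reaches_dst)

lemma dst_reaches_right: "(x, y) \<in> E\<^sup>* \<Longrightarrow> reaches E n y z \<Longrightarrow> dst E x z \<le> dst E x y + n"
  by (intro dst_le reaches_trans[of _ _ _ y] reaches_dst)

lemma dst_reaches_left: "reaches E n x y \<Longrightarrow> (y, z) \<in> E\<^sup>* \<Longrightarrow> dst E x z \<le> n + dst E y z"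
  by (intro dst_le reaches_trans[of _ _ _ y] reaches_dst)

lemma relpow_converse:
  fixes E :: "'a rel"
  shows "(x, y) \<in> (E\<inverse>) ^^ n \<longleftrightarrow> (y, x) \<in> E ^^ n"
proof (induction n arbitrary: x y)
  case (Suc n)
  have "(x, y) \<in> (E\<inverse>) ^^ Suc n \<longleftrightarrow> (\<exists>z. (x, z) \<in> (E\<inverse>) ^^ n \<and> (z, y) \<in> E\<inverse>)"
    by auto
  also have "\<dots> \<longleftrightarrow> (\<exists>z. (y, z) \<in> E \<and> (z, x) \<in> E ^^ n)"
    using Suc.IH by auto
  also have "\<dots> \<longleftrightarrow> (y, x) \<in> E ^^ Suc n"
    by (meson relpow_Suc_D2 relpow_Suc_I2)
  finally show ?case .
qed auto

lemma reaches_converse [simp]: "reaches (E\<inverse>) n x y \<longleftrightarrow> reaches E n y x"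
  unfolding reaches_def relpow_converse ..

lemma dst_converse [simp]: "dst (E\<inverse>) x y = dst E y x"
  unfolding dst_def relpow_converse ..

lemma reaches_step_mono:
  assumes "\<And>x y. (x, y) \<in> X \<Longrightarrow> reaches E k x y" and "reaches X n x y"
  shows "reaches E (k * n) x y"
proof -
  have "(x, y) \<in> X ^^ m \<Longrightarrow> reaches E (k * m) x y" for m
  proof (induction m arbitrary: y)
    case (Suc m)
    then obtain z where "(x, z) \<in> X ^^ m" "(z, y) \<in> X"
      by auto
    then have "reaches E (k * m) x z" "reaches E k z y"
      using Suc.IH assms(1) by auto
    then show ?case
      by (rule reaches_trans_le) simp
  qed simp
  then show ?thesis
    using assms(2) unfolding reaches_def[of X] by (meson mult_le_mono2 reaches_mono)
qed

lemma rtrancl_step_mono: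
  assumes "\<And>x y. (x, y) \<in> X \<Longrightarrow> reaches E k x y" and "(x, y) \<in> X\<^sup>*"
  shows "(x, y) \<in> E\<^sup>*"
  using reaches_step_mono[OF assms(1) reaches_dst[OF assms(2)]] by (rule reaches_rtrancl)

section \<open>Geodesics\<close>

definition geodesic_upto :: "'a rel \<Rightarrow> (nat \<Rightarrow> 'a) \<Rightarrow> nat \<Rightarrow> bool" where
  "geodesic_upto E p n \<longleftrightarrow> (\<forall>i<n. (p i, p (Suc i)) \<in> E) \<and> dst E (p 0) (p n) = n"

text \<open>Thinness speaks about sides as vertex sets, so a geodesic is recorded by its ends and its set
  of vertices.\<close>
definition segment :: "'a rel \<Rightarrow> 'a \<Rightarrow> 'a \<Rightarrow> 'a set \<Rightarrow> bool" where
  "segment E x y X \<longleftrightarrow> (\<exists>p n. geodesic_upto E p n \<and> p 0 = x \<and> p n = y \<and> X = p ` {..n})"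

lemma path_relpow:
  assumes "\<forall>i<n. (p i, p (Suc i)) \<in> E" "i \<le> j" "j \<le> n"
  shows "(p i, p j) \<in> E ^^ (j - i)"
  unfolding relpow_fun_conv using assms by (intro exI[of _ "\<lambda>l. p (l + i)"]) auto

lemma path_reaches:
  assumes "\<forall>i<n. reaches E k (p i) (p (Suc i))" "i \<le> j" "j \<le> n"
  shows "reaches E (k * (j - i)) (p i) (p j)"
  using assms(2,3)
proof (induction j rule: dec_induct)
  case (step j)
  then have "reaches E (k * (j - i)) (p i) (p j)" "reaches E k (p j) (p (Suc j))"
    using assms(1) by auto
  then show ?case
    by (rule reaches_trans_le) (use step in \<open>simp add: Suc_diff_le\<close>)
qed simp

lemma geodesic_uptoD:
  assumes "geodesic_upto E p n" "i \<le> j" "j \<le> n"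
  shows "reaches E (j - i) (p i) (p j)" "dst E (p i) (p j) = j - i" "(p i, p j) \<in> E\<^sup>*"
proof -
  have *: "(p a, p b) \<in> E ^^ (b - a)" if "a \<le> b" "b \<le> n" for a b
    using path_relpow[of n p E a b] assms(1) that unfolding geodesic_upto_def by blast
  show 1: "reaches E (j - i) (p i) (p j)"
    unfolding reaches_def using *[OF assms(2,3)] by blast
  show r: "(p i, p j) \<in> E\<^sup>*"
    using 1 by (rule reaches_rtrancl)
  have "dst E (p 0) (p n) \<le> dst E (p 0) (p i) + dst E (p i) (p n)"
    "dst E (p i) (p n) \<le> dst E (p i) (p j) + dst E (p j) (p n)"
    using *[of 0 i] *[of i j] *[of j n] *[of i n] assms
    by (auto intro!: dst_triangle intro: relpow_imp_rtrancl)
  moreover have "dst E (p 0) (p i) \<le> i" "dst E (p i) (p j) \<le> j - i" "dst E (p j) (p n) \<le> n - j"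
    using *[of 0 i] *[of i j] *[of j n] assms by (auto dest: dst_le_relpow)
  moreover have "dst E (p 0) (p n) = n"
    using assms(1) unfolding geodesic_upto_def by blast
  ultimately show "dst E (p i) (p j) = j - i"
    using assms(2,3) by linarith
qed

lemma geodesic_upto_mono: "geodesic_upto E p n \<Longrightarrow> m \<le> n \<Longrightarrow> geodesic_upto E p m"
  using geodesic_uptoD(2)[of E p n 0 m] unfolding geodesic_upto_def by auto

lemma geodesic_upto_shift:
  assumes "geodesic_upto E p n" "i + m \<le> n"
  shows "geodesic_upto E (\<lambda>l. p (l + i)) m"
  using geodesic_uptoD(2)[OF assms(1), of i "i + m"] assms unfolding geodesic_upto_def
  by (auto simp: add.commute)

lemma geodesic_upto_exists:
  assumes "(x, y) \<in> E\<^sup>*"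
  shows "\<exists>p. geodesic_upto E p (dst E x y) \<and> p 0 = x \<and> p (dst E x y) = y"
  using dst_relpow[OF assms] unfolding relpow_fun_conv geodesic_upto_def by auto

lemma segment_exists: "(x, y) \<in> E\<^sup>* \<Longrightarrow> \<exists>X. segment E x y X"
  using geodesic_upto_exists unfolding segment_def by metis

lemma segment_of_path: "geodesic_upto E p n \<Longrightarrow> i \<le> j \<Longrightarrow> j \<le> n \<Longrightarrow> segment E (p i) (p j) (p ` {i..j})"
proof -
  assume a: "geodesic_upto E p n" "i \<le> j" "j \<le> n"
  have "p ` {i..j} = (\<lambda>l. p (l + i)) ` {..j - i}"
  proof -
    have "{i..j} = (\<lambda>l. l + i) ` {..j - i}"
    proof (intro equalityI subsetI)
      fix l assume "l \<in> {i..j}"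
      then show "l \<in> (\<lambda>l. l + i) ` {..j - i}"
        by (intro image_eqI[of _ _ "l - i"]) auto
    qed (use a in auto)
    then show ?thesis by (simp add: image_image)
  qed
  then show ?thesis
    unfolding segment_def using geodesic_upto_shift[OF a(1), of i "j - i"] a
    by (intro exI[of _ "\<lambda>l. p (l + i)"] exI[of _ "j - i"]) auto
qed

lemma segment_refl [simp]: "segment E x x {x}"
  unfolding segment_def geodesic_upto_def by (intro exI[of _ "\<lambda>_. x"] exI[of _ 0]) auto

lemma segment_ends: "segment E x y X \<Longrightarrow> x \<in> X \<and> y \<in> X"
  unfolding segment_def by auto

lemma segment_reach: "segment E x y X \<Longrightarrow> (x, y) \<in> E\<^sup>*"
  unfolding segment_def using geodesic_uptoD(3) by blast

lemma segment_between:
  assumes "segment E x y X" "v \<in> X"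
  shows "(x, v) \<in> E\<^sup>*" "(v, y) \<in> E\<^sup>*" "dst E x v + dst E v y = dst E x y"
    "reaches E (dst E x y) x v" "reaches E (dst E x y) v y"
proof -
  obtain p n i where p: "geodesic_upto E p n" "p 0 = x" "p n = y" "i \<le> n" "v = p i"
    using assms unfolding segment_def by auto
  show 1: "(x, v) \<in> E\<^sup>*" "(v, y) \<in> E\<^sup>*" "dst E x v + dst E v y = dst E x y"
    using geodesic_uptoD[OF p(1), of 0 i] geodesic_uptoD[OF p(1), of i n]
      geodesic_uptoD[OF p(1), of 0 n] p by auto
  show "reaches E (dst E x y) x v" "reaches E (dst E x y) v y"
    unfolding reaches_iff using 1 by auto
qed

lemma segment_point: "segment E x y X \<Longrightarrow> m \<le> dst E x y \<Longrightarrow> \<exists>v\<in>X. dst E x v = m"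
  unfolding segment_def using geodesic_uptoD(2)[of E _ _ 0 m] geodesic_uptoD(2)[of E]
  by (metis atMost_iff diff_zero image_eqI order_refl zero_le)

lemma segment_order:
  assumes "segment E x y X" "u \<in> X" "v \<in> X" "dst E x u \<le> dst E x v"
  shows "reaches E (dst E x v - dst E x u) u v"
proof -
  obtain p n i j where p: "geodesic_upto E p n" "p 0 = x" "p n = y" "i \<le> n" "u = p i" "j \<le> n" "v = p j"
    using assms unfolding segment_def by auto
  have "dst E x u = i" "dst E x v = j"
    using geodesic_uptoD(2)[OF p(1), of 0] p by auto
  then show ?thesis
    using geodesic_uptoD(1)[OF p(1), of i j] p assms(4) by auto
qed

lemma segment_initial:
  assumes "segment E x y X" "v \<in> X"
  shows "\<exists>Y\<subseteq>X. segment E x v Y \<and> (\<forall>u\<in>X. dst E x u \<le> dst E x v \<longrightarrow> u \<in> Y)"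
proof -
  obtain p n i where p: "geodesic_upto E p n" "p 0 = x" "p n = y" "i \<le> n" "v = p i" "X = p ` {..n}"
    using assms unfolding segment_def by auto
  have d: "dst E x (p j) = j" if "j \<le> n" for j
    using geodesic_uptoD(2)[OF p(1), of 0 j] p that by simp
  have "segment E x v (p ` {0..i})"
    using segment_of_path[OF p(1), of 0 i] p by auto
  then show ?thesis
    using p d by (intro exI[of _ "p ` {0..i}"]) auto
qed

lemma card_segment: "segment E x y X \<Longrightarrow> finite X \<and> card X = Suc (dst E x y)"
proof -
  assume "segment E x y X"
  then obtain p n where p: "geodesic_upto E p n" "p 0 = x" "p n = y" "X = p ` {..n}"
    unfolding segment_def by auto
  have d: "dst E x (p j) = j" if "j \<le> n" for j
    using geodesic_uptoD(2)[OF p(1), of 0 j] p that by simp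
  have "inj_on p {..n}"
    by (rule inj_on_inverseI[of _ "dst E x"]) (use d in auto)
  then show ?thesis
    using p d[of n] by (auto simp: card_image)
qed

lemma geodesic_upto_converse:
  assumes "geodesic_upto E p n"
  shows "geodesic_upto (E\<inverse>) (\<lambda>i. p (n - i)) n"
  unfolding geodesic_upto_def
proof (intro conjI allI impI)
  fix i assume "i < n"
  then have "(p (n - Suc i), p (Suc (n - Suc i))) \<in> E"
    using assms unfolding geodesic_upto_def by simp
  then show "(p (n - i), p (n - Suc i)) \<in> E\<inverse>"
    using \<open>i < n\<close> by (simp add: Suc_diff_Suc)
qed (use assms in \<open>simp add: geodesic_upto_def\<close>)

lemma segment_converse [simp]: "segment (E\<inverse>) x y X \<longleftrightarrow> segment E y x X"
proof -
  have *: "segment (E\<inverse>) x y X" if seg: "segment E y x X" for E :: "'a rel" and x y X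
  proof -
    obtain p n where p: "geodesic_upto E p n" "p 0 = y" "p n = x" "X = p ` {..n}"
      using seg unfolding segment_def by blast
    have "(\<lambda>i. n - i) ` {..n} = {..n}"
    proof (intro equalityI subsetI)
      fix i assume "i \<in> {..n}"
      then show "i \<in> (\<lambda>i. n - i) ` {..n}"
        by (intro image_eqI[of _ _ "n - i"]) auto
    qed auto
    then have "p ` {..n} = (\<lambda>i. p (n - i)) ` {..n}"
      by (metis (no_types, lifting) image_cong image_image)
    then show ?thesis
      unfolding segment_def using geodesic_upto_converse[OF p(1)] p
      by (intro exI[of _ "\<lambda>i. p (n - i)"] exI[of _ n]) auto
  qed
  show ?thesis
    using *[of E y x X] *[of "E\<inverse>" x y X] by auto
qed

section \<open>Thin digraphs of bounded degree\<close>

text \<open>Twice the number of vertices on a geodesic of length \<open>r\<close>, times the size of a \<open>\<delta>\<close>-ball.\<close>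
definition cone_bound :: "nat \<Rightarrow> nat \<Rightarrow> nat \<Rightarrow> nat" where
  "cone_bound \<delta> K r = 2 * Suc r * Suc K ^ \<delta>"

text \<open>The amount by which a distance function can change along one edge, in either direction.\<close>
definition potential_bound :: "nat \<Rightarrow> nat \<Rightarrow> nat" where
  "potential_bound \<delta> K = cone_bound \<delta> K (Suc \<delta>) + \<delta> + 2"

text \<open>Reversing all edges exchanges the two sides \<open>Y\<close> and \<open>Z\<close> and the two kinds of balls, so the
  axioms are self-dual; most statements below come in dual pairs of which only one is proved.\<close>
locale thin_digraph =
  fixes E :: "'a rel" and \<delta> K :: nat
  assumes thin: "segment E x y X \<Longrightarrow> segment E x z Y \<or> segment E z x Y \<Longrightarrow>
      segment E y z Z \<or> segment E z y Z \<Longrightarrow> v \<in> X \<Longrightarrow>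
      (\<exists>q\<in>Y. reaches E \<delta> q v) \<or> (\<exists>q\<in>Z. reaches E \<delta> v q)"
    and out_degree: "finite {y. (x, y) \<in> E}" "card {y. (x, y) \<in> E} \<le> K"
    and in_degree: "finite {y. (y, x) \<in> E}" "card {y. (y, x) \<in> E} \<le> K"
begin

lemma thin_converse: "thin_digraph (E\<inverse>) \<delta> K"
proof
  fix x y z X Y Z v
  assume a: "segment (E\<inverse>) x y X" "segment (E\<inverse>) x z Y \<or> segment (E\<inverse>) z x Y"
    "segment (E\<inverse>) y z Z \<or> segment (E\<inverse>) z y Z" "v \<in> X"
  show "(\<exists>q\<in>Y. reaches (E\<inverse>) \<delta> q v) \<or> (\<exists>q\<in>Z. reaches (E\<inverse>) \<delta> v q)"
    using thin[of y x X z Z Y v] a by auto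
qed (use in_degree out_degree in auto)

text \<open>Each further step multiplies the number of vertices by at most \<open>Suc K\<close>.\<close>
lemma out_ball_card: "finite {y. reaches E r x y} \<and> card {y. reaches E r x y} \<le> Suc K ^ r"
proof (induction r)
  case 0
  have "{y. reaches E 0 x y} = {x}" by auto
  then show ?case by simp
next
  case (Suc r)
  let ?U = "\<Union>z\<in>{y. reaches E r x y}. insert z {y. (z, y) \<in> E}"
  have sub: "{y. reaches E (Suc r) x y} \<subseteq> ?U"
  proof
    fix y assume "y \<in> {y. reaches E (Suc r) x y}"
    then obtain m where m: "m \<le> Suc r" "(x, y) \<in> E ^^ m"
      unfolding reaches_def by blast
    show "y \<in> ?U"
    proof (cases "m \<le> r")
      case True
      then show ?thesis using m unfolding reaches_def by blast
    next
      case False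
      then obtain z where "(x, z) \<in> E ^^ r" "(z, y) \<in> E"
        using m by (auto simp: not_le le_Suc_eq)
      then show ?thesis unfolding reaches_def by blast
    qed
  qed
  have fin: "finite ?U" using Suc.IH out_degree(1) by auto
  have "card ?U \<le> (\<Sum>z\<in>{y. reaches E r x y}. card (insert z {y. (z, y) \<in> E}))"
    using Suc.IH by (intro card_UN_le) auto
  also have "\<dots> \<le> (\<Sum>z\<in>{y. reaches E r x y}. Suc K)"
    by (intro sum_mono le_trans[OF card_insert_le_m1] ) (use out_degree in \<open>auto simp: card_insert_if\<close>)
  also have "\<dots> \<le> Suc K ^ Suc r"
    using Suc.IH by (simp add: mult.commute del: mult_Suc)
  finally show ?case
    using sub fin card_mono[OF fin sub] finite_subset by (meson le_trans)
qed

lemma finite_out_ball: "finite {y. reaches E r x y}" and card_out_ball: "card {y. reaches E r x y} \<le> Suc K ^ r"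
  using out_ball_card by auto

lemma finite_in_ball: "finite {y. reaches E r y x}" and card_in_ball: "card {y. reaches E r y x} \<le> Suc K ^ r"
  using thin_digraph.out_ball_card[OF thin_converse, of r x] by auto

text \<open>A geodesic from \<open>a\<close> to \<open>b\<close> is thin with respect to the two short sides towards \<open>z\<close>, and
  only boundedly many vertices are \<open>\<delta>\<close>-close to those.\<close>
lemma reaches_of_common_target:
  assumes "reaches E r a z" "reaches E r b z" "(a, b) \<in> E\<^sup>*"
  shows "reaches E (cone_bound \<delta> K r) a b"
proof -
  obtain X Y Z where seg: "segment E a b X" "segment E a z Y" "segment E b z Z"
    using assms segment_exists reaches_rtrancl by metis
  let ?U = "(\<Union>q\<in>Y. {v. reaches E \<delta> q v}) \<union> (\<Union>q\<in>Z. {v. reaches E \<delta> v q})"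
  have sub: "X \<subseteq> ?U"
    using thin[OF seg(1), of z Y Z] seg by auto
  have finY: "finite Y" "card Y \<le> Suc r" and finZ: "finite Z" "card Z \<le> Suc r"
    using card_segment[OF seg(2)] card_segment[OF seg(3)] dst_le[OF assms(1)] dst_le[OF assms(2)] by auto
  have fin: "finite ?U"
    using finY finZ finite_out_ball finite_in_ball by auto
  have "card ?U \<le> card (\<Union>q\<in>Y. {v. reaches E \<delta> q v}) + card (\<Union>q\<in>Z. {v. reaches E \<delta> v q})"
    by (rule card_Un_le)
  also have "\<dots> \<le> (\<Sum>q\<in>Y. card {v. reaches E \<delta> q v}) + (\<Sum>q\<in>Z. card {v. reaches E \<delta> v q})"
    using finY finZ by (intro add_mono card_UN_le)
  also have "\<dots> \<le> (\<Sum>q\<in>Y. Suc K ^ \<delta>) + (\<Sum>q\<in>Z. Suc K ^ \<delta>)"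
    by (intro add_mono sum_mono card_out_ball card_in_ball)
  also have "\<dots> \<le> Suc r * Suc K ^ \<delta> + Suc r * Suc K ^ \<delta>"
    using finY finZ by (intro add_mono) (simp_all add: mult_le_mono1 del: mult_Suc power_Suc)
  also have "\<dots> = cone_bound \<delta> K r"
    unfolding cone_bound_def by simp
  finally have "card X \<le> cone_bound \<delta> K r"
    using card_mono[OF fin sub] by linarith
  then have "dst E a b \<le> cone_bound \<delta> K r"
    using card_segment[OF seg(1)] by linarith
  then show ?thesis
    unfolding reaches_iff using assms(3) by simp
qed

lemma reaches_of_common_source:
  assumes "reaches E r z a" "reaches E r z b" "(a, b) \<in> E\<^sup>*"
  shows "reaches E (cone_bound \<delta> K r) a b"
  using thin_digraph.reaches_of_common_target[OF thin_converse, of r b z a] assms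
  by (simp add: rtrancl_converse)

text \<open>Within a strong component distances are symmetric up to a linear factor.\<close>
lemma reaches_back:
  assumes "reaches E r b a" "(a, b) \<in> E\<^sup>*"
  shows "reaches E (cone_bound \<delta> K r) a b"
  using reaches_of_common_target[of r a a b] assms by simp

abbreviation "C \<equiv> potential_bound \<delta> K"

text \<open>A vertex \<open>w\<close> a little before \<open>u\<close> on a geodesic from \<open>p\<close> to \<open>u\<close> cannot be \<open>\<delta>\<close>-close to the edge
  \<open>(u, v)\<close>, because \<open>w\<close> and \<open>u\<close> would then have a common near target. By thinness \<open>w\<close> is reached
  from a geodesic from \<open>p\<close> to \<open>v\<close>, so \<open>v\<close> is not much closer to \<open>p\<close> than \<open>u\<close>.\<close>
lemma dst_edge_le:
  assumes "(p, u) \<in> E\<^sup>*" "(u, v) \<in> E"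
  shows "dst E p u \<le> dst E p v + C"
proof (cases "dst E p u \<le> cone_bound \<delta> K (Suc \<delta>) + 1")
  case True
  then show ?thesis unfolding potential_bound_def by simp
next
  case False
  let ?m = "cone_bound \<delta> K (Suc \<delta>) + 1"
  have pv: "(p, v) \<in> E\<^sup>*" using assms by auto
  obtain X where X: "segment E p u X" using segment_exists[OF assms(1)] by blast
  obtain Y where Y: "segment E p v Y" using segment_exists[OF pv] by blast
  obtain Z where Z: "segment E u v Z" using segment_exists[OF r_into_rtrancl[OF assms(2)]] by blast
  obtain w where w: "w \<in> X" "dst E p w = dst E p u - ?m"
    using segment_point[OF X, of "dst E p u - ?m"] by auto
  have wu: "(w, u) \<in> E\<^sup>*" "dst E w u = ?m"
    using segment_between[OF X w(1)] w(2) False by auto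
  have "\<not> reaches E \<delta> w q" if q: "q \<in> Z" for q
  proof
    assume wq: "reaches E \<delta> w q"
    have "dst E u v \<le> Suc 0" using assms(2) by (intro dst_le reaches_edge)
    then have "reaches E (Suc \<delta>) w v"
      using reaches_trans_le[OF wq segment_between(5)[OF Z q]] by simp
    moreover have "reaches E (Suc \<delta>) u v"
      using reaches_edge[OF assms(2)] by (rule reaches_mono) simp
    ultimately have "reaches E (cone_bound \<delta> K (Suc \<delta>)) w u"
      using reaches_of_common_target wu by blast
    then show False using dst_le wu by fastforce
  qed
  then obtain q where q: "q \<in> Y" "reaches E \<delta> q w"
    using thin[OF X, of v Y Z w] Y Z w by blast
  have "dst E p w \<le> dst E p q + \<delta>"
    using segment_between[OF Y q(1)] q(2) by (intro dst_reaches_right)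
  also have "dst E p q \<le> dst E p v" using segment_between(3)[OF Y q(1)] by simp
  finally show ?thesis using w False unfolding potential_bound_def by simp
qed

lemma dst_reaches_le:
  assumes "(p, u) \<in> E\<^sup>*" "reaches E r u v"
  shows "dst E p u \<le> dst E p v + C * r"
proof -
  have "dst E p u \<le> dst E p v + C * m" if "(u, v) \<in> E ^^ m" for m
    using that
  proof (induction m arbitrary: v)
    case (Suc m)
    then obtain w where w: "(u, w) \<in> E ^^ m" "(w, v) \<in> E" by auto
    have "(p, w) \<in> E\<^sup>*" using w assms(1) by (meson relpow_imp_rtrancl rtrancl_trans)
    then show ?case using dst_edge_le[OF _ w(2)] Suc.IH[OF w(1)] by fastforce
  qed simp
  moreover obtain m where "m \<le> r" "(u, v) \<in> E ^^ m" using assms(2) unfolding reaches_def by blast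
  ultimately show ?thesis by (meson add_left_mono le_trans mult_le_mono2)
qed

lemma dst_reaches_le_target:
  assumes "(v, p) \<in> E\<^sup>*" "reaches E r u v"
  shows "dst E v p \<le> dst E u p + C * r"
  using thin_digraph.dst_reaches_le[OF thin_converse, of p v r u] assms by (simp add: rtrancl_converse)

end

section \<open>Stability of quasi-geodesics\<close>

text \<open>On the vertices between \<open>x\<close> and \<open>y\<close> this is closeness for a symmetric pseudometric, the supremum
  distance of the coordinates \<open>d(x, \<cdot>)\<close> and \<open>d(\<cdot>, y)\<close>.\<close>
definition coordinate_close :: "'a rel \<Rightarrow> 'a \<Rightarrow> 'a \<Rightarrow> nat \<Rightarrow> 'a \<Rightarrow> 'a \<Rightarrow> bool" where
  "coordinate_close E x y r a b \<longleftrightarrow>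
     dst E x a \<le> dst E x b + r \<and> dst E x b \<le> dst E x a + r \<and>
     dst E a y \<le> dst E b y + r \<and> dst E b y \<le> dst E a y + r"

definition between :: "'a rel \<Rightarrow> 'a \<Rightarrow> 'a \<Rightarrow> 'a \<Rightarrow> bool" where
  "between E x y a \<longleftrightarrow> (x, a) \<in> E\<^sup>* \<and> (a, y) \<in> E\<^sup>*"

text \<open>Steps of length up to \<open>k\<close> are allowed, so that the notion is invariant under changing the
  digraph within its quasi-isometry class.\<close>
definition quasi_geodesic_upto :: "'a rel \<Rightarrow> nat \<Rightarrow> nat \<Rightarrow> nat \<Rightarrow> (nat \<Rightarrow> 'a) \<Rightarrow> nat \<Rightarrow> bool" where
  "quasi_geodesic_upto E k \<gamma> c W N \<longleftrightarrow>
     (\<forall>i<N. reaches E k (W i) (W (Suc i))) \<and>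
     (\<forall>i j m. i \<le> j \<longrightarrow> j \<le> N \<longrightarrow> reaches E m (W i) (W j) \<longrightarrow> j - i \<le> \<gamma> * m + c)"

lemma coordinate_close_converse [simp]:
  "coordinate_close (E\<inverse>) y x r a b \<longleftrightarrow> coordinate_close E x y r a b"
  unfolding coordinate_close_def by auto

lemma between_converse [simp]: "between (E\<inverse>) y x a \<longleftrightarrow> between E x y a"
  unfolding between_def by (auto simp: rtrancl_converse)

lemma coordinate_close_trans:
  "coordinate_close E x y r a b \<Longrightarrow> coordinate_close E x y s b d \<Longrightarrow> coordinate_close E x y (r + s) a d"
  unfolding coordinate_close_def by linarith

lemma coordinate_close_sym: "coordinate_close E x y r a b \<Longrightarrow> coordinate_close E x y r b a"
  unfolding coordinate_close_def by linarith

lemma coordinate_close_mono: "coordinate_close E x y r a b \<Longrightarrow> r \<le> s \<Longrightarrow> coordinate_close E x y s a b"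
  unfolding coordinate_close_def by linarith

lemma between_segment: "between E x y a \<Longrightarrow> between E x y b \<Longrightarrow> segment E a b X \<Longrightarrow> q \<in> X \<Longrightarrow> between E x y q"
  unfolding between_def using segment_between(1,2) by (meson rtrancl_trans)

lemma exponential_beats_linear: "\<exists>m0. \<forall>m\<ge>m0. A * m + B \<le> (2::nat) ^ m"
proof (rule exI[of _ "2 * (3 * A + B + 1)"], intro allI impI)
  fix m :: nat assume m: "2 * (3 * A + B + 1) \<le> m"
  define h where "h = m div 2"
  have h: "3 * A + B + 1 \<le> h" "m \<le> 2 * h + 1" "h + h \<le> m" using m unfolding h_def by auto
  have "A * m + B \<le> A * (2 * h + 1) + B" using h(2) by (intro add_mono mult_le_mono) auto
  also have "\<dots> = 2 * A * h + (A + B) * 1" by (simp add: algebra_simps)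
  also have "\<dots> \<le> 2 * A * h + (A + B) * h" using h(1) by (intro add_mono mult_le_mono) auto
  also have "\<dots> = (3 * A + B) * h" by (simp add: algebra_simps)
  also have "\<dots> \<le> h * h" using h(1) by (intro mult_le_mono) auto
  also have "\<dots> \<le> 2 ^ h * 2 ^ h" by (intro mult_le_mono less_imp_le less_exp)
  also have "\<dots> = 2 ^ (h + h)" by (simp add: power_add)
  also have "\<dots> \<le> 2 ^ m" using h(3) by (intro power_increasing) auto
  finally show "A * m + B \<le> 2 ^ m" .
qed

text \<open>The form in which the exponential divergence of geodesics contradicts the linear length of a
  quasi-geodesic.\<close>
lemma logarithm_beats_linear:
  "\<exists>\<kappa>. \<forall>D>\<kappa>. \<exists>m. a * m + b < D \<and> \<alpha> * D + \<beta> \<le> (2::nat) ^ m"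
proof -
  define a' where "a' = Suc a"
  obtain m0 where m0: "\<And>m. m \<ge> m0 \<Longrightarrow> \<alpha> * a' * m + (\<alpha> * (a' + b) + \<beta>) \<le> 2 ^ m"
    using exponential_beats_linear by blast
  show ?thesis
  proof (rule exI[of _ "a' * m0 + b"], intro allI impI)
    fix D assume D: "a' * m0 + b < D"
    define m where "m = (D - b - 1) div a'"
    have 1: "a' * m \<le> D - b - 1" unfolding m_def by (rule times_div_less_eq_dividend)
    have 2: "D - b - 1 < a' * m + a'"
      unfolding m_def a'_def using dividend_less_times_div[of "Suc a" "D - b - 1"] by simp
    have "a' * m0 \<le> D - b - 1" using D by simp
    then have "m0 \<le> m" unfolding m_def a'_def by (simp add: less_eq_div_iff_mult_less_eq mult.commute)
    have "\<alpha> * D + \<beta> \<le> \<alpha> * (a' * m + a' + b) + \<beta>"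
      using 2 by (intro add_mono mult_le_mono) auto
    also have "\<dots> = \<alpha> * a' * m + (\<alpha> * (a' + b) + \<beta>)" by (simp add: algebra_simps)
    also have "\<dots> \<le> 2 ^ m" using m0[OF \<open>m0 \<le> m\<close>] .
    finally have "\<alpha> * D + \<beta> \<le> 2 ^ m" .
    moreover have "a * m \<le> a' * m" unfolding a'_def by simp
    then have "a * m + b < D" using 1 D by linarith
    ultimately show "\<exists>m. a * m + b < D \<and> \<alpha> * D + \<beta> \<le> 2 ^ m" by blast
  qed
qed

context thin_digraph begin

lemma coordinate_close_of_reaches:
  assumes "between E x y a" "between E x y b" "reaches E r a b"
  shows "coordinate_close E x y (C * r) a b"
proof -
  have "r \<le> C * r" unfolding potential_bound_def by simp
  moreover have "dst E x a \<le> dst E x b + C * r" "dst E x b \<le> dst E x a + r"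
    "dst E a y \<le> r + dst E b y" "dst E b y \<le> dst E a y + C * r"
    using assms unfolding between_def
    by (auto intro: dst_reaches_le dst_reaches_right dst_reaches_left dst_reaches_le_target)
  ultimately show ?thesis
    unfolding coordinate_close_def by linarith
qed

text \<open>If the detour through \<open>q\<close> costs at most \<open>e\<close>, then the vertex \<open>u\<close> at distance \<open>e + \<delta> + 1\<close> before \<open>q\<close>
  on a geodesic from \<open>x\<close> is too far from \<open>y\<close> to be \<open>\<delta>\<close>-close to a geodesic from \<open>q\<close> to \<open>y\<close>; hence
  the side from \<open>x\<close> to \<open>y\<close> reaches \<open>u\<close>.\<close>
lemma reaches_from_segment_of_excess:
  assumes "segment E x y P" "between E x y q" "dst E x q + dst E q y \<le> dst E x y + e"
  shows "\<exists>p\<in>P. reaches E (e + 2 * \<delta> + 1) p q"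
proof (cases "dst E x q \<le> e + \<delta> + 1")
  case True
  then have "reaches E (e + 2 * \<delta> + 1) x q"
    using assms(2) unfolding reaches_iff between_def by simp
  then show ?thesis using segment_ends[OF assms(1)] by blast
next
  case False
  have xq: "(x, q) \<in> E\<^sup>*" and qy: "(q, y) \<in> E\<^sup>*" using assms(2) unfolding between_def by auto
  obtain Q where Q: "segment E x q Q" using segment_exists[OF xq] by blast
  obtain R where R: "segment E q y R" using segment_exists[OF qy] by blast
  obtain u where u: "u \<in> Q" "dst E x u = dst E x q - (e + \<delta> + 1)"
    using segment_point[OF Q, of "dst E x q - (e + \<delta> + 1)"] by auto
  have xu: "(x, u) \<in> E\<^sup>*" "(u, q) \<in> E\<^sup>*" "dst E u q = e + \<delta> + 1"
    using segment_between[OF Q u(1)] u(2) False by auto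
  have "\<not> reaches E \<delta> u v" if v: "v \<in> R" for v
  proof
    assume "reaches E \<delta> u v"
    then have "dst E x v \<le> dst E x u + \<delta>" "(x, v) \<in> E\<^sup>*"
      using dst_reaches_right[OF xu(1)] rtrancl_trans[OF xu(1) reaches_rtrancl] by auto
    moreover have "(v, y) \<in> E\<^sup>*" "dst E v y \<le> dst E q y" using segment_between[OF R v] by auto
    ultimately have "dst E x y \<le> dst E x u + \<delta> + dst E q y"
      using dst_triangle[of x v E y] by linarith
    then show False using u(2) False assms(3) by linarith
  qed
  then obtain p where p: "p \<in> P" "reaches E \<delta> p u"
    using thin[OF Q disjI1[OF assms(1)] disjI1[OF R] u(1)] by blast
  have "reaches E (e + \<delta> + 1) u q" using xu unfolding reaches_iff by simp
  then have "reaches E (e + 2 * \<delta> + 1) p q" by (rule reaches_trans_le[OF p(2)]) simp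
  then show ?thesis using p(1) by blast
qed

lemma reaches_segment_of_excess:
  assumes "segment E x y P" "between E x y q" "dst E x q + dst E q y \<le> dst E x y + e"
  shows "\<exists>p\<in>P. reaches E (e + 2 * \<delta> + 1) q p"
  using thin_digraph.reaches_from_segment_of_excess[OF thin_converse, of y x P q e] assms by simp

text \<open>Bisecting the path \<open>m\<close> times costs only \<open>m\<close> applications of thinness, one for each level. The
  directions in which the successive \<open>\<delta>\<close>-steps go are mixed; the coordinates do not see them.\<close>
lemma segment_near_path:
  assumes step: "\<And>i. i < N \<Longrightarrow> reaches E k (W i) (W (Suc i))"
    and bet: "\<And>i. i \<le> N \<Longrightarrow> between E x y (W i)"
    and "i \<le> j" "j \<le> N" "j - i \<le> 2 ^ m" "segment E (W i) (W j) X" "q \<in> X"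
  shows "\<exists>l\<le>N. coordinate_close E x y (C * \<delta> * m + C * k) q (W l)"
  using assms(3-)
proof (induction m arbitrary: i j X q)
  case 0
  have "reaches E k (W i) (W j)"
  proof (cases "i = j")
    case False
    then have "j = Suc i" "i < N" using 0 by auto
    then show ?thesis using step by simp
  qed simp
  then have "reaches E k q (W j)"
    by (rule reaches_mono[OF segment_between(5)[OF 0(4,5)] dst_le])
  moreover have "between E x y q" using between_segment[OF bet bet 0(4,5)] 0 by simp
  ultimately show ?case
    using coordinate_close_of_reaches bet 0 by (intro exI[of _ j]) simp
next
  case (Suc m)
  define l where "l = (i + j) div 2"
  have l: "i \<le> l" "l \<le> j" "l - i \<le> 2 ^ m" "j - l \<le> 2 ^ m"
    using Suc.prems(1,3) unfolding l_def by auto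
  have reach: "(W a, W b) \<in> E\<^sup>*" if "a \<le> b" "b \<le> N" for a b
    by (rule reaches_rtrancl[OF path_reaches[of N E k W a b]]) (use step that in auto)
  obtain X1 where X1: "segment E (W i) (W l) X1" using segment_exists[OF reach, of i l] l Suc.prems by auto
  obtain X2 where X2: "segment E (W l) (W j) X2" using segment_exists[OF reach, of l j] l Suc.prems by auto
  have bq: "between E x y q" using between_segment[OF bet bet Suc.prems(4,5)] Suc.prems by simp
  have "\<exists>q'. coordinate_close E x y (C * \<delta>) q q' \<and> (q' \<in> X1 \<or> q' \<in> X2)"
  proof -
    consider q' where "q' \<in> X1" "reaches E \<delta> q' q" | q' where "q' \<in> X2" "reaches E \<delta> q q'"
      using thin[OF Suc.prems(4) _ _ Suc.prems(5), of "W l" X1 X2] X1 X2 by blast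
    then show ?thesis
    proof cases
      case 1
      then have "between E x y q'" using between_segment[OF bet bet X1] l Suc.prems by simp
      then have "coordinate_close E x y (C * \<delta>) q q'"
        by (rule coordinate_close_sym[OF coordinate_close_of_reaches[OF _ bq 1(2)]])
      then show ?thesis using 1 by blast
    next
      case 2
      then have "between E x y q'" using between_segment[OF bet bet X2] l Suc.prems by simp
      then show ?thesis using coordinate_close_of_reaches[OF bq _ 2(2)] 2 by blast
    qed
  qed
  then obtain q' where q': "coordinate_close E x y (C * \<delta>) q q'" "q' \<in> X1 \<or> q' \<in> X2" by blast
  obtain l' where l': "l' \<le> N" "coordinate_close E x y (C * \<delta> * m + C * k) q' (W l')"
    using q'(2) Suc.IH[OF l(1) _ l(3) X1] Suc.IH[OF l(2) _ l(4) X2] l Suc.prems(2) by auto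
  have "coordinate_close E x y (C * \<delta> * Suc m + C * k) q (W l')"
    using coordinate_close_trans[OF q'(1) l'(2)] by (simp add: add.assoc)
  then show ?case using l'(1) by blast
qed

text \<open>Let \<open>P t\<close> be a vertex of the geodesic with the largest coordinate distance \<open>D\<close> from \<open>V\<close>.
  Some way before \<open>P t\<close> the geodesic can be connected to \<open>V\<close> by a path that stays away from
  \<open>P t\<close>. How far before is chosen linear in \<open>D\<close> and so large that a path of length \<open>\<rho>\<close> cannot come back; if
  the geodesic starts before that, its first vertex, which lies in \<open>V\<close>, is taken.\<close>
lemma left_anchor:
  assumes P: "geodesic_upto E P n" and t: "t \<le> n" and D: "0 < D"
    and close: "\<And>s. s \<le> n \<Longrightarrow> \<exists>w\<in>V. coordinate_close E (P 0) (P n) D (P s) w"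
    and far: "\<And>w. w \<in> V \<Longrightarrow> \<not> coordinate_close E (P 0) (P n) (D - 1) (P t) w"
    and bet: "\<And>w. w \<in> V \<Longrightarrow> between E (P 0) (P n) w"
    and start: "P 0 \<in> V"
    and \<rho>: "\<rho> = 2 * D + 2 * \<delta> + 1"
  shows "\<exists>w\<in>V. \<exists>s\<le>t. t \<le> s + (3 * D + \<rho> + 2 * C * \<rho>) \<and> reaches E \<rho> w (P s) \<and>
     (\<forall>X z. segment E w (P s) X \<longrightarrow> z \<in> X \<longrightarrow> \<not> coordinate_close E (P 0) (P n) (D - 1) (P t) z)"
proof -
  define L where "L = 2 * D + \<rho> + C * \<rho>"
  have dP: "dst E (P 0) (P s) = s" "dst E (P s) (P n) = n - s" if "s \<le> n" for s
    using geodesic_uptoD(2)[OF P, of 0 s] geodesic_uptoD(2)[OF P, of s n] that by auto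
  show ?thesis
  proof (cases "t \<le> L")
    case True
    have "z = P 0" if "segment E (P 0) (P 0) X" "z \<in> X" for X z
      using segment_between(4)[OF that] by simp
    then show ?thesis
      using True start far unfolding L_def by (intro bexI[of _ "P 0"] exI[of _ 0]) (auto simp: algebra_simps)
  next
    case False
    obtain w where w: "w \<in> V" "coordinate_close E (P 0) (P n) D (P (t - L)) w"
      using close[of "t - L"] t by fastforce
    have dw: "dst E (P 0) w \<le> t - L + D" "t - L \<le> dst E (P 0) w + D" "dst E w (P n) \<le> n - (t - L) + D"
      using w(2) dP[of "t - L"] t unfolding coordinate_close_def by auto
    have seg: "segment E (P 0) (P n) (P ` {0..n})"
      using segment_of_path[OF P, of 0 n] by simp
    have "dst E (P 0) w + dst E w (P n) \<le> dst E (P 0) (P n) + 2 * D"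
      using dw dP[of n] False t by simp
    then obtain s where s: "s \<le> n" "reaches E \<rho> w (P s)"
      using reaches_segment_of_excess[OF seg bet[OF w(1)], of "2 * D"] unfolding \<rho> by auto
    have reach: "(P 0, w) \<in> E\<^sup>*" using bet[OF w(1)] unfolding between_def by simp
    have "s \<le> dst E (P 0) w + \<rho>" "dst E (P 0) w \<le> s + C * \<rho>"
      using dst_reaches_right[OF reach s(2)] dst_reaches_le[OF reach s(2)] dP[OF s(1)] by auto
    then have st: "s \<le> t - L + D + \<rho>" "t - L \<le> s + C * \<rho> + D" using dw by auto
    have "\<not> coordinate_close E (P 0) (P n) (D - 1) (P t) z" if z: "segment E w (P s) X" "z \<in> X" for X z
    proof
      assume cz: "coordinate_close E (P 0) (P n) (D - 1) (P t) z"
      have "reaches E \<rho> z (P s)"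
        using segment_between(5)[OF z] dst_le[OF s(2)] by (rule reaches_mono)
      moreover have "(P 0, z) \<in> E\<^sup>*"
        using reach segment_between(1)[OF z] by simp
      ultimately have "dst E (P 0) z \<le> s + C * \<rho>"
        using dst_reaches_le dP(1)[OF s(1)] by metis
      moreover have "t \<le> dst E (P 0) z + (D - 1)"
        using cz dP(1)[OF t] unfolding coordinate_close_def by simp
      ultimately show False using st False D unfolding L_def by linarith
    qed
    moreover have "s \<le> t" "t \<le> s + (3 * D + \<rho> + 2 * C * \<rho>)"
      using st False unfolding L_def by (auto simp: algebra_simps)
    ultimately show ?thesis using w(1) s(2) by blast
  qed
qed

lemma right_anchor:
  assumes P: "geodesic_upto E P n" and t: "t \<le> n" and D: "0 < D"
    and close: "\<And>s. s \<le> n \<Longrightarrow> \<exists>w\<in>V. coordinate_close E (P 0) (P n) D (P s) w"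
    and far: "\<And>w. w \<in> V \<Longrightarrow> \<not> coordinate_close E (P 0) (P n) (D - 1) (P t) w"
    and bet: "\<And>w. w \<in> V \<Longrightarrow> between E (P 0) (P n) w"
    and finish: "P n \<in> V"
    and \<rho>: "\<rho> = 2 * D + 2 * \<delta> + 1"
  shows "\<exists>w\<in>V. \<exists>s\<le>n. t \<le> s \<and> s \<le> t + (3 * D + \<rho> + 2 * C * \<rho>) \<and> reaches E \<rho> (P s) w \<and>
     (\<forall>X z. segment E (P s) w X \<longrightarrow> z \<in> X \<longrightarrow> \<not> coordinate_close E (P 0) (P n) (D - 1) (P t) z)"
proof -
  have "\<exists>w\<in>V. \<exists>s\<le>n - t. n - t \<le> s + (3 * D + \<rho> + 2 * C * \<rho>) \<and> reaches E \<rho> (P (n - s)) w \<and>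
     (\<forall>X z. segment E (P (n - s)) w X \<longrightarrow> z \<in> X \<longrightarrow> \<not> coordinate_close E (P 0) (P n) (D - 1) (P t) z)"
    using thin_digraph.left_anchor[OF thin_converse geodesic_upto_converse[OF P], of "n - t" D V \<rho>]
      t D close far bet finish \<rho> by auto
  then obtain w s where "w \<in> V" "s \<le> n - t" "n - t \<le> s + (3 * D + \<rho> + 2 * C * \<rho>)"
    "reaches E \<rho> (P (n - s)) w"
    "\<forall>X z. segment E (P (n - s)) w X \<longrightarrow> z \<in> X \<longrightarrow> \<not> coordinate_close E (P 0) (P n) (D - 1) (P t) z"
    by blast
  then show ?thesis
    using t by (intro bexI[of _ w] exI[of _ "n - s"]) auto
qed

text \<open>Let \<open>D\<close> be the largest distance of a vertex \<open>P t\<close> of the geodesic from the quasi-geodesic. Anchors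
  on both sides of \<open>P t\<close> lead to points \<open>W i\<close> and \<open>W j\<close> whose distance is linear in \<open>D\<close>, so the
  piece of \<open>W\<close> between them has length linear in \<open>D\<close>. By thin polygons \<open>P t\<close> is close to a geodesic
  joining \<open>W i\<close> and \<open>W j\<close>, and this is logarithmically close to \<open>W\<close>, which bounds \<open>D\<close>.\<close>
lemma geodesic_close_to_quasi_geodesic:
  "\<exists>\<kappa>. \<forall>P n W N. geodesic_upto E P n \<longrightarrow> quasi_geodesic_upto E k \<gamma> c W N \<longrightarrow> W 0 = P 0 \<longrightarrow> W N = P n \<longrightarrow>
     (\<forall>t\<le>n. \<exists>i\<le>N. coordinate_close E (P 0) (P n) \<kappa> (P t) (W i))"
proof -
  define b where "b = Suc K ^ \<delta>"
  define \<alpha> where "\<alpha> = \<gamma> * (2 * (14 + 8 * C) * b)"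
  define \<beta> where "\<beta> = \<gamma> * (2 * ((4 + 4 * C) * (2 * \<delta> + 1) + 1) * b) + c"
  obtain \<kappa> where \<kappa>: "\<And>D. \<kappa> < D \<Longrightarrow> \<exists>m. (C * \<delta>) * m + (3 * (C * \<delta>) + C * k) < D \<and> \<alpha> * D + \<beta> \<le> 2 ^ m"
    using logarithm_beats_linear by meson
  have main: "\<exists>i\<le>N. coordinate_close E (P 0) (P n) \<kappa> (P t) (W i)"
    if P: "geodesic_upto E P n" and W: "quasi_geodesic_upto E k \<gamma> c W N"
      and W0: "W 0 = P 0" and WN: "W N = P n" and tn: "t \<le> n" for P n W N t
  proof -
    let ?cl = "coordinate_close E (P 0) (P n)"
    let ?bet = "between E (P 0) (P n)"
    have step: "\<And>i. i < N \<Longrightarrow> reaches E k (W i) (W (Suc i))" using W unfolding quasi_geodesic_upto_def by blast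
    have reachW: "(W i, W j) \<in> E\<^sup>*" if "i \<le> j" "j \<le> N" for i j
      by (rule reaches_rtrancl[OF path_reaches[of N E k W i j]]) (use step that in auto)
    have betW: "?bet (W i)" if "i \<le> N" for i
      using reachW[of 0 i] reachW[of i N] that W0 WN unfolding between_def by simp
    have dP: "dst E (P 0) (P s) = s" "dst E (P s) (P n) = n - s" "?bet (P s)" if "s \<le> n" for s
      using geodesic_uptoD(2,3)[OF P, of 0 s] geodesic_uptoD(2,3)[OF P, of s n] that
      unfolding between_def by auto
    define good where "good r \<longleftrightarrow> (\<forall>s\<le>n. \<exists>i\<le>N. ?cl r (P s) (W i))" for r
    have "good n"
      unfolding good_def
    proof (intro allI impI)
      fix s assume "s \<le> n"
      then have "?cl n (P s) (W 0)" unfolding coordinate_close_def W0 using dP[of s] dP[of n] by auto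
      then show "\<exists>i\<le>N. ?cl n (P s) (W i)" by blast
    qed
    define D where "D = (LEAST r. good r)"
    have goodD: "good D" unfolding D_def using \<open>good n\<close> by (rule LeastI)
    have "D \<le> \<kappa>"
    proof (rule ccontr)
      assume "\<not> D \<le> \<kappa>"
      then have D: "\<kappa> < D" "0 < D" by auto
      have "\<not> good (D - 1)" using D(2) not_less_Least[of "D - 1" good] unfolding D_def by simp
      then obtain t where t: "t \<le> n" and far: "\<And>i. i \<le> N \<Longrightarrow> \<not> ?cl (D - 1) (P t) (W i)"
        unfolding good_def by blast
      obtain m where m: "(C * \<delta>) * m + (3 * (C * \<delta>) + C * k) < D" "\<alpha> * D + \<beta> \<le> 2 ^ m"
        using \<kappa>[OF D(1)] by blast
      define \<rho> where "\<rho> = 2 * D + 2 * \<delta> + 1"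
      define L where "L = 3 * D + \<rho> + 2 * C * \<rho>"
      have hyp: "\<And>s. s \<le> n \<Longrightarrow> \<exists>w\<in>W ` {..N}. ?cl D (P s) w"
        "\<And>w. w \<in> W ` {..N} \<Longrightarrow> \<not> ?cl (D - 1) (P t) w" "\<And>w. w \<in> W ` {..N} \<Longrightarrow> ?bet w"
        "P 0 \<in> W ` {..N}" "P n \<in> W ` {..N}"
        using goodD far betW W0[symmetric] WN[symmetric] unfolding good_def by auto
      obtain i s where i: "i \<le> N" "s \<le> t" "t \<le> s + L" "reaches E \<rho> (W i) (P s)"
        and farA: "\<And>X z. segment E (W i) (P s) X \<Longrightarrow> z \<in> X \<Longrightarrow> \<not> ?cl (D - 1) (P t) z"
        using left_anchor[OF P t D(2) hyp(1-4) \<rho>_def] unfolding L_def by blast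
      obtain j s' where j: "j \<le> N" "s' \<le> n" "t \<le> s'" "s' \<le> t + L" "reaches E \<rho> (P s') (W j)"
        and farB: "\<And>X z. segment E (P s') (W j) X \<Longrightarrow> z \<in> X \<Longrightarrow> \<not> ?cl (D - 1) (P t) z"
        using right_anchor[OF P t D(2) hyp(1-3,5) \<rho>_def] unfolding L_def by blast
      have sn: "s \<le> n" using i t by simp
      define r where "r = 2 * \<rho> + 2 * L"
      have rD: "r = (14 + 8 * C) * D + (4 + 4 * C) * (2 * \<delta> + 1)"
        unfolding r_def L_def \<rho>_def by (simp add: algebra_simps)
      have Wij: "reaches E r (W i) (W j)"
      proof (rule reaches_trans_le)
        show "reaches E (\<rho> + (s' - s)) (W i) (P s')"
          by (rule reaches_trans[OF i(4) geodesic_uptoD(1)[OF P]]) (use i j in auto)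
        show "reaches E \<rho> (P s') (W j)" by fact
        show "\<rho> + (s' - s) + \<rho> \<le> r" using i j unfolding r_def by simp
      qed
      have "\<gamma> * cone_bound \<delta> K r + c = \<alpha> * D + \<beta>"
        unfolding cone_bound_def rD \<alpha>_def \<beta>_def b_def[symmetric] by (simp add: algebra_simps)
      then have len: "\<gamma> * cone_bound \<delta> K r + c \<le> 2 ^ m" using m(2) by simp
      have rcone: "r \<le> cone_bound \<delta> K r"
      proof -
        have "r * 1 \<le> 2 * Suc r * Suc K ^ \<delta>" by (intro mult_le_mono) auto
        then show ?thesis unfolding cone_bound_def by simp
      qed
      have idx: "v - u \<le> 2 ^ m" if "u \<le> v" "v \<le> N" "reaches E (cone_bound \<delta> K r) (W u) (W v)" for u v
        using W that len unfolding quasi_geodesic_upto_def by (meson le_trans)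
      have p: "P t \<in> P ` {s..s'}" using i j by auto
      have segP: "segment E (P s) (P s') (P ` {s..s'})" using segment_of_path[OF P, of s s'] i j by simp
      obtain A where A: "segment E (W i) (P s) A" using segment_exists[OF reaches_rtrancl[OF i(4)]] by blast
      obtain B where B: "segment E (P s') (W j) B" using segment_exists[OF reaches_rtrancl[OF j(5)]] by blast
      note bets = between_segment[OF betW[OF i(1)] dP(3)[OF sn] A] between_segment[OF dP(3)[OF j(2)] betW[OF j(1)] B]
      have small: "l * (C * \<delta>) \<le> D - 1" if "l \<le> 3" for l
      proof -
        have "l * (C * \<delta>) \<le> 3 * (C * \<delta>)" using that by simp
        then show ?thesis using m(1) D(2) by linarith
      qed
      \<comment> \<open>One more \<open>\<delta>\<close>-step, in whichever direction.\<close>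
      have jump: "?cl (Suc l * (C * \<delta>)) (P t) z'"
        if "?cl (l * (C * \<delta>)) (P t) z" "?bet z" "?bet z'" "reaches E \<delta> z z' \<or> reaches E \<delta> z' z" for l z z'
        using that coordinate_close_trans[OF that(1), of "C * \<delta>" z']
          coordinate_close_of_reaches[of "P 0" "P n" z z' \<delta>] coordinate_close_of_reaches[of "P 0" "P n" z' z \<delta>]
          coordinate_close_sym[of E "P 0" "P n" "C * \<delta>" z' z] by (auto simp: add.commute)
      have self: "?cl (0 * (C * \<delta>)) (P t) (P t)" unfolding coordinate_close_def by simp
      have noA: "\<not> ?cl (l * (C * \<delta>)) (P t) z" if "z \<in> A" "l \<le> 3" for z l
        using farA[OF A that(1)] coordinate_close_mono[OF _ small[OF that(2)]] by (rule contrapos_nn)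
      have noB: "\<not> ?cl (l * (C * \<delta>)) (P t) z" if "z \<in> B" "l \<le> 3" for z l
        using farB[OF B that(1)] coordinate_close_mono[OF _ small[OF that(2)]] by (rule contrapos_nn)
      \<comment> \<open>A point near \<open>P t\<close> on a geodesic joining two points of the short piece of \<open>W\<close> is impossible.\<close>
      have contra: False if h: "u \<le> v" "v \<le> N" "segment E (W u) (W v) G" "reaches E (cone_bound \<delta> K r) (W u) (W v)"
        "q \<in> G" "?cl (l * (C * \<delta>)) (P t) q" "l \<le> 3" for u v G q l
      proof -
        obtain l' where l': "l' \<le> N" "?cl (C * \<delta> * m + C * k) q (W l')"
          using segment_near_path[OF step betW h(1,2) idx[OF h(1,2,4)] h(3,5)] by blast
        have "?cl (l * (C * \<delta>) + (C * \<delta> * m + C * k)) (P t) (W l')"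
          using coordinate_close_trans[OF h(6) l'(2)] .
        moreover have "l * (C * \<delta>) \<le> 3 * (C * \<delta>)" using h(7) by simp
        then have "l * (C * \<delta>) + (C * \<delta> * m + C * k) \<le> D - 1" using m(1) by linarith
        ultimately have "?cl (D - 1) (P t) (W l')" by (rule coordinate_close_mono)
        then show False using far[OF l'(1)] by blast
      qed
      show False
      proof (cases "i \<le> j")
        case True
        \<comment> \<open>The quadrilateral \<open>W i\<close>, \<open>P s\<close>, \<open>P s'\<close>, \<open>W j\<close> with diagonal from \<open>W i\<close> to \<open>P s'\<close>.\<close>
        have "(W i, P s') \<in> E\<^sup>*"
          using reaches_rtrancl[OF i(4)] segment_reach[OF segP] by simp
        then obtain B' where B': "segment E (W i) (P s') B'" using segment_exists by metis
        obtain G where G: "segment E (W i) (W j) G" using segment_exists[OF reachW[OF True j(1)]] by blast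
        have "\<not> (\<exists>q\<in>A. reaches E \<delta> q (P t))"
          using jump[OF self dP(3)[OF t] bets(1)] noA[of _ 1] by auto
        then obtain q where q: "q \<in> B'" "reaches E \<delta> (P t) q"
          using thin[OF segP _ _ p, of "W i" A B'] A B' by blast
        have bq: "?bet q" using between_segment[OF betW[OF i(1)] dP(3)[OF j(2)] B' q(1)] .
        have cq: "?cl (1 * (C * \<delta>)) (P t) q" using jump[OF self dP(3)[OF t] bq] q(2) by simp
        have "\<not> (\<exists>q'\<in>B. reaches E \<delta> q q')"
          using jump[OF cq bq bets(2)] noB[of _ 2] by (auto simp: numeral_2_eq_2)
        then obtain q' where q': "q' \<in> G" "reaches E \<delta> q' q"
          using thin[OF B' _ _ q(1), of "W j" G B] G B by blast
        have bq': "?bet q'" using between_segment[OF betW[OF i(1)] betW[OF j(1)] G q'(1)] .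
        have "?cl (2 * (C * \<delta>)) (P t) q'" using jump[OF cq bq bq'] q'(2) by (simp add: numeral_2_eq_2)
        then show False
          using contra[OF True j(1) G reaches_mono[OF Wij rcone] q'(1), of 2] by simp
      next
        case False
        then have ji: "j \<le> i" by simp
        \<comment> \<open>Now \<open>W\<close> leads from \<open>P s'\<close> back to \<open>P s\<close>. First replace the geodesic from \<open>P s\<close> to \<open>P s'\<close>
          by one in the opposite direction, then use the quadrilateral \<open>P s'\<close>, \<open>W j\<close>, \<open>W i\<close>, \<open>P s\<close>.\<close>
        have ret: "(P s', W i) \<in> E\<^sup>*" "(P s', P s) \<in> E\<^sup>*"
          using reaches_rtrancl[OF j(5)] reachW[OF ji i(1)] reaches_rtrancl[OF i(4)] by auto
        obtain P' where P': "segment E (P s') (P s) P'" using segment_exists[OF ret(2)] by blast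
        obtain H where H: "segment E (P s') (W i) H" using segment_exists[OF ret(1)] by blast
        obtain G where G: "segment E (W j) (W i) G" using segment_exists[OF reachW[OF ji i(1)]] by blast
        have Wji: "reaches E (cone_bound \<delta> K r) (W j) (W i)"
          using reaches_of_common_source[OF Wij reaches_refl reachW[OF ji i(1)]] .
        have "P s \<in> A" using segment_ends[OF A] by simp
        then have "\<not> reaches E \<delta> (P s) (P t)"
          using jump[OF self dP(3)[OF t] dP(3)[OF sn]] noA[of _ 1] by auto
        then obtain q where q: "q \<in> P'" "reaches E \<delta> (P t) q"
          using thin[OF segP _ _ p, of "P s" "{P s}" P'] P' by auto
        have bq: "?bet q" using between_segment[OF dP(3)[OF j(2)] dP(3)[OF sn] P' q(1)] .
        have cq: "?cl (1 * (C * \<delta>)) (P t) q" using jump[OF self dP(3)[OF t] bq] q(2) by simp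
        have "\<not> (\<exists>q'\<in>A. reaches E \<delta> q q')"
          using jump[OF cq bq bets(1)] noA[of _ 2] by (auto simp: numeral_2_eq_2)
        then obtain q' where q': "q' \<in> H" "reaches E \<delta> q' q"
          using thin[OF P' _ _ q(1), of "W i" H A] H A by blast
        have bq': "?bet q'" using between_segment[OF dP(3)[OF j(2)] betW[OF i(1)] H q'(1)] .
        have cq': "?cl (2 * (C * \<delta>)) (P t) q'" using jump[OF cq bq bq'] q'(2) by (simp add: numeral_2_eq_2)
        have "\<not> (\<exists>q3\<in>B. reaches E \<delta> q3 q')"
          using jump[OF cq' bq' bets(2)] noB[of _ 3] by (auto simp: numeral_3_eq_3 numeral_2_eq_2)
        then obtain q3 where q3: "q3 \<in> G" "reaches E \<delta> q' q3"
          using thin[OF H _ _ q'(1), of "W j" B G] G B by blast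
        have bq3: "?bet q3" using between_segment[OF betW[OF j(1)] betW[OF i(1)] G q3(1)] .
        have "?cl (3 * (C * \<delta>)) (P t) q3"
          using jump[OF cq' bq' bq3] q3(2) by (simp add: numeral_3_eq_3 numeral_2_eq_2)
        then show False
          using contra[OF ji i(1) G Wji q3(1), of 3] by simp
      qed
    qed
    then show ?thesis
      using goodD tn coordinate_close_mono[OF _ \<open>D \<le> \<kappa>\<close>] unfolding good_def by meson
  qed
  show ?thesis by (rule exI[of _ \<kappa>], intro allI impI, rule main)
qed

text \<open>A vertex \<open>w\<close> of \<open>V\<close> near a vertex slightly later than \<open>P t\<close> is reached from the geodesic, and the
  coordinate \<open>d(P 0, \<cdot>)\<close> shows that it is reached from a vertex at or after \<open>P t\<close>.\<close>
lemma geodesic_reaches_of_coordinate_close: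
  assumes P: "geodesic_upto E P n"
    and close: "\<And>s. s \<le> n \<Longrightarrow> \<exists>w\<in>V. coordinate_close E (P 0) (P n) \<kappa> (P s) w"
    and bet: "\<And>w. w \<in> V \<Longrightarrow> between E (P 0) (P n) w"
    and finish: "P n \<in> V" and t: "t \<le> n"
    and \<rho>: "\<rho> = 2 * \<kappa> + 2 * \<delta> + 1"
  shows "\<exists>w\<in>V. reaches E (2 * \<kappa> + 2 * \<rho> + C * \<rho>) (P t) w"
proof (cases "n \<le> t + \<kappa> + \<rho>")
  case True
  have "reaches E (n - t) (P t) (P n)" using geodesic_uptoD(1)[OF P t order_refl] .
  then show ?thesis using True finish by (intro bexI[of _ "P n"]) (auto elim: reaches_mono)
next
  case False
  let ?t = "t + \<kappa> + \<rho>"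
  have dP: "dst E (P 0) (P s) = s" "dst E (P s) (P n) = n - s" if "s \<le> n" for s
    using geodesic_uptoD(2)[OF P, of 0 s] geodesic_uptoD(2)[OF P, of s n] that by auto
  obtain w where w: "w \<in> V" "coordinate_close E (P 0) (P n) \<kappa> (P ?t) w"
    using close[of ?t] False by auto
  have dw: "dst E (P 0) w \<le> ?t + \<kappa>" "?t \<le> dst E (P 0) w + \<kappa>" "dst E w (P n) \<le> n - ?t + \<kappa>"
    using w(2) dP[of ?t] False unfolding coordinate_close_def by auto
  have seg: "segment E (P 0) (P n) (P ` {0..n})"
    using segment_of_path[OF P, of 0 n] by simp
  have "dst E (P 0) w + dst E w (P n) \<le> dst E (P 0) (P n) + 2 * \<kappa>"
    using dw dP[of n] False by simp
  then obtain s where s: "s \<le> n" "reaches E \<rho> (P s) w"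
    using reaches_from_segment_of_excess[OF seg bet[OF w(1)], of "2 * \<kappa>"] unfolding \<rho> by auto
  have "(P 0, P s) \<in> E\<^sup>*" using geodesic_uptoD(3)[OF P, of 0 s] s by simp
  then have "dst E (P 0) w \<le> s + \<rho>" "s \<le> dst E (P 0) w + C * \<rho>"
    using dst_reaches_right[OF _ s(2)] dst_reaches_le[OF _ s(2)] dP(1)[OF s(1)] by fastforce+
  then have "t \<le> s" "s - t + \<rho> \<le> 2 * \<kappa> + 2 * \<rho> + C * \<rho>" using dw by auto
  moreover have "reaches E (s - t) (P t) (P s)" using geodesic_uptoD(1)[OF P \<open>t \<le> s\<close> s(1)] .
  ultimately show ?thesis using reaches_trans_le[OF _ s(2)] by (intro bexI[OF _ w(1)])
qed

theorem quasi_geodesic_stability: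
  "\<exists>M. \<forall>P n W N. geodesic_upto E P n \<longrightarrow> quasi_geodesic_upto E k \<gamma> c W N \<longrightarrow> W 0 = P 0 \<longrightarrow> W N = P n \<longrightarrow>
     (\<forall>t\<le>n. (\<exists>i\<le>N. reaches E M (P t) (W i)) \<and> (\<exists>i\<le>N. reaches E M (W i) (P t)))"
proof -
  obtain \<kappa> where "\<forall>P n W N. geodesic_upto E P n \<longrightarrow> quasi_geodesic_upto E k \<gamma> c W N \<longrightarrow> W 0 = P 0 \<longrightarrow> W N = P n \<longrightarrow>
      (\<forall>t\<le>n. \<exists>i\<le>N. coordinate_close E (P 0) (P n) \<kappa> (P t) (W i))"
    using geodesic_close_to_quasi_geodesic[of k \<gamma> c] by (rule exE)
  note \<kappa> = this[rule_format]
  define \<rho> where "\<rho> = 2 * \<kappa> + 2 * \<delta> + 1"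
  define M where "M = 2 * \<kappa> + 2 * \<rho> + C * \<rho>"
  have main: "(\<exists>i\<le>N. reaches E M (P t) (W i)) \<and> (\<exists>i\<le>N. reaches E M (W i) (P t))"
    if P: "geodesic_upto E P n" and W: "quasi_geodesic_upto E k \<gamma> c W N"
      and W0: "W 0 = P 0" and WN: "W N = P n" and t: "t \<le> n" for P n W N t
  proof
    let ?V = "W ` {..N}"
    have close: "\<exists>w\<in>?V. coordinate_close E (P 0) (P n) \<kappa> (P s) w" if "s \<le> n" for s
      using \<kappa>[OF P W W0 WN that] by blast
    have reachW: "(W i, W j) \<in> E\<^sup>*" if "i \<le> j" "j \<le> N" for i j
      by (rule reaches_rtrancl[OF path_reaches[of N E k W i j]]) (use W that in \<open>auto simp: quasi_geodesic_upto_def\<close>)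
    have bet: "between E (P 0) (P n) w" if "w \<in> ?V" for w
      using reachW[of 0] reachW[of _ N] that W0 WN unfolding between_def by auto
    have ends: "P 0 \<in> ?V" "P n \<in> ?V" using W0[symmetric] WN[symmetric] by auto
    show "\<exists>i\<le>N. reaches E M (P t) (W i)"
      using geodesic_reaches_of_coordinate_close[OF P close bet ends(2) t \<rho>_def] unfolding M_def by auto
    have "\<exists>w\<in>?V. reaches (E\<inverse>) M (P (n - (n - t))) w"
      unfolding M_def
      by (rule thin_digraph.geodesic_reaches_of_coordinate_close[OF thin_converse geodesic_upto_converse[OF P]])
        (use close bet ends \<rho>_def in auto)
    then show "\<exists>i\<le>N. reaches E M (W i) (P t)" using t by auto
  qed
  show ?thesis by (rule exI[of _ M], intro allI impI, rule main)
qed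

end

section \<open>Rays and their limits\<close>

definition proper_seq :: "(nat \<Rightarrow> 'a) \<Rightarrow> bool" where
  "proper_seq R \<longleftrightarrow> (\<forall>v. finite {i. R i = v})"

definition coarse_ray :: "'a rel \<Rightarrow> (nat \<Rightarrow> 'a) \<Rightarrow> bool" where
  "coarse_ray E R \<longleftrightarrow> (\<exists>k \<gamma> c. \<forall>N. quasi_geodesic_upto E k \<gamma> c R N)"

definition geodesic_ray :: "'a rel \<Rightarrow> (nat \<Rightarrow> 'a) \<Rightarrow> bool" where
  "geodesic_ray E g \<longleftrightarrow> (\<forall>n. geodesic_upto E g n)"

text \<open>All four clauses are kept because together they make the relation symmetric, transitive and
  invariant under reversing the edges.\<close>
definition parallel :: "'a rel \<Rightarrow> (nat \<Rightarrow> 'a) \<Rightarrow> (nat \<Rightarrow> 'a) \<Rightarrow> bool" where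
  "parallel E R R' \<longleftrightarrow> (\<exists>M.
     (\<forall>i. \<exists>j. reaches E M (R i) (R' j)) \<and> (\<forall>i. \<exists>j. reaches E M (R' j) (R i)) \<and>
     (\<forall>j. \<exists>i. reaches E M (R i) (R' j)) \<and> (\<forall>j. \<exists>i. reaches E M (R' j) (R i)))"

text \<open>The boundary order in terms of indices: for proper sequences, leaving all balls is the same as
  having large indices. Requiring both indices to be large makes the relation self-dual.\<close>
definition below :: "'a rel \<Rightarrow> (nat \<Rightarrow> 'a) \<Rightarrow> (nat \<Rightarrow> 'a) \<Rightarrow> bool" where
  "below E R1 R2 \<longleftrightarrow> (\<exists>M. \<forall>n. \<exists>i\<ge>n. \<exists>j\<ge>n. reaches E M (R1 i) (R2 j))"

lemma proper_seq_avoids: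
  assumes "proper_seq R" "finite F"
  shows "\<exists>n. \<forall>i\<ge>n. R i \<notin> F"
proof -
  have "{i. R i \<in> F} = (\<Union>v\<in>F. {i. R i = v})" by auto
  then have "finite {i. R i \<in> F}" using assms unfolding proper_seq_def by auto
  then obtain n where "\<forall>i\<in>{i. R i \<in> F}. i < n" unfolding finite_nat_set_iff_bounded by blast
  then show ?thesis by (intro exI[of _ n]) (auto simp: not_less[symmetric])
qed

lemma coarse_ray_proper:
  assumes "coarse_ray E R"
  shows "proper_seq R"
  unfolding proper_seq_def
proof
  fix v
  obtain k \<gamma> c where q: "\<And>N. quasi_geodesic_upto E k \<gamma> c R N"
    using assms unfolding coarse_ray_def by blast
  show "finite {i. R i = v}"
  proof (cases "\<exists>i. R i = v")
    case True
    define a where "a = (LEAST i. R i = v)"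
    have a: "R a = v" "\<And>i. R i = v \<Longrightarrow> a \<le> i"
      using LeastI_ex[OF True] Least_le[of "\<lambda>i. R i = v"] unfolding a_def by auto
    have "i \<le> a + c" if "R i = v" for i
    proof -
      have "i - a \<le> \<gamma> * 0 + c"
        using q[of i] a(1) a(2)[OF that] that unfolding quasi_geodesic_upto_def
        by (metis order_refl reaches_refl)
      then show ?thesis by simp
    qed
    then have "{i. R i = v} \<subseteq> {..a + c}" by auto
    then show ?thesis using finite_subset by blast
  qed auto
qed

lemma quasi_geodesic_upto_mono: "quasi_geodesic_upto E k \<gamma> c W N \<Longrightarrow> m \<le> N \<Longrightarrow> quasi_geodesic_upto E k \<gamma> c W m"
  unfolding quasi_geodesic_upto_def by (meson le_trans less_le_trans)

lemma quasi_geodesic_upto_cong: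
  "(\<And>i. i \<le> N \<Longrightarrow> W i = W' i) \<Longrightarrow> quasi_geodesic_upto E k \<gamma> c W N \<Longrightarrow> quasi_geodesic_upto E k \<gamma> c W' N"
  unfolding quasi_geodesic_upto_def by simp

lemma geodesic_upto_cong:
  "(\<And>i. i \<le> N \<Longrightarrow> W i = W' i) \<Longrightarrow> geodesic_upto E W N \<Longrightarrow> geodesic_upto E W' N"
  unfolding geodesic_upto_def by (metis Suc_leI less_imp_le order_refl zero_le)

lemma geodesic_rayD:
  assumes "geodesic_ray E g" "i \<le> j"
  shows "reaches E (j - i) (g i) (g j)" "dst E (g i) (g j) = j - i" "(g i, g j) \<in> E\<^sup>*"
  using geodesic_uptoD[of E g j i j] assms unfolding geodesic_ray_def by auto

lemma geodesic_ray_edge: "geodesic_ray E g \<Longrightarrow> (g i, g (Suc i)) \<in> E"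
  unfolding geodesic_ray_def geodesic_upto_def by blast

lemma geodesic_ray_coarse:
  assumes "geodesic_ray E g"
  shows "coarse_ray E g"
proof -
  have "quasi_geodesic_upto E 1 1 0 g N" for N
    unfolding quasi_geodesic_upto_def
  proof (intro conjI allI impI)
    fix i j m assume "i \<le> j" "reaches E m (g i) (g j)"
    then show "j - i \<le> 1 * m + 0" using geodesic_rayD(2)[OF assms] dst_le by fastforce
  qed (use geodesic_ray_edge[OF assms] reaches_edge in fastforce)
  then show ?thesis unfolding coarse_ray_def by blast
qed

lemma parallel_sym: "parallel E R R' \<Longrightarrow> parallel E R' R"
  unfolding parallel_def by blast

lemma parallel_converse [simp]: "parallel (E\<inverse>) R R' \<longleftrightarrow> parallel E R R'"
  unfolding parallel_def reaches_converse by blast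

lemma below_converse [simp]: "below (E\<inverse>) R R' \<longleftrightarrow> below E R' R"
  unfolding below_def reaches_converse by blast

lemma parallel_trans:
  assumes "parallel E R1 R2" "parallel E R2 R3"
  shows "parallel E R1 R3"
proof -
  obtain M where M: "\<forall>i. \<exists>j. reaches E M (R1 i) (R2 j)" "\<forall>i. \<exists>j. reaches E M (R2 j) (R1 i)"
     "\<forall>j. \<exists>i. reaches E M (R1 i) (R2 j)" "\<forall>j. \<exists>i. reaches E M (R2 j) (R1 i)"
    using assms(1) unfolding parallel_def by blast
  obtain M' where M': "\<forall>i. \<exists>j. reaches E M' (R2 i) (R3 j)" "\<forall>i. \<exists>j. reaches E M' (R3 j) (R2 i)"
     "\<forall>j. \<exists>i. reaches E M' (R2 i) (R3 j)" "\<forall>j. \<exists>i. reaches E M' (R3 j) (R2 i)"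
    using assms(2) unfolding parallel_def by blast
  show ?thesis
    unfolding parallel_def
  proof (rule exI[of _ "M + M'"], intro conjI allI)
    fix i
    show "\<exists>j. reaches E (M + M') (R1 i) (R3 j)" "\<exists>j. reaches E (M + M') (R1 j) (R3 i)"
      using M(1,3) M'(1,3) reaches_trans[of E M _ _ M'] by meson+
    show "\<exists>j. reaches E (M + M') (R3 j) (R1 i)" "\<exists>j. reaches E (M + M') (R3 i) (R1 j)"
      using M(2,4) M'(2,4) reaches_trans[of E M' _ _ M] by (metis add.commute)+
  qed
qed

text \<open>Koenig's lemma: coordinatewise finitely many values allow a diagonal choice of a limit.\<close>
lemma koenig_limit:
  fixes X :: "nat \<Rightarrow> nat \<Rightarrow> 'a"
  assumes "\<And>i. finite (range (\<lambda>N. X N i))"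
  shows "\<exists>g. \<forall>n. infinite {N. \<forall>i\<le>n. X N i = g i}"
proof -
  have pick: "\<exists>T. (infinite T \<and> (\<exists>v. \<forall>N\<in>T. X N n = v)) \<and> T \<subseteq> S" if S: "infinite S" for S n
  proof -
    have "finite ((\<lambda>N. X N n) ` S)" using assms finite_subset by (meson image_mono subset_UNIV)
    then obtain a where "infinite {b \<in> S. X b n = X a n}"
      using pigeonhole_infinite[OF S] by blast
    then show ?thesis by (intro exI[of _ "{b \<in> S. X b n = X a n}"]) auto
  qed
  have "\<exists>S. \<forall>n. (infinite (S n) \<and> (\<exists>v. \<forall>N\<in>S n. X N n = v)) \<and> S (Suc n) \<subseteq> S n"
    by (rule dependent_nat_choice) (use pick[of UNIV 0] pick in blast)+
  then obtain S where S: "\<And>n. infinite (S n) \<and> (\<exists>v. \<forall>N\<in>S n. X N n = v)" "\<And>n. S (Suc n) \<subseteq> S n"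
    by blast
  have "\<forall>n. \<exists>v. \<forall>N\<in>S n. X N n = v" using S(1) by blast
  then obtain g where g: "\<forall>n. \<forall>N\<in>S n. X N n = g n" by (rule choice[THEN exE])
  have "S n \<subseteq> {N. \<forall>i\<le>n. X N i = g i}" for n
  proof (intro subsetI CollectI allI impI)
    fix N i assume "N \<in> S n" "i \<le> n"
    then have "N \<in> S i" using lift_Suc_antimono_le[of S, OF S(2)] by blast
    then show "X N i = g i" using g by blast
  qed
  then have "infinite {N. \<forall>i\<le>n. X N i = g i}" for n using S(1) infinite_super by blast
  then show ?thesis by blast
qed

lemma crossing_index:
  fixes f :: "nat \<Rightarrow> nat"
  assumes "f 0 = 0" "finite {t. f t \<le> l}"
  shows "\<exists>t. f t \<le> l \<and> l < f (Suc t)"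
proof -
  have ex: "\<exists>t. l < f t"
  proof (rule ccontr)
    assume "\<nexists>t. l < f t"
    then have "{t. f t \<le> l} = UNIV" by (auto simp: not_less)
    then show False using assms(2) by simp
  qed
  define T where "T = (LEAST t. l < f t)"
  have T: "l < f T" unfolding T_def by (rule LeastI_ex[OF ex])
  have below_T: "f t \<le> l" if "t < T" for t
    using not_less_Least[OF that[unfolded T_def]] by simp
  then obtain t where "T = Suc t" using assms(1) T by (cases T) auto
  then show ?thesis using T below_T by auto
qed
context thin_digraph begin

text \<open>Large indices of \<open>R\<close> belong to large indices of \<open>R'\<close>, because the out-ball of a fixed vertex
  contains \<open>R i\<close> for finitely many \<open>i\<close> only.\<close>
lemma below_parallel_left:
  assumes "proper_seq R" "parallel E R R'" "below E R Q"
  shows "below E R' Q"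
proof -
  obtain M where M: "\<And>i. \<exists>j. reaches E M (R' j) (R i)"
    using assms(2) unfolding parallel_def by blast
  obtain M' where M': "\<And>n. \<exists>i\<ge>n. \<exists>j\<ge>n. reaches E M' (R i) (Q j)"
    using assms(3) unfolding below_def by blast
  have "\<exists>i\<ge>n. \<exists>j\<ge>n. reaches E (M + M') (R' i) (Q j)" for n
  proof -
    have "finite (\<Union>t<n. {v. reaches E M (R' t) v})" using finite_out_ball by auto
    then obtain n' where n': "\<And>i. i \<ge> n' \<Longrightarrow> R i \<notin> (\<Union>t<n. {v. reaches E M (R' t) v})"
      using proper_seq_avoids[OF assms(1)] by blast
    obtain i j where ij: "i \<ge> max n n'" "j \<ge> max n n'" "reaches E M' (R i) (Q j)" using M' by blast
    obtain t where t: "reaches E M (R' t) (R i)" using M by blast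
    have "n \<le> t" using n'[of i] t ij(1) not_less by auto
    moreover have "reaches E (M + M') (R' t) (Q j)" using reaches_trans[OF t ij(3)] .
    ultimately show ?thesis using ij(2) by auto
  qed
  then show ?thesis unfolding below_def by blast
qed

lemma below_parallel_right:
  assumes "proper_seq R" "parallel E R R'" "below E Q R"
  shows "below E Q R'"
  using thin_digraph.below_parallel_left[OF thin_converse, of R R' Q] assms by simp

text \<open>Whenever two consecutive points of \<open>Q\<close> lie near \<open>R i\<close> and \<open>R j\<close>, the indices \<open>i\<close>
  and \<open>j\<close> differ by a bounded amount, so no point of \<open>R\<close> is left far from \<open>Q\<close>.\<close>
lemma path_near_quasi_geodesic:
  assumes R: "\<And>N. quasi_geodesic_upto E k \<gamma> c R N"
    and Q: "\<And>t. reaches E k' (Q t) (Q (Suc t))" "proper_seq Q" "R 0 = Q 0"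
    and near: "\<And>t. \<exists>i. reaches E M (Q t) (R i)"
  shows "\<exists>M'. \<forall>i. \<exists>t. reaches E M' (Q t) (R i)"
proof -
  define f where "f t = (if t = 0 then 0 else SOME i. reaches E M (Q t) (R i))" for t
  have f: "reaches E M (Q t) (R (f t))" for t
    using someI_ex[OF near[of t]] Q(3) unfolding f_def by (cases t) auto
  have fin: "finite {t. f t \<le> l}" for l
  proof -
    have "finite (\<Union>i\<le>l. {v. reaches E M v (R i)})" using finite_in_ball by auto
    then obtain n where n: "\<And>t. t \<ge> n \<Longrightarrow> Q t \<notin> (\<Union>i\<le>l. {v. reaches E M v (R i)})"
      using proper_seq_avoids[OF Q(2)] by blast
    have "{t. f t \<le> l} \<subseteq> {..<n}" using n f by (force simp: not_less[symmetric])
    then show ?thesis using finite_subset by blast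
  qed
  let ?b = "\<gamma> * cone_bound \<delta> K (k' + M) + c"
  have "\<exists>t. reaches E (M + k * ?b) (Q t) (R l)" for l
  proof -
    obtain t where t: "f t \<le> l" "l < f (Suc t)"
      using crossing_index[of f l] fin unfolding f_def by auto
    have path: "reaches E (k * (j - i)) (R i) (R j)" if "i \<le> j" for i j
      using path_reaches[of j E k R i j] R[of j] that unfolding quasi_geodesic_upto_def by auto
    have 1: "reaches E (k' + M) (Q t) (R (f t))" using f by (rule reaches_mono) simp
    have 2: "(R (f t), R (f (Suc t))) \<in> E\<^sup>*" using reaches_rtrancl[OF path] t by simp
    have "reaches E (cone_bound \<delta> K (k' + M)) (R (f t)) (R (f (Suc t)))"
      using reaches_of_common_source[OF 1 reaches_trans[OF Q(1) f] 2] .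
    then have "f (Suc t) - f t \<le> ?b"
      using R[of "f (Suc t)"] t unfolding quasi_geodesic_upto_def by simp
    then have "k * (l - f t) \<le> k * ?b" using t by (intro mult_le_mono) auto
    then have "reaches E (k * ?b) (R (f t)) (R l)" by (rule reaches_mono[OF path[OF t(1)]])
    then show ?thesis using reaches_trans[OF f] by blast
  qed
  then show ?thesis by blast
qed

lemma quasi_geodesic_near_path:
  assumes R: "\<And>N. quasi_geodesic_upto E k \<gamma> c R N"
    and Q: "\<And>t. reaches E k' (Q t) (Q (Suc t))" "proper_seq Q" "R 0 = Q 0"
    and near: "\<And>t. \<exists>i. reaches E M (R i) (Q t)"
  shows "\<exists>M'. \<forall>i. \<exists>t. reaches E M' (R i) (Q t)"
proof -
  define f where "f t = (if t = 0 then 0 else SOME i. reaches E M (R i) (Q t))" for t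
  have f: "reaches E M (R (f t)) (Q t)" for t
    using someI_ex[OF near[of t]] Q(3) unfolding f_def by (cases t) auto
  have fin: "finite {t. f t \<le> l}" for l
  proof -
    have "finite (\<Union>i\<le>l. {v. reaches E M (R i) v})" using finite_out_ball by auto
    then obtain n where n: "\<And>t. t \<ge> n \<Longrightarrow> Q t \<notin> (\<Union>i\<le>l. {v. reaches E M (R i) v})"
      using proper_seq_avoids[OF Q(2)] by blast
    have "{t. f t \<le> l} \<subseteq> {..<n}" using n f by (force simp: not_less[symmetric])
    then show ?thesis using finite_subset by blast
  qed
  let ?b = "\<gamma> * cone_bound \<delta> K (M + k') + c"
  have "\<exists>t. reaches E (k * ?b + M) (R l) (Q t)" for l
  proof -
    obtain t where t: "f t \<le> l" "l < f (Suc t)"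
      using crossing_index[of f l] fin unfolding f_def by auto
    have path: "reaches E (k * (j - i)) (R i) (R j)" if "i \<le> j" for i j
      using path_reaches[of j E k R i j] R[of j] that unfolding quasi_geodesic_upto_def by auto
    have 1: "reaches E (M + k') (R (f (Suc t))) (Q (Suc t))" using f by (rule reaches_mono) simp
    have 2: "(R (f t), R (f (Suc t))) \<in> E\<^sup>*" using reaches_rtrancl[OF path] t by simp
    have "reaches E (cone_bound \<delta> K (M + k')) (R (f t)) (R (f (Suc t)))"
      using reaches_of_common_target[OF reaches_trans[OF f Q(1)] 1 2] .
    then have "f (Suc t) - f t \<le> ?b"
      using R[of "f (Suc t)"] t unfolding quasi_geodesic_upto_def by simp
    then have "k * (f (Suc t) - l) \<le> k * ?b" using t by (intro mult_le_mono) auto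
    then have "reaches E (k * ?b) (R l) (R (f (Suc t)))"
      by (rule reaches_mono[OF path[OF less_imp_le[OF t(2)]]])
    then show ?thesis using reaches_trans[OF _ f] by blast
  qed
  then show ?thesis by blast
qed

lemma parallel_of_near:
  assumes "\<And>N. quasi_geodesic_upto E k \<gamma> c R N" "geodesic_ray E g" "R 0 = g 0"
    and "\<And>t. \<exists>i. reaches E M (g t) (R i)" "\<And>t. \<exists>i. reaches E M (R i) (g t)"
  shows "parallel E R g"
proof -
  have g: "\<And>t. reaches E (Suc 0) (g t) (g (Suc t))" "proper_seq g"
    using reaches_edge[OF geodesic_ray_edge[OF assms(2)]] coarse_ray_proper[OF geodesic_ray_coarse[OF assms(2)]] by auto
  obtain M1 where M1: "\<forall>i. \<exists>t. reaches E M1 (g t) (R i)"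
    using path_near_quasi_geodesic[OF assms(1) g assms(3,4)] by blast
  obtain M2 where M2: "\<forall>i. \<exists>t. reaches E M2 (R i) (g t)"
    using quasi_geodesic_near_path[OF assms(1) g assms(3,5)] by blast
  let ?M = "M + M1 + M2"
  have up: "reaches E M1 x y \<Longrightarrow> reaches E ?M x y" "reaches E M2 x y \<Longrightarrow> reaches E ?M x y"
    "reaches E M x y \<Longrightarrow> reaches E ?M x y" for x y
    by (auto elim: reaches_mono)
  show ?thesis
    unfolding parallel_def
    using M1 M2 assms(4,5) up by (intro exI[of "\<lambda>M. _ M \<and> _ M \<and> _ M \<and> _ M" ?M]) blast
qed

text \<open>Stability is uniform, so it survives the passage to limits of geodesics and quasi-geodesics
  with a common starting point and common end points.\<close>
lemma limits_parallel:
  fixes P W :: "nat \<Rightarrow> nat \<Rightarrow> 'a" and n l :: "nat \<Rightarrow> nat"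
  assumes P: "\<And>N. geodesic_upto E (P N) (n N)" "\<And>N. P N 0 = b" "\<And>m. finite {N. n N < m}"
    and W: "\<And>N. quasi_geodesic_upto E k \<gamma> c (W N) (l N)" "\<And>N. W N 0 = b" "\<And>N. W N (l N) = P N (n N)"
  shows "\<exists>g R. geodesic_ray E g \<and> g 0 = b \<and> (\<forall>N. quasi_geodesic_upto E k \<gamma> c R N) \<and> R 0 = b \<and>
    parallel E R g \<and> (\<forall>m. infinite {N. m \<le> n N \<and> m \<le> l N \<and> (\<forall>i\<le>m. P N i = g i \<and> W N i = R i)})"
proof -
  \<comment> \<open>Beyond their ends the sequences are made constant, which keeps each coordinate in a finite set.\<close>
  define X where "X N i = (if i \<le> n N then P N i else b, if i \<le> l N then W N i else b)" for N i
  have Wball: "reaches E (k * i) b (W N i)" if "i \<le> l N" for N i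
    using path_reaches[of "l N" E k "W N" 0 i] W(1)[of N] W(2) that unfolding quasi_geodesic_upto_def by auto
  have Pball: "reaches E i b (P N i)" if "i \<le> n N" for N i
    using geodesic_uptoD(1)[OF P(1), of 0 i N] P(2) that by simp
  have "range (\<lambda>N. X N i) \<subseteq> {v. reaches E i b v} \<times> {v. reaches E (k * i) b v}" for i
    using Wball Pball unfolding X_def by auto
  then have finX: "\<And>i. finite (range (\<lambda>N. X N i))"
    using finite_out_ball finite_subset by (metis finite_cartesian_product)
  obtain gr where gr: "\<And>m. infinite {N. \<forall>i\<le>m. X N i = gr i}" using koenig_limit[of X, OF finX] by blast
  define g where "g i = fst (gr i)" for i
  define R where "R i = snd (gr i)" for i
  have finl: "finite {N. l N < m}" for m
  proof -
    have "n N < Suc (k * m)" if "l N < m" for N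
    proof -
      have "n N = dst E b (W N (l N))" using P(1)[of N] P(2) W(3) unfolding geodesic_upto_def by metis
      also have "\<dots> \<le> k * l N" using Wball by (intro dst_le) simp
      also have "\<dots> \<le> k * m" using that by simp
      finally show ?thesis by simp
    qed
    then have "{N. l N < m} \<subseteq> {N. n N < Suc (k * m)}" by auto
    then show ?thesis using P(3) finite_subset by blast
  qed
  have inf: "infinite {N. m \<le> n N \<and> m \<le> l N \<and> (\<forall>i\<le>m. P N i = g i \<and> W N i = R i)}" for m
  proof -
    have "infinite ({N. \<forall>i\<le>m. X N i = gr i} - ({N. n N < m} \<union> {N. l N < m}))"
      using gr P(3) finl by (intro Diff_infinite_finite) auto
    moreover have "{N. \<forall>i\<le>m. X N i = gr i} - ({N. n N < m} \<union> {N. l N < m})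
      \<subseteq> {N. m \<le> n N \<and> m \<le> l N \<and> (\<forall>i\<le>m. P N i = g i \<and> W N i = R i)}"
    proof
      fix N assume N: "N \<in> {N. \<forall>i\<le>m. X N i = gr i} - ({N. n N < m} \<union> {N. l N < m})"
      then have "m \<le> n N" "m \<le> l N" by auto
      moreover have "P N i = g i \<and> W N i = R i" if "i \<le> m" for i
      proof -
        have "gr i = (P N i, W N i)" using N that unfolding X_def by auto
        then show ?thesis unfolding g_def R_def by simp
      qed
      ultimately show "N \<in> {N. m \<le> n N \<and> m \<le> l N \<and> (\<forall>i\<le>m. P N i = g i \<and> W N i = R i)}" by blast
    qed
    ultimately show ?thesis using infinite_super by blast
  qed
  have ex: "\<exists>N. m \<le> n N \<and> m \<le> l N \<and> (\<forall>i\<le>m. P N i = g i \<and> W N i = R i)" for m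
    using inf[of m] not_finite_existsD by blast
  have g: "geodesic_ray E g"
    unfolding geodesic_ray_def
  proof
    fix m obtain N where "m \<le> n N" "\<forall>i\<le>m. P N i = g i" using ex by blast
    then show "geodesic_upto E g m"
      using geodesic_upto_cong geodesic_upto_mono[OF P(1)] by (metis (full_types))
  qed
  have R: "quasi_geodesic_upto E k \<gamma> c R m" for m
  proof -
    obtain N where "m \<le> l N" "\<forall>i\<le>m. W N i = R i" using ex by blast
    then show ?thesis
      using quasi_geodesic_upto_cong[of m "W N" R] quasi_geodesic_upto_mono[OF W(1)] by blast
  qed
  have g0: "g 0 = b" "R 0 = b" using ex[of 0] P(2) W(2) by auto
  obtain M where M: "\<forall>P n W N. geodesic_upto E P n \<longrightarrow> quasi_geodesic_upto E k \<gamma> c W N \<longrightarrow> W 0 = P 0 \<longrightarrow> W N = P n \<longrightarrow>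
     (\<forall>t\<le>n. (\<exists>i\<le>N. reaches E M (P t) (W i)) \<and> (\<exists>i\<le>N. reaches E M (W i) (P t)))"
    using quasi_geodesic_stability[of k \<gamma> c] by (rule exE)
  have near: "(\<exists>i. reaches E M (g t) (R i)) \<and> (\<exists>i. reaches E M (R i) (g t))" for t
  proof -
    \<comment> \<open>The index on \<open>W N\<close> provided by stability is bounded independently of \<open>N\<close>, so agreement of
      \<open>W N\<close> with \<open>R\<close> up to \<open>m\<close> suffices.\<close>
    define m where "m = t + (\<gamma> * (t + C * M) + c)"
    obtain N where N: "m \<le> n N" "m \<le> l N" "\<And>i. i \<le> m \<Longrightarrow> P N i = g i" "\<And>i. i \<le> m \<Longrightarrow> W N i = R i"
      using ex[of m] by blast
    have tn: "t \<le> n N" using N(1) unfolding m_def by simp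
    have Pt: "P N t = g t" using N(3)[of t] unfolding m_def by simp
    have bound: "W N i = R i" if "i \<le> l N" "reaches E (t + C * M) b (W N i)" for i
    proof -
      have "i - 0 \<le> \<gamma> * (t + C * M) + c"
        using W(1)[of N] W(2)[of N] that unfolding quasi_geodesic_upto_def by (metis zero_le)
      then show ?thesis using N(4)[of i] unfolding m_def by simp
    qed
    have MC: "M \<le> C * M" unfolding potential_bound_def by simp
    have both: "(\<exists>i\<le>l N. reaches E M (P N t) (W N i)) \<and> (\<exists>i\<le>l N. reaches E M (W N i) (P N t))"
      using M[rule_format, of "P N" "n N" "W N" "l N" t] P(1,2) W(1,2,3) tn by simp
    obtain i where i: "i \<le> l N" "reaches E M (P N t) (W N i)" using both by blast
    obtain j where j: "j \<le> l N" "reaches E M (W N j) (P N t)" using both by blast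
    have "reaches E (t + C * M) b (W N i)"
      by (rule reaches_trans_le[OF Pball[OF tn] i(2)]) (use MC in simp)
    moreover have bj: "(b, W N j) \<in> E\<^sup>*" using reaches_rtrancl[OF Wball[OF j(1)]] .
    then have "dst E b (W N j) \<le> dst E b (P N t) + C * M" using dst_reaches_le[OF _ j(2)] by blast
    then have "reaches E (t + C * M) b (W N j)"
      using bj dst_le[OF Pball[OF tn]] unfolding reaches_iff by simp
    ultimately show ?thesis using bound[OF i(1)] bound[OF j(1)] i(2) j(2) Pt by metis
  qed
  have "parallel E R g"
    using parallel_of_near[OF R g _ conjunct1[OF near] conjunct2[OF near]] g0 by simp
  then show ?thesis using g R g0 inf by blast
qed

text \<open>Apply the limit lemma to the initial pieces of \<open>R\<close> and geodesics between their ends.\<close>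
lemma coarse_ray_parallel_geodesic:
  assumes "coarse_ray E R"
  shows "\<exists>g. geodesic_ray E g \<and> g 0 = R 0 \<and> parallel E R g"
proof -
  obtain k \<gamma> c where q: "\<And>N. quasi_geodesic_upto E k \<gamma> c R N"
    using assms unfolding coarse_ray_def by blast
  have reach: "(R 0, R N) \<in> E\<^sup>*" for N
    by (rule reaches_rtrancl[OF path_reaches[of N E k R 0 N]])
      (use q[of N] in \<open>auto simp: quasi_geodesic_upto_def\<close>)
  have "\<forall>N. \<exists>p. geodesic_upto E p (dst E (R 0) (R N)) \<and> p 0 = R 0 \<and> p (dst E (R 0) (R N)) = R N"
    using geodesic_upto_exists[OF reach] by blast
  then obtain P where P: "\<And>N. geodesic_upto E (P N) (dst E (R 0) (R N))" "\<And>N. P N 0 = R 0"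
      "\<And>N. P N (dst E (R 0) (R N)) = R N" by metis
  have fin: "finite {N. dst E (R 0) (R N) < m}" for m
  proof -
    have "N \<le> \<gamma> * m + c" if "dst E (R 0) (R N) < m" for N
    proof -
      have "reaches E m (R 0) (R N)" using reach that unfolding reaches_iff by simp
      then have "N - 0 \<le> \<gamma> * m + c" using q[of N] unfolding quasi_geodesic_upto_def by blast
      then show ?thesis by simp
    qed
    then have "{N. dst E (R 0) (R N) < m} \<subseteq> {..\<gamma> * m + c}" by auto
    then show ?thesis using finite_subset by blast
  qed
  obtain g R' where g: "geodesic_ray E g" "g 0 = R 0" "parallel E R' g"
    "\<And>m. infinite {N. m \<le> dst E (R 0) (R N) \<and> m \<le> N \<and> (\<forall>i\<le>m. P N i = g i \<and> R i = R' i)}"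
    using limits_parallel[OF P(1,2) fin, of k \<gamma> c "\<lambda>_. R" "\<lambda>N. N"] q P(3) by auto
  have "R' i = R i" for i
    using g(4)[of i] not_finite_existsD by (metis (mono_tags, lifting) order_refl)
  then have "R' = R" by auto
  then show ?thesis using g by blast
qed

text \<open>The geodesics of \<open>X\<close> from \<open>g 0\<close> to the vertices of \<open>g\<close> are quasi-geodesics of \<open>E\<close> with uniform
  constants; their limit is a geodesic ray of \<open>X\<close>.\<close>
lemma geodesic_ray_change_digraph:
  assumes XE: "\<And>x y. (x, y) \<in> X \<Longrightarrow> reaches E k x y" and EX: "\<And>x y. (x, y) \<in> E \<Longrightarrow> reaches X k x y"
    and g: "geodesic_ray E g"
  shows "\<exists>h. geodesic_ray X h \<and> h 0 = g 0 \<and> parallel E g h \<and> coarse_ray E h"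
proof -
  have reach: "(g 0, g N) \<in> X\<^sup>*" for N
    using rtrancl_step_mono[OF EX geodesic_rayD(3)[OF g, of 0 N]] by simp
  have "\<forall>N. \<exists>p. geodesic_upto X p (dst X (g 0) (g N)) \<and> p 0 = g 0 \<and> p (dst X (g 0) (g N)) = g N"
    using geodesic_upto_exists[OF reach] by blast
  then obtain W where W: "\<And>N. geodesic_upto X (W N) (dst X (g 0) (g N))" "\<And>N. W N 0 = g 0"
      "\<And>N. W N (dst X (g 0) (g N)) = g N" by metis
  have qW: "quasi_geodesic_upto E k k 0 (W N) (dst X (g 0) (g N))" for N
    unfolding quasi_geodesic_upto_def
  proof (intro conjI allI impI)
    fix i j m assume "i \<le> j" "j \<le> dst X (g 0) (g N)" "reaches E m (W N i) (W N j)"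
    then show "j - i \<le> k * m + 0"
      using geodesic_uptoD(2)[OF W(1)] dst_le[OF reaches_step_mono[OF EX]] by fastforce
  qed (use W(1) XE in \<open>auto simp: geodesic_upto_def\<close>)
  have fin: "finite {N::nat. N < m}" for m by simp
  have gN: "geodesic_upto E g N" for N using g unfolding geodesic_ray_def by blast
  obtain g' h where h: "geodesic_ray E g'" "\<forall>N. quasi_geodesic_upto E k k 0 h N" "h 0 = g 0" "parallel E h g'"
    "\<And>m. infinite {N. m \<le> N \<and> m \<le> dst X (g 0) (g N) \<and> (\<forall>i\<le>m. g i = g' i \<and> W N i = h i)}"
    using limits_parallel[OF gN refl fin qW W(2) W(3)] by blast
  have ex: "\<exists>N. m \<le> N \<and> m \<le> dst X (g 0) (g N) \<and> (\<forall>i\<le>m. g i = g' i \<and> W N i = h i)" for m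
    using h(5)[of m] not_finite_existsD by blast
  have "g' i = g i" for i using ex[of i] by auto
  then have "g' = g" by auto
  moreover have "geodesic_ray X h"
    unfolding geodesic_ray_def
  proof
    fix m obtain N where "m \<le> dst X (g 0) (g N)" "\<forall>i\<le>m. W N i = h i" using ex by blast
    then show "geodesic_upto X h m"
      using geodesic_upto_cong geodesic_upto_mono[OF W(1)] by (metis (full_types))
  qed
  ultimately show ?thesis using h parallel_sym unfolding coarse_ray_def by blast
qed

end

section \<open>Geodesic rays from a common vertex\<close>

definition far :: "'a rel \<Rightarrow> 'a \<Rightarrow> nat \<Rightarrow> 'a \<Rightarrow> bool" where
  "far E b L v \<longleftrightarrow> (b, v) \<in> E\<^sup>* \<and> L \<le> dst E b v"

definition far_step :: "'a rel \<Rightarrow> 'a \<Rightarrow> nat \<Rightarrow> 'a rel" where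
  "far_step E b L = {(u, v). far E b L u \<and> far E b L v \<and> ((u, v) \<in> E \<or> (v, u) \<in> E)}"

text \<open>The ray \<open>g\<close> points in the direction of \<open>v\<close>, as seen at distance \<open>n\<close> from \<open>b\<close>.\<close>
definition tracks :: "'a rel \<Rightarrow> nat \<Rightarrow> 'a \<Rightarrow> nat \<Rightarrow> (nat \<Rightarrow> 'a) \<Rightarrow> 'a \<Rightarrow> bool" where
  "tracks E \<delta> b n g v \<longleftrightarrow>
     (\<exists>X z s. segment E b v X \<and> z \<in> X \<and> dst E b z = n \<and> reaches E \<delta> (g s) z)"

definition many_directions :: "'a rel \<Rightarrow> bool" where
  "many_directions E \<longleftrightarrow> (\<exists>b G. infinite G \<and> (\<forall>g\<in>G. geodesic_ray E g \<and> g 0 = b) \<and>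
     (\<forall>g\<in>G. \<forall>h\<in>G. g \<noteq> h \<longrightarrow> \<not> below E g h))"

lemma geodesic_ray_segment: "geodesic_ray E g \<Longrightarrow> segment E (g 0) (g n) (g ` {0..n})"
  using segment_of_path[of E g n 0 n] unfolding geodesic_ray_def by simp

context thin_digraph begin

text \<open>Even if two geodesic rays from \<open>b\<close> come \<open>M\<close>-close only at far away places, the long thin
  triangles with apex \<open>b\<close> make them \<open>\<delta>\<close>-close throughout, with \<open>\<delta>\<close> independent of \<open>M\<close>, and in both
  directions.\<close>
lemma below_near:
  assumes g: "geodesic_ray E g" "g 0 = b" and h: "geodesic_ray E h" "h 0 = b" and "below E g h"
  shows "\<exists>s. reaches E \<delta> (g s) (h t)" "\<exists>s. reaches E \<delta> (h s) (g t)"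
proof -
  obtain M where M: "\<And>n. \<exists>i\<ge>n. \<exists>j\<ge>n. reaches E M (g i) (h j)"
    using assms(5) unfolding below_def by blast
  obtain i j where ij: "i \<ge> t + \<delta> + C * M + 1" "j \<ge> t + \<delta> + C * M + 1" "reaches E M (g i) (h j)"
    using M by blast
  have G: "segment E b (g i) (g ` {0..i})" using geodesic_ray_segment[OF g(1)] g(2) by simp
  have H: "segment E b (h j) (h ` {0..j})" using geodesic_ray_segment[OF h(1)] h(2) by simp
  obtain Z where Z: "segment E (g i) (h j) Z" using segment_exists[OF reaches_rtrancl[OF ij(3)]] by blast
  have far: "\<not> reaches E \<delta> v z" if v: "(b, v) \<in> E\<^sup>*" "dst E b v \<le> t" and z: "z \<in> Z" for v z
  proof
    assume "reaches E \<delta> v z"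
    then have "dst E b z \<le> t + \<delta>" using dst_reaches_right[OF v(1)] v(2) by fastforce
    moreover have "reaches E M (g i) z"
      by (rule reaches_mono[OF segment_between(4)[OF Z z] dst_le[OF ij(3)]])
    then have "dst E b (g i) \<le> dst E b z + C * M"
      using dst_reaches_le geodesic_rayD(3)[OF g(1), of 0 i] g(2) by simp
    ultimately show False using geodesic_rayD(2)[OF g(1), of 0 i] g(2) ij(1) by simp
  qed
  have gt: "(b, g t) \<in> E\<^sup>*" "dst E b (g t) = t" "(b, h t) \<in> E\<^sup>*" "dst E b (h t) = t"
    using geodesic_rayD(2,3)[OF g(1), of 0 t] geodesic_rayD(2,3)[OF h(1), of 0 t] g(2) h(2) by auto
  have "(\<exists>q\<in>h ` {0..j}. reaches E \<delta> q (g t)) \<or> (\<exists>q\<in>Z. reaches E \<delta> (g t) q)"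
    by (rule thin[OF G disjI1[OF H] disjI1[OF Z]]) (use ij in auto)
  then show "\<exists>s. reaches E \<delta> (h s) (g t)" using far[OF gt(1)] gt(2) by auto
  have "(\<exists>q\<in>g ` {0..i}. reaches E \<delta> q (h t)) \<or> (\<exists>q\<in>Z. reaches E \<delta> (h t) q)"
    by (rule thin[OF H disjI1[OF G] disjI2[OF Z]]) (use ij in auto)
  then show "\<exists>s. reaches E \<delta> (g s) (h t)" using far[OF gt(3)] gt(4) by auto
qed

lemma geodesic_ray_proper: "geodesic_ray E g \<Longrightarrow> proper_seq g"
  by (rule coarse_ray_proper[OF geodesic_ray_coarse])

lemma below_geodesic_sym:
  assumes "geodesic_ray E g" "g 0 = b" "geodesic_ray E h" "h 0 = b" "below E g h"
  shows "below E h g"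
  unfolding below_def
proof (rule exI[of _ \<delta>], intro allI)
  fix n
  obtain s where s: "reaches E \<delta> (h s) (g (n + \<delta>))"
    using below_near(2)[OF assms] by blast
  have "dst E b (g (n + \<delta>)) \<le> dst E b (h s) + \<delta>"
    using dst_reaches_right[OF _ s] geodesic_rayD(3)[OF assms(3), of 0 s] assms(4) by simp
  then have "n \<le> s"
    using geodesic_rayD(2)[OF assms(3), of 0 s] geodesic_rayD(2)[OF assms(1), of 0 "n + \<delta>"] assms(2,4) by simp
  then show "\<exists>i\<ge>n. \<exists>j\<ge>n. reaches E \<delta> (h i) (g j)" using s by (meson le_add1)
qed

lemma below_geodesic_trans:
  assumes g: "geodesic_ray E g" "g 0 = b" and h: "geodesic_ray E h" "h 0 = b" and f: "geodesic_ray E f" "f 0 = b"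
    and gh: "below E g h" and hf: "below E h f"
  shows "below E g f"
  unfolding below_def
proof (rule exI[of _ "\<delta> + \<delta>"], intro allI)
  fix n
  obtain s where s: "reaches E \<delta> (h s) (f (n + 2 * \<delta>))"
    using below_near(1)[OF h f hf] by blast
  obtain r where r: "reaches E \<delta> (g r) (h s)"
    using below_near(1)[OF g h gh] by blast
  have rs: "reaches E (\<delta> + \<delta>) (g r) (f (n + 2 * \<delta>))" by (rule reaches_trans[OF r s])
  have "dst E b (f (n + 2 * \<delta>)) \<le> dst E b (g r) + (\<delta> + \<delta>)"
    using dst_reaches_right[OF _ rs] geodesic_rayD(3)[OF g(1), of 0 r] g(2) by simp
  then have "n \<le> r"
    using geodesic_rayD(2)[OF g(1), of 0 r] geodesic_rayD(2)[OF f(1), of 0 "n + 2 * \<delta>"] g(2) f(2) by simp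
  then show "\<exists>i\<ge>n. \<exists>j\<ge>n. reaches E (\<delta> + \<delta>) (g i) (f j)" using rs by (meson le_add1)
qed

text \<open>A path of length \<open>r\<close> that starts far enough from \<open>b\<close> does not come close to \<open>b\<close>, since distances
  from \<open>b\<close> drop by at most \<open>C\<close> along an edge.\<close>
lemma far_path:
  assumes "(b, u) \<in> E\<^sup>*" "reaches E r u v" "L + C * r \<le> dst E b u"
  shows "(u, v) \<in> (far_step E b L)\<^sup>*"
proof -
  have "m \<le> r \<Longrightarrow> (u, v) \<in> E ^^ m \<Longrightarrow> (u, v) \<in> (far_step E b L)\<^sup>*" for m
  proof (induction m arbitrary: v)
    case (Suc m)
    obtain w where w: "(u, w) \<in> E ^^ m" "(w, v) \<in> E" using Suc.prems(2) by auto
    have *: "far E b L x" if "(u, x) \<in> E ^^ l" "l \<le> r" for x l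
    proof -
      have "reaches E r u x" using that unfolding reaches_def by blast
      then have "dst E b u \<le> dst E b x + C * r" "(u, x) \<in> E\<^sup>*"
        using dst_reaches_le[OF assms(1)] reaches_rtrancl by auto
      then show ?thesis using assms(1,3) unfolding far_def by auto
    qed
    have "(w, v) \<in> far_step E b L"
      using *[OF w(1)] *[OF Suc.prems(2,1)] w(2) Suc.prems(1) unfolding far_step_def by simp
    then show ?case using Suc.IH[OF _ w(1)] Suc.prems(1) by auto
  qed simp
  then show ?thesis using assms(2) unfolding reaches_def by blast
qed

text \<open>Geodesics from \<open>b\<close> to adjacent far away vertices stay together near \<open>b\<close>, so rays that
  run along these two geodesics come close to each other.\<close>
lemma tracks_adjacent:
  assumes g: "geodesic_ray E g" "g 0 = b" and h: "geodesic_ray E h" "h 0 = b"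
    and n: "n = n0 + 6 * \<delta> + C * \<delta> + 1"
    and far: "far E b (n + C + 1) v" "far E b (n + C + 1) w"
    and tr: "tracks E \<delta> b n g v" "tracks E \<delta> b n h w"
    and adj: "reaches E 1 v w \<or> reaches E 1 w v"
  shows "\<exists>i\<ge>n0. \<exists>j\<ge>n0. reaches E (4 * \<delta> + C * \<delta>) (g i) (h j)"
proof -
  obtain X z s where X: "segment E b v X" "z \<in> X" "dst E b z = n" "reaches E \<delta> (g s) z"
    using tr(1) unfolding tracks_def by blast
  obtain Y z' s' where Y: "segment E b w Y" "z' \<in> Y" "dst E b z' = n" "reaches E \<delta> (h s') z'"
    using tr(2) unfolding tracks_def by blast
  \<comment> \<open>The comparison takes place at distance \<open>m\<close> from \<open>b\<close>: below \<open>n\<close> by a margin for the steps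
    that follow, and above \<open>n0\<close> by \<open>2 * \<delta>\<close> so that the index found on \<open>g\<close> is at least \<open>n0\<close>.\<close>
  define m where "m = n0 + 2 * \<delta>"
  have wn: "n + C + 1 \<le> dst E b w" using far(2) unfolding far_def by simp
  obtain p where p: "p \<in> Y" "dst E b p = m"
    using segment_point[OF Y(1), of m] wn n unfolding m_def by auto
  have bp: "(b, p) \<in> E\<^sup>*" using segment_between(1)[OF Y(1) p(1)] .
  have bz: "(b, z) \<in> E\<^sup>*" "(b, z') \<in> E\<^sup>*" using segment_between(1)[OF X(1,2)] segment_between(1)[OF Y(1,2)] by auto
  have "\<exists>Z. (segment E v w Z \<or> segment E w v Z) \<and> (\<forall>e\<in>Z. n + 1 \<le> dst E b e)"
  proof -
    have *: "\<exists>Z. segment E u u' Z \<and> (\<forall>e\<in>Z. n + 1 \<le> dst E b e)"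
      if u: "reaches E 1 u u'" "far E b (n + C + 1) u" for u u'
    proof -
      obtain Z where Z: "segment E u u' Z" using segment_exists[OF reaches_rtrancl[OF u(1)]] by blast
      have "n + 1 \<le> dst E b e" if "e \<in> Z" for e
      proof -
        have "reaches E 1 u e" by (rule reaches_mono[OF segment_between(4)[OF Z that] dst_le[OF u(1)]])
        then have "dst E b u \<le> dst E b e + C * 1" using dst_reaches_le u(2) unfolding far_def by blast
        then show ?thesis using u(2) unfolding far_def by simp
      qed
      then show ?thesis using Z by blast
    qed
    then show ?thesis using adj far by blast
  qed
  then obtain Z where Z: "segment E w v Z \<or> segment E v w Z" "\<And>e. e \<in> Z \<Longrightarrow> n + 1 \<le> dst E b e" by blast
  have "\<not> reaches E \<delta> p e" if "e \<in> Z" for e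
    using dst_reaches_right[OF bp, of \<delta> e] p(2) Z(2)[OF that] n unfolding m_def by fastforce
  then obtain q where q: "q \<in> X" "reaches E \<delta> q p"
    using thin[OF Y(1) disjI1[OF X(1)] Z(1) p(1)] by blast
  have bq: "(b, q) \<in> E\<^sup>*" using segment_between(1)[OF X(1) q(1)] .
  have dq: "dst E b q \<le> m + C * \<delta>" using dst_reaches_le[OF bq q(2)] p(2) by simp
  obtain X' where X': "segment E b z X'" "\<And>u. u \<in> X \<Longrightarrow> dst E b u \<le> n \<Longrightarrow> u \<in> X'"
    using segment_initial[OF X(1,2)] X(3) by blast
  have qX': "q \<in> X'" using X'(2)[OF q(1)] dq n unfolding m_def by simp
  obtain A where A: "segment E (g s) z A" using segment_exists[OF reaches_rtrancl[OF X(4)]] by blast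
  have G: "segment E b (g s) (g ` {0..s})" using geodesic_ray_segment[OF g(1)] g(2) by simp
  have "\<not> reaches E \<delta> q e" if e: "e \<in> A" for e
  proof
    assume "reaches E \<delta> q e"
    then have "dst E b e \<le> dst E b q + \<delta>" and be: "(b, e) \<in> E\<^sup>*"
      using dst_reaches_right[OF bq] rtrancl_trans[OF bq reaches_rtrancl] by auto
    moreover have "reaches E \<delta> e z"
      by (rule reaches_mono[OF segment_between(5)[OF A e] dst_le[OF X(4)]])
    then have "n \<le> dst E b e + \<delta>" using dst_reaches_right[OF be, of \<delta> z] X(3) by simp
    ultimately show False using dq n unfolding m_def by simp
  qed
  then obtain i where i: "reaches E \<delta> (g i) q"
    using thin[OF X'(1) disjI1[OF G] disjI2[OF A] qX'] by blast
  have gp: "reaches E (\<delta> + \<delta>) (g i) p" by (rule reaches_trans[OF i q(2)])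
  have "m \<le> dst E b (g i) + (\<delta> + \<delta>)"
    using dst_reaches_right[OF _ gp, of b] geodesic_rayD(3)[OF g(1), of 0 i] g(2) p(2) by simp
  then have i0: "n0 \<le> i" using geodesic_rayD(2)[OF g(1), of 0 i] g(2) unfolding m_def by simp
  have hs: "(b, h s') \<in> E\<^sup>*" "dst E b (h s') = s'"
    using geodesic_rayD(2,3)[OF h(1), of 0 s'] h(2) by auto
  have "n \<le> s' + \<delta>" using dst_reaches_right[OF hs(1) Y(4)] hs(2) Y(3) by simp
  then have ms': "m + \<delta> \<le> s'" using n unfolding m_def by simp
  have hm: "(b, h (m + \<delta>)) \<in> E\<^sup>*" "dst E b (h (m + \<delta>)) = m + \<delta>"
    using geodesic_rayD(2,3)[OF h(1), of 0 "m + \<delta>"] h(2) by auto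
  obtain Y' where Y': "segment E b z' Y'" "Y' \<subseteq> Y"
    using segment_initial[OF Y(1,2)] by blast
  obtain B where B: "segment E (h s') z' B" using segment_exists[OF reaches_rtrancl[OF Y(4)]] by blast
  have H: "segment E b (h s') (h ` {0..s'})" using geodesic_ray_segment[OF h(1)] h(2) by simp
  have "\<not> reaches E \<delta> (h (m + \<delta>)) e" if e: "e \<in> B" for e
  proof
    assume "reaches E \<delta> (h (m + \<delta>)) e"
    then have "dst E b e \<le> m + \<delta> + \<delta>" and be: "(b, e) \<in> E\<^sup>*"
      using dst_reaches_right[OF hm(1)] rtrancl_trans[OF hm(1) reaches_rtrancl] hm(2) by auto
    moreover have "reaches E \<delta> e z'"
      by (rule reaches_mono[OF segment_between(5)[OF B e] dst_le[OF Y(4)]])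
    then have "n \<le> dst E b e + \<delta>" using dst_reaches_right[OF be, of \<delta> z'] Y(3) by simp
    ultimately show False using n unfolding m_def by simp
  qed
  moreover have "h (m + \<delta>) \<in> h ` {0..s'}" using ms' by simp
  ultimately obtain p' where p': "p' \<in> Y" "reaches E \<delta> p' (h (m + \<delta>))"
    using thin[OF H disjI1[OF Y'(1)] disjI1[OF B]] Y'(2) by blast
  have bp': "(b, p') \<in> E\<^sup>*" using segment_between(1)[OF Y(1) p'(1)] .
  have "m \<le> dst E b p'" "dst E b p' \<le> m + \<delta> + C * \<delta>"
    using dst_reaches_right[OF bp' p'(2)] dst_reaches_le[OF bp' p'(2)] hm(2) by auto
  then have "reaches E (\<delta> + C * \<delta>) p p'"
    using segment_order[OF Y(1) p(1) p'(1)] p(2) by (auto elim: reaches_mono)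
  from reaches_trans[OF gp reaches_trans[OF this p'(2)]]
  have "reaches E (4 * \<delta> + C * \<delta>) (g i) (h (m + \<delta>))"
    by (rule reaches_mono) simp
  then show ?thesis using i0 unfolding m_def by (intro exI[of _ i] conjI exI[of _ "n0 + 2 * \<delta> + \<delta>"]) auto
qed

text \<open>Otherwise geodesics from \<open>b\<close> to untracked vertices farther and farther away would have a limit
  ray, whose direction is tracked by some member of \<open>G\<close>.\<close>
lemma far_vertices_tracked:
  assumes cover: "\<And>g. geodesic_ray E g \<Longrightarrow> g 0 = b \<Longrightarrow> \<exists>h\<in>G. geodesic_ray E h \<and> h 0 = b \<and> below E h g"
  shows "\<exists>L. \<forall>v. far E b L v \<longrightarrow> (\<exists>g\<in>G. tracks E \<delta> b n g v)"
proof (rule ccontr)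
  assume "\<nexists>L. \<forall>v. far E b L v \<longrightarrow> (\<exists>g\<in>G. tracks E \<delta> b n g v)"
  then have "\<forall>L. \<exists>v. far E b L v \<and> (\<forall>g\<in>G. \<not> tracks E \<delta> b n g v)" by blast
  then obtain V where V: "\<And>L. far E b L (V L)" "\<And>L g. g \<in> G \<Longrightarrow> \<not> tracks E \<delta> b n g (V L)" by metis
  have reach: "(b, V L) \<in> E\<^sup>*" for L using V(1) unfolding far_def by blast
  have "\<forall>L. \<exists>p. geodesic_upto E p (dst E b (V L)) \<and> p 0 = b \<and> p (dst E b (V L)) = V L"
    using geodesic_upto_exists[OF reach] by blast
  then obtain P where P: "\<And>L. geodesic_upto E (P L) (dst E b (V L))" "\<And>L. P L 0 = b"
    "\<And>L. P L (dst E b (V L)) = V L" by metis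
  have fin: "finite {N. dst E b (V N) < m}" for m
  proof -
    have "{N. dst E b (V N) < m} \<subseteq> {..<m}"
      using V(1) unfolding far_def by (auto intro: le_less_trans)
    then show ?thesis using finite_subset by blast
  qed
  have q: "quasi_geodesic_upto E 1 1 0 (P N) (dst E b (V N))" for N
    unfolding quasi_geodesic_upto_def
  proof (intro conjI allI impI)
    fix i assume "i < dst E b (V N)"
    then show "reaches E 1 (P N i) (P N (Suc i))"
      using P(1)[of N] reaches_edge unfolding geodesic_upto_def by fastforce
  next
    fix i j m assume "i \<le> j" "j \<le> dst E b (V N)" "reaches E m (P N i) (P N j)"
    then show "j - i \<le> 1 * m + 0" using geodesic_uptoD(2)[OF P(1)] dst_le by fastforce
  qed
  obtain g R where g: "geodesic_ray E g" "g 0 = b"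
    "\<And>m. infinite {N. m \<le> dst E b (V N) \<and> m \<le> dst E b (V N) \<and> (\<forall>i\<le>m. P N i = g i \<and> P N i = R i)}"
    using limits_parallel[OF P(1,2) fin q P(2) refl] by blast
  obtain N where N: "n \<le> dst E b (V N)" "P N n = g n"
    using g(3)[of n] not_finite_existsD by blast
  obtain h where h: "h \<in> G" "geodesic_ray E h" "h 0 = b" "below E h g" using cover[OF g(1,2)] by blast
  obtain s where s: "reaches E \<delta> (h s) (g n)" using below_near(1)[OF h(2,3) g(1,2) h(4)] by blast
  have "segment E b (V N) (P N ` {0..dst E b (V N)})"
    using segment_of_path[OF P(1), of 0 "dst E b (V N)" N] P(2,3) by simp
  moreover have "dst E b (g n) = n" using geodesic_rayD(2)[OF g(1), of 0 n] g(2) by simp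
  moreover have "g n \<in> P N ` {0..dst E b (V N)}" using N by (metis atLeastAtMost_iff imageI zero_le)
  ultimately have "tracks E \<delta> b n h (V N)" using s unfolding tracks_def by blast
  then show False using V(2)[OF h(1)] by blast
qed

text \<open>If only finitely many directions leave \<open>b\<close>, then far from \<open>b\<close> the direction of a vertex
  cannot change along an edge.\<close>
theorem far_connected_below:
  assumes g1: "geodesic_ray E g1" "g1 0 = b" and g2: "geodesic_ray E g2" "g2 0 = b"
    and conn: "\<And>L. \<exists>i j. far E b L (g1 i) \<and> (g1 i, g2 j) \<in> (far_step E b L)\<^sup>*"
    and few: "\<not> many_directions E"
  shows "below E g1 g2"
proof -
  define S where "S = {g. geodesic_ray E g \<and> g 0 = b}"
  \<comment> \<open>One representative for each direction.\<close>
  define rep where "rep g = (SOME h. h \<in> S \<and> below E g h)" for g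
  have below_refl: "below E g g" for g unfolding below_def by (meson order_refl reaches_refl)
  have sym: "below E g h \<Longrightarrow> below E h g" if "g \<in> S" "h \<in> S" for g h
    using below_geodesic_sym that unfolding S_def by blast
  have trans: "below E g h \<Longrightarrow> below E h f \<Longrightarrow> below E g f" if "g \<in> S" "h \<in> S" "f \<in> S" for g h f
    using below_geodesic_trans that unfolding S_def by blast
  have rep: "rep g \<in> S" "below E g (rep g)" if "g \<in> S" for g
    using someI[of "\<lambda>h. h \<in> S \<and> below E g h" g] that below_refl unfolding rep_def by auto
  have rep_eq: "rep g = rep h" if "g \<in> S" "h \<in> S" "below E g h" for g h
  proof -
    have "(\<lambda>f. f \<in> S \<and> below E g f) = (\<lambda>f. f \<in> S \<and> below E h f)"
      using that sym trans by (intro ext) blast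
    then show ?thesis unfolding rep_def by simp
  qed
  define G where "G = rep ` S"
  have GS: "g \<in> S" if "g \<in> G" for g using that rep unfolding G_def by auto
  have sep: "g = h" if gh: "g \<in> G" "h \<in> G" "below E g h" for g h
  proof -
    obtain g' h' where *: "g = rep g'" "g' \<in> S" "h = rep h'" "h' \<in> S" using gh(1,2) unfolding G_def by auto
    have "rep g' = rep g" "rep h' = rep h" using rep_eq rep * by auto
    then show ?thesis using rep_eq[OF GS GS gh(3)] gh * by simp
  qed
  have finG: "finite G"
  proof (rule ccontr)
    assume inf: "infinite G"
    have "\<forall>g\<in>G. geodesic_ray E g \<and> g 0 = b" using GS unfolding S_def by auto
    moreover have "\<forall>g\<in>G. \<forall>h\<in>G. g \<noteq> h \<longrightarrow> \<not> below E g h" using sep by auto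
    ultimately have "many_directions E"
      unfolding many_directions_def by (intro exI[of _ b] exI[of _ G] conjI inf)
    then show False using few by simp
  qed
  let ?M = "4 * \<delta> + C * \<delta>"
  have "\<exists>n0. \<forall>g\<in>G. \<forall>h\<in>G. g \<noteq> h \<longrightarrow> (\<forall>i\<ge>n0. \<forall>j\<ge>n0. \<not> reaches E ?M (g i) (h j))"
  proof -
    have "\<exists>n. \<forall>i\<ge>n. \<forall>j\<ge>n. \<not> reaches E ?M (g i) (h j)" if "g \<in> G" "h \<in> G" "g \<noteq> h" for g h
      using sep[OF that(1,2)] that(3) unfolding below_def by blast
    then obtain N where N: "\<And>g h i j. g \<in> G \<Longrightarrow> h \<in> G \<Longrightarrow> g \<noteq> h \<Longrightarrow> i \<ge> N g h \<Longrightarrow> j \<ge> N g h \<Longrightarrow>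
        \<not> reaches E ?M (g i) (h j)" by metis
    have "N g h \<le> (\<Sum>g\<in>G. \<Sum>h\<in>G. N g h)" if "g \<in> G" "h \<in> G" for g h
    proof -
      have "N g h \<le> (\<Sum>h\<in>G. N g h)" using member_le_sum[of h G "N g"] finG that by simp
      also have "\<dots> \<le> (\<Sum>g\<in>G. \<Sum>h\<in>G. N g h)" using member_le_sum[of g G "\<lambda>g. \<Sum>h\<in>G. N g h"] finG that by simp
      finally show ?thesis .
    qed
    then show ?thesis using N by (intro exI[of _ "\<Sum>g\<in>G. \<Sum>h\<in>G. N g h"]) (meson le_trans)
  qed
  then obtain n0 where n0: "\<And>g h i j. g \<in> G \<Longrightarrow> h \<in> G \<Longrightarrow> i \<ge> n0 \<Longrightarrow> j \<ge> n0 \<Longrightarrow>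
      reaches E ?M (g i) (h j) \<Longrightarrow> g = h" by blast
  define n where "n = n0 + 6 * \<delta> + C * \<delta> + 1"
  have "\<exists>h\<in>G. geodesic_ray E h \<and> h 0 = b \<and> below E h g" if "geodesic_ray E g" "g 0 = b" for g
  proof -
    have "g \<in> S" using that unfolding S_def by simp
    then show ?thesis using rep[of g] sym[of g "rep g"] unfolding G_def S_def by blast
  qed
  then obtain L0 where L0: "\<And>v. far E b L0 v \<Longrightarrow> \<exists>g\<in>G. tracks E \<delta> b n g v"
    using far_vertices_tracked[of b G n] by blast
  define L where "L = L0 + (n + C + 1)"
  have farL: "far E b L v \<Longrightarrow> far E b L0 v" "far E b L v \<Longrightarrow> far E b (n + C + 1) v" for v
    unfolding far_def L_def by auto
  have uniq: "g = h" if "g \<in> G" "h \<in> G" "tracks E \<delta> b n g v" "tracks E \<delta> b n h w" "far E b L v" "far E b L w"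
    "reaches E 1 v w \<or> reaches E 1 w v" for g h v w
  proof -
    have "\<exists>i\<ge>n0. \<exists>j\<ge>n0. reaches E ?M (g i) (h j)"
      using tracks_adjacent[of g b h n n0 v w] GS[OF that(1)] GS[OF that(2)] farL that(3-) n_def
      unfolding S_def by blast
    then show ?thesis using n0 that(1,2) by blast
  qed
  have stay: "tracks E \<delta> b n g w \<and> far E b L w"
    if "g \<in> G" "tracks E \<delta> b n g v" "far E b L v" "(v, w) \<in> (far_step E b L)\<^sup>*" for g v w
    using that(4)
  proof (induction rule: rtrancl_induct)
    case (step y z)
    then have z: "far E b L z" "reaches E 1 y z \<or> reaches E 1 z y"
      unfolding far_step_def using reaches_edge[of y z E] reaches_edge[of z y E] by auto
    obtain h where "h \<in> G" "tracks E \<delta> b n h z" using L0 farL(1)[OF z(1)] by blast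
    then show ?case using uniq[OF that(1) _ _ _ _ z] step.IH z(1) by blast
  qed (use that in auto)
  have rep_tracks: "tracks E \<delta> b n (rep g) (g i)" if g: "g \<in> S" "far E b L (g i)" for g i
  proof -
    have g': "geodesic_ray E g" "g 0 = b" using g(1) unfolding S_def by auto
    have i: "n \<le> i" using g(2) geodesic_rayD(2)[OF g'(1), of 0 i] g'(2) unfolding far_def L_def by simp
    obtain s where "reaches E \<delta> (rep g s) (g n)"
      using below_near(2)[OF g' _ _ rep(2)[OF g(1)]] rep(1)[OF g(1)] unfolding S_def by blast
    moreover have "segment E b (g i) (g ` {0..i})" using geodesic_ray_segment[OF g'(1)] g'(2) by simp
    moreover have "g n \<in> g ` {0..i}" "dst E b (g n) = n"
      using i geodesic_rayD(2)[OF g'(1), of 0 n] g'(2) by auto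
    ultimately show ?thesis unfolding tracks_def by blast
  qed
  obtain i j where ij: "far E b L (g1 i)" "(g1 i, g2 j) \<in> (far_step E b L)\<^sup>*" using conn by blast
  have gS: "g1 \<in> S" "g2 \<in> S" using g1 g2 unfolding S_def by auto
  have repG: "rep g1 \<in> G" "rep g2 \<in> G" using gS unfolding G_def by auto
  have "tracks E \<delta> b n (rep g1) (g2 j)" "far E b L (g2 j)"
    using stay[OF repG(1) rep_tracks[OF gS(1) ij(1)] ij] by auto
  then have "rep g1 = rep g2"
    using uniq[OF repG _ rep_tracks[OF gS(2)]] by (metis reaches_refl)
  then show ?thesis
    using rep[OF gS(1)] rep[OF gS(2)] sym trans gS by metis
qed

text \<open>Without any geodesic ray from \<open>b\<close>, the empty set of rays would track all far vertices.\<close>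
lemma geodesic_ray_exists:
  assumes "infinite {v. (b, v) \<in> E\<^sup>*}"
  shows "\<exists>g. geodesic_ray E g \<and> g 0 = b"
proof (rule ccontr)
  assume none: "\<nexists>g. geodesic_ray E g \<and> g 0 = b"
  obtain L where L: "\<And>v. \<not> far E b L v"
    using far_vertices_tracked[of b "{}" 0] none by auto
  then have "{v. (b, v) \<in> E\<^sup>*} \<subseteq> {v. reaches E L b v}"
    unfolding far_def reaches_iff by (auto simp: not_le intro: less_imp_le)
  then show False using assms finite_subset[OF _ finite_out_ball] by blast
qed

lemma many_directions_change_digraph:
  assumes "many_directions E"
    and YE: "\<And>x y. (x, y) \<in> Y \<Longrightarrow> reaches E k x y" and EY: "\<And>x y. (x, y) \<in> E \<Longrightarrow> reaches Y k x y"
  shows "\<exists>H. infinite H \<and> (\<forall>h\<in>H. geodesic_ray Y h) \<and> (\<forall>h\<in>H. \<forall>h'\<in>H. h \<noteq> h' \<longrightarrow> \<not> below E h h')"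
proof -
  obtain b G where G: "infinite G" "\<And>g. g \<in> G \<Longrightarrow> geodesic_ray E g"
    "\<And>g h. g \<in> G \<Longrightarrow> h \<in> G \<Longrightarrow> below E g h \<Longrightarrow> g = h"
    using assms(1) unfolding many_directions_def by blast
  have "\<forall>g\<in>G. \<exists>h. geodesic_ray Y h \<and> parallel E g h \<and> proper_seq h"
    using geodesic_ray_change_digraph[OF YE EY G(2)] coarse_ray_proper by blast
  then obtain f where f: "\<And>g. g \<in> G \<Longrightarrow> geodesic_ray Y (f g) \<and> parallel E g (f g) \<and> proper_seq (f g)"
    by metis
  have inj: "g = h" if "g \<in> G" "h \<in> G" "below E (f g) (f h)" for g h
  proof -
    have "below E g (f h)"
      using below_parallel_left[OF _ parallel_sym that(3)] f[OF that(1)] by blast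
    then have "below E g h"
      using below_parallel_right[OF _ parallel_sym] f[OF that(2)] by blast
    then show ?thesis using G(3) that by blast
  qed
  have refl: "below E h h" for h unfolding below_def by (meson order_refl reaches_refl)
  have "inj_on f G" using inj refl by (metis inj_onI)
  then have "infinite (f ` G)" using G(1) finite_image_iff by blast
  then show ?thesis using f inj by (intro exI[of _ "f ` G"]) auto
qed

end

section \<open>One-ended thin digraphs\<close>

definition avoiding :: "'a rel \<Rightarrow> 'a set \<Rightarrow> 'a rel" where
  "avoiding X F = {(x, y) \<in> X. x \<notin> F \<and> y \<notin> F}"

lemma avoiding_converse: "avoiding (X\<inverse>) F = (avoiding X F)\<inverse>"
  unfolding avoiding_def by auto

lemma geodesic_ray_inj:
  assumes "geodesic_ray E g"
  shows "inj g"
proof (rule injI)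
  fix i j assume "g i = g j"
  then have "dst E (g i) (g j) = 0" "dst E (g j) (g i) = 0" by simp_all
  then show "i = j"
    using geodesic_rayD(2)[OF assms, of i j] geodesic_rayD(2)[OF assms, of j i] by linarith
qed

lemma geodesic_ray_is_ray: "geodesic_ray E g \<Longrightarrow> ray E g"
  unfolding ray_def using geodesic_ray_inj geodesic_ray_edge by blast

lemma geodesic_ray_converse_is_anti_ray: "geodesic_ray (E\<inverse>) g \<Longrightarrow> anti_ray E g"
  unfolding anti_ray_def using geodesic_ray_inj geodesic_ray_edge by blast

lemma all_rays_converse [simp]: "all_rays (E\<inverse>) = all_rays E"
  unfolding all_rays_def ray_def anti_ray_def by auto

lemma below_tail:
  assumes "below E R (\<lambda>i. Q (n + i)) \<or> below E R (case_nat b (\<lambda>i. Q (n + i)))"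
  shows "below E R Q"
proof -
  have "\<exists>M. \<forall>m. \<exists>i\<ge>m. \<exists>j\<ge>m. reaches E M (R i) (Q j)"
    using assms
  proof
    assume "below E R (\<lambda>i. Q (n + i))"
    then show ?thesis unfolding below_def by (meson trans_le_add2)
  next
    assume "below E R (case_nat b (\<lambda>i. Q (n + i)))"
    then obtain M where M: "\<And>m. \<exists>i\<ge>m. \<exists>j\<ge>m. reaches E M (R i) (case_nat b (\<lambda>i. Q (n + i)) j)"
      unfolding below_def by blast
    have "\<exists>i\<ge>m. \<exists>j\<ge>m. reaches E M (R i) (Q j)" for m
    proof -
      obtain i j where ij: "i \<ge> Suc m" "j \<ge> Suc m" "reaches E M (R i) (case_nat b (\<lambda>i. Q (n + i)) j)"
        using M by blast
      then obtain j' where "j = Suc j'" by (cases j) auto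
      then show ?thesis using ij by (intro exI[of _ i] conjI exI[of _ "n + j'"]) auto
    qed
    then show ?thesis by blast
  qed
  then show ?thesis unfolding below_def .
qed

lemma below_tail_left:
  assumes "below E (\<lambda>i. Q (n + i)) R \<or> below E (case_nat b (\<lambda>i. Q (n + i))) R"
  shows "below E Q R"
  using below_tail[of "E\<inverse>" R Q n b] assms by simp

lemma coarse_rayD_reach:
  assumes "coarse_ray E R" "i \<le> j"
  shows "(R i, R j) \<in> E\<^sup>*"
proof -
  obtain k \<gamma> c where "\<And>N. quasi_geodesic_upto E k \<gamma> c R N" using assms(1) unfolding coarse_ray_def by blast
  then show ?thesis
    by (intro reaches_rtrancl[OF path_reaches[of j E k R i j]]) (use assms in \<open>auto simp: quasi_geodesic_upto_def\<close>)
qed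

context thin_digraph begin

text \<open>This moves the starting point of a ray to any vertex that reaches it, which gives two rays a
  common starting point. The distance to a point of \<open>R\<close> is at most \<open>C * d\<close> smaller from \<open>b\<close> than
  from \<open>R l\<close>, with \<open>d\<close> the distance from \<open>b\<close> to \<open>R l\<close>.\<close>
lemma coarse_ray_cons_tail:
  assumes "coarse_ray E R" "(b, R l) \<in> E\<^sup>*"
  shows "coarse_ray E (case_nat b (\<lambda>i. R (l + i)))"
proof -
  obtain k \<gamma> c where q: "\<And>N. quasi_geodesic_upto E k \<gamma> c R N"
    using assms(1) unfolding coarse_ray_def by blast
  define d where "d = dst E b (R l)"
  let ?R = "case_nat b (\<lambda>i. R (l + i))"
  have step: "reaches E k (R i) (R (Suc i))" for i
    using q[of "Suc i"] unfolding quasi_geodesic_upto_def by simp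
  have qg: "j - i \<le> \<gamma> * m + c" if "i \<le> j" "reaches E m (R i) (R j)" for i j m
    using q[of j] that unfolding quasi_geodesic_upto_def by simp
  have "quasi_geodesic_upto E (k + d) \<gamma> (\<gamma> * (C * d) + c + 1) ?R N" for N
    unfolding quasi_geodesic_upto_def
  proof (intro conjI allI impI)
    fix i
    have "reaches E d b (R l)" unfolding d_def by (rule reaches_dst[OF assms(2)])
    then show "reaches E (k + d) (?R i) (?R (Suc i))"
      using step[of "l + (i - 1)"] by (cases i) (auto elim: reaches_mono)
  next
    fix i j m assume ij: "i \<le> j" and m: "reaches E m (?R i) (?R j)"
    show "j - i \<le> \<gamma> * m + (\<gamma> * (C * d) + c + 1)"
    proof (cases i)
      case (Suc i')
      then obtain j' where "j = Suc j'" using ij by (cases j) auto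
      then show ?thesis using qg[of "l + i'" "l + j'" m] ij m Suc by simp
    next
      case 0
      show ?thesis
      proof (cases j)
        case (Suc j')
        have Rl: "(R l, R (l + j')) \<in> E\<^sup>*" using coarse_rayD_reach[OF assms(1)] by simp
        have "dst E (R l) (R (l + j')) \<le> dst E b (R (l + j')) + C * d"
          using dst_reaches_le_target[OF Rl reaches_dst[OF assms(2)]] unfolding d_def .
        also have "dst E b (R (l + j')) \<le> m" using m Suc 0 dst_le by simp
        finally have "reaches E (m + C * d) (R l) (R (l + j'))" using Rl unfolding reaches_iff by simp
        then have "j' \<le> \<gamma> * (m + C * d) + c" using qg[of l "l + j'"] by fastforce
        then show ?thesis using Suc 0 by (simp add: algebra_simps)
      qed simp
    qed
  qed
  then show ?thesis unfolding coarse_ray_def by blast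
qed

text \<open>Distances inside a strong component are symmetric up to a linear factor.\<close>
lemma coarse_ray_of_strong_anti_ray:
  assumes "coarse_ray (E\<inverse>) R" "\<And>i j. i \<ge> n \<Longrightarrow> (R i, R j) \<in> E\<^sup>*"
  shows "coarse_ray E (\<lambda>i. R (n + i))"
proof -
  obtain k \<gamma> c where q: "\<And>N. quasi_geodesic_upto (E\<inverse>) k \<gamma> c R N"
    using assms(1) unfolding coarse_ray_def by blast
  have step: "reaches E k (R (Suc i)) (R i)" for i
    using q[of "Suc i"] unfolding quasi_geodesic_upto_def by simp
  have qg: "j - i \<le> \<gamma> * m + c" if "i \<le> j" "reaches E m (R j) (R i)" for i j m
    using q[of j] that unfolding quasi_geodesic_upto_def by simp
  let ?b = "2 * Suc K ^ \<delta>"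
  have "quasi_geodesic_upto E (cone_bound \<delta> K k) (\<gamma> * ?b) (\<gamma> * ?b + c) (\<lambda>i. R (n + i)) N" for N
    unfolding quasi_geodesic_upto_def
  proof (intro conjI allI impI)
    fix i show "reaches E (cone_bound \<delta> K k) (R (n + i)) (R (n + Suc i))"
      using reaches_back[OF step] assms(2) by simp
  next
    fix i j m assume "i \<le> j" "reaches E m (R (n + i)) (R (n + j))"
    then show "j - i \<le> \<gamma> * ?b * m + (\<gamma> * ?b + c)"
      using qg[of "n + i" "n + j", OF _ reaches_back[OF _ assms(2)], of m]
      by (simp add: cone_bound_def algebra_simps)
  qed
  then show ?thesis unfolding coarse_ray_def by blast
qed

end

text \<open>Hyperbolicity is known for \<open>E\<close>, one-endedness for \<open>X\<close>; the two are quasi-isometric by the identity.\<close>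
locale one_ended_thin_digraph = thin_digraph E \<delta> K for E :: "'a rel" and \<delta> K +
  fixes X :: "'a rel" and k :: nat
  assumes XE: "(x, y) \<in> X \<Longrightarrow> reaches E k x y" and EX: "(x, y) \<in> E \<Longrightarrow> reaches X k x y"
    and one_ended: "R1 \<in> all_rays X \<Longrightarrow> R2 \<in> all_rays X \<Longrightarrow> finite F \<Longrightarrow>
      \<exists>i j. R1 i \<notin> F \<and> R2 j \<notin> F \<and> (R1 i, R2 j) \<in> (avoiding X F)\<^sup>*"
begin

lemma one_ended_converse: "one_ended_thin_digraph (E\<inverse>) \<delta> K (X\<inverse>) k"
proof -
  interpret dual: thin_digraph "E\<inverse>" \<delta> K by (rule thin_converse)
  show ?thesis
  proof
    fix R1 R2 F assume "R1 \<in> all_rays (X\<inverse>)" "R2 \<in> all_rays (X\<inverse>)" "finite (F :: 'a set)"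
    then obtain i j where "R2 i \<notin> F" "R1 j \<notin> F" "(R2 i, R1 j) \<in> (avoiding X F)\<^sup>*"
      using one_ended[of R2 R1 F] by auto
    then show "\<exists>i j. R1 i \<notin> F \<and> R2 j \<notin> F \<and> (R1 i, R2 j) \<in> (avoiding (X\<inverse>) F)\<^sup>*"
      unfolding avoiding_converse rtrancl_converse by blast
  qed (use XE EX in auto)
qed

lemma X_reach: "(x, y) \<in> X\<^sup>* \<Longrightarrow> (x, y) \<in> E\<^sup>*"
  using rtrancl_step_mono[OF XE] .

lemma avoiding_reach: "(x, y) \<in> (avoiding X F)\<^sup>* \<Longrightarrow> (x, y) \<in> E\<^sup>*"
  using X_reach rtrancl_mono[of "avoiding X F" X] unfolding avoiding_def by blast

text \<open>One ray \<open>g\<close> for the geometry of \<open>E\<close> and one ray \<open>h\<close> to which one-endedness of \<open>X\<close> applies.\<close>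
lemma parallel_geodesic_rays:
  assumes "coarse_ray E R"
  shows "\<exists>g h. geodesic_ray E g \<and> g 0 = R 0 \<and> parallel E R g \<and>
    geodesic_ray X h \<and> h 0 = R 0 \<and> parallel E g h \<and> h \<in> all_rays X"
proof -
  obtain g where g: "geodesic_ray E g" "g 0 = R 0" "parallel E R g"
    using coarse_ray_parallel_geodesic[OF assms] by blast
  obtain h where h: "geodesic_ray X h" "h 0 = g 0" "parallel E g h"
    using geodesic_ray_change_digraph[OF XE EX g(1)] by blast
  show ?thesis
    using g h geodesic_ray_is_ray[OF h(1)] unfolding all_rays_def by (intro exI[of _ g] exI[of _ h]) simp
qed

text \<open>Go from \<open>g1\<close> to \<open>h1\<close>, along a path of \<open>X\<close> to \<open>h2\<close>, and on to \<open>g2\<close>. The path avoids a ball around \<open>b\<close>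
  that is large enough for all connecting pieces to stay far from \<open>b\<close>.\<close>
lemma far_connected:
  assumes g1: "(b, h1 0) \<in> E\<^sup>*" "geodesic_ray X h1" "geodesic_ray E g1" "g1 0 = b" "parallel E g1 h1"
    and g2: "h2 \<in> all_rays X" "parallel E g2 h2"
  shows "\<exists>i j. far E b L (g1 i) \<and> (g1 i, g2 j) \<in> (far_step E b L)\<^sup>*"
proof -
  obtain M1 where M1: "\<And>i. \<exists>j. reaches E M1 (g1 j) (h1 i)" using g1(5) unfolding parallel_def by blast
  obtain M2 where M2: "\<And>i. \<exists>j. reaches E M2 (h2 i) (g2 j)" using g2(2) unfolding parallel_def by blast
  define L' where "L' = L + C * k + C * M1 + M1 + C * M2"
  define F where "F = {v. reaches E L' b v}"
  have "finite F" unfolding F_def by (rule finite_out_ball)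
  moreover have "h1 \<in> all_rays X" using geodesic_ray_is_ray[OF g1(2)] unfolding all_rays_def by simp
  ultimately obtain i j where ij: "h1 i \<notin> F" "(h1 i, h2 j) \<in> (avoiding X F)\<^sup>*"
    using one_ended[of h1 h2 F] g2(1) by blast
  have bh: "(b, h1 i) \<in> E\<^sup>*"
    using g1(1) X_reach[OF geodesic_rayD(3)[OF g1(2), of 0 i]] by simp
  have notF: "L' < dst E b v" if "v \<notin> F" "(b, v) \<in> E\<^sup>*" for v
    using that unfolding F_def reaches_iff by simp
  have path: "(h1 i, v) \<in> (far_step E b L)\<^sup>* \<and> (b, v) \<in> E\<^sup>* \<and> v \<notin> F" if "(h1 i, v) \<in> (avoiding X F)\<^sup>*" for v
    using that
  proof (induction rule: rtrancl_induct)
    case (step y z)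
    have yz: "reaches E k y z" "y \<notin> F" "z \<notin> F" using step(2) XE unfolding avoiding_def by auto
    have "(y, z) \<in> (far_step E b L)\<^sup>*"
      by (rule far_path[OF _ yz(1)]) (use step.IH notF[OF yz(2)] in \<open>auto simp: L'_def\<close>)
    then show ?case using step.IH yz(3) reaches_rtrancl[OF yz(1)] by auto
  qed (use ij bh in auto)
  obtain s where s: "reaches E M1 (g1 s) (h1 i)" using M1 by blast
  have bs: "(b, g1 s) \<in> E\<^sup>*" using geodesic_rayD(3)[OF g1(3), of 0 s] g1(4) by simp
  have "dst E b (h1 i) \<le> dst E b (g1 s) + M1" by (rule dst_reaches_right[OF bs s])
  then have "L + C * M1 \<le> dst E b (g1 s)" using notF[OF ij(1) bh] unfolding L'_def by simp
  then have "(g1 s, h1 i) \<in> (far_step E b L)\<^sup>*" "far E b L (g1 s)"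
    using far_path[OF bs s] bs unfolding far_def by auto
  moreover obtain t where t: "reaches E M2 (h2 j) (g2 t)" using M2 by blast
  have "(h2 j, g2 t) \<in> (far_step E b L)\<^sup>*"
    by (rule far_path[OF _ t]) (use path[OF ij(2)] notF[of "h2 j"] in \<open>auto simp: L'_def\<close>)
  ultimately show ?thesis using path[OF ij(2)] by (meson rtrancl_trans)
qed

text \<open>A path from the first ray to the second lets both be regarded as rays from one vertex, up to
  parallelism and a change of an initial piece.\<close>
lemma coarse_rays_below:
  assumes R1: "coarse_ray E R1" and R2: "coarse_ray E R2" and few: "\<not> many_directions E"
  shows "below E R1 R2 \<and> below E R2 R1"
proof -
  obtain g1 h1 where g1: "geodesic_ray E g1" "g1 0 = R1 0" "parallel E R1 g1"
    "geodesic_ray X h1" "h1 0 = R1 0" "parallel E g1 h1" "h1 \<in> all_rays X"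
    using parallel_geodesic_rays[OF R1] by blast
  obtain g h where g: "parallel E R2 g" "parallel E g h" "h \<in> all_rays X"
    using parallel_geodesic_rays[OF R2] by blast
  let ?b = "R1 0"
  obtain i j where ij: "(h1 i, h j) \<in> (avoiding X {})\<^sup>*"
    using one_ended[OF g1(7) g(3), of "{}"] by blast
  obtain M l where "reaches E M (h j) (R2 l)"
    using parallel_trans[OF g(1,2)] unfolding parallel_def by blast
  then have l: "(h j, R2 l) \<in> E\<^sup>*" by (rule reaches_rtrancl)
  have "(?b, h1 i) \<in> E\<^sup>*"
    using X_reach[OF geodesic_rayD(3)[OF g1(4), of 0 i]] g1(5) by simp
  then have bl: "(?b, R2 l) \<in> E\<^sup>*" using avoiding_reach[OF ij] l by simp
  define Q where "Q = case_nat ?b (\<lambda>i. R2 (l + i))"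
  have Q: "coarse_ray E Q" unfolding Q_def by (rule coarse_ray_cons_tail[OF R2 bl])
  have Q0: "Q 0 = ?b" unfolding Q_def by simp
  obtain g2 h2 where g2: "geodesic_ray E g2" "g2 0 = ?b" "parallel E Q g2" "parallel E g2 h2" "h2 \<in> all_rays X"
    using parallel_geodesic_rays[OF Q] Q0 by auto
  have bh: "(?b, h1 0) \<in> E\<^sup>*" using g1(5) by simp
  have b12: "below E g1 g2"
    by (rule far_connected_below[OF g1(1,2) g2(1,2) far_connected[OF bh g1(4,1,2,6) g2(5,4)] few])
  have b21: "below E g2 g1" by (rule below_geodesic_sym[OF g1(1,2) g2(1,2) b12])
  note pr = geodesic_ray_proper[OF g1(1)] geodesic_ray_proper[OF g2(1)]
  note ps = parallel_sym[OF g1(3)] parallel_sym[OF g2(3)]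
  have bQ: "below E R1 Q" "below E Q R1"
    using below_parallel_left[OF pr(1) ps(1) below_parallel_right[OF pr(2) ps(2) b12]]
      below_parallel_right[OF pr(1) ps(1) below_parallel_left[OF pr(2) ps(2) b21]] by auto
  show ?thesis
    by (rule conjI[OF below_tail[OF disjI2[OF bQ(1)[unfolded Q_def]]]
          below_tail_left[OF disjI2[OF bQ(2)[unfolded Q_def]]]])
qed

text \<open>Going back and forth between a ray and an anti-ray closes directed cycles, so the anti-ray
  eventually stays in one strong component.\<close>
lemma coarse_ray_anti_ray_below:
  assumes R1: "coarse_ray E R1" and R2: "coarse_ray (E\<inverse>) R2" and few: "\<not> many_directions E"
  shows "below E R1 R2 \<and> below E R2 R1"
proof -
  interpret dual: one_ended_thin_digraph "E\<inverse>" \<delta> K "X\<inverse>" k by (rule one_ended_converse)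
  obtain g1 h1 where g1: "geodesic_ray X h1" "h1 \<in> all_rays X"
    using parallel_geodesic_rays[OF R1] by blast
  obtain g2 h2 where g2: "parallel E R2 g2" "geodesic_ray (X\<inverse>) h2" "parallel E g2 h2" "h2 \<in> all_rays X"
    using dual.parallel_geodesic_rays[OF R2] by auto
  have up: "(h1 i, h1 j) \<in> E\<^sup>*" if "i \<le> j" for i j
    using X_reach[OF geodesic_rayD(3)[OF g1(1) that]] .
  have down: "(h2 j, h2 i) \<in> E\<^sup>*" if "i \<le> j" for i j
    using X_reach geodesic_rayD(3)[OF g2(2) that] unfolding rtrancl_converse by blast
  have h12: "(h1 i, h2 j) \<in> E\<^sup>*" for i j
  proof -
    obtain i' j' where *: "h1 i' \<notin> h1 ` {..<i} \<union> h2 ` {..<j}" "h2 j' \<notin> h1 ` {..<i} \<union> h2 ` {..<j}"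
      "(h1 i', h2 j') \<in> (avoiding X (h1 ` {..<i} \<union> h2 ` {..<j}))\<^sup>*"
      using one_ended[OF g1(2) g2(4), of "h1 ` {..<i} \<union> h2 ` {..<j}"] by blast
    have "i \<le> i'" "j \<le> j'" using *(1,2) by (force simp: not_less[symmetric])+
    then show ?thesis using up[of i i'] avoiding_reach[OF *(3)] down[of j j'] by (meson rtrancl_trans)
  qed
  obtain i0 j0 where 0: "(h2 j0, h1 i0) \<in> E\<^sup>*"
    using one_ended[OF g2(4) g1(2), of "{}"] by (auto dest: avoiding_reach)
  have strong: "(h2 j, h2 j') \<in> E\<^sup>*" if "j \<ge> j0" for j j'
    using down[OF that] 0 h12[of i0 j'] by (meson rtrancl_trans)
  obtain M where M: "\<And>i. \<exists>t. reaches E M (R2 i) (h2 t)" "\<And>i. \<exists>t. reaches E M (h2 t) (R2 i)"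
    using parallel_trans[OF g2(1,3)] unfolding parallel_def by blast
  have "finite (\<Union>t<j0. {v. reaches E M v (h2 t)})" using finite_in_ball by auto
  then obtain n where n: "\<And>i. i \<ge> n \<Longrightarrow> R2 i \<notin> (\<Union>t<j0. {v. reaches E M v (h2 t)})"
    using proper_seq_avoids[OF coarse_ray_proper[OF R2]] by blast
  have "(R2 i, R2 j) \<in> E\<^sup>*" if "i \<ge> n" for i j
  proof -
    obtain t where t: "reaches E M (R2 i) (h2 t)" using M(1) by blast
    obtain t' where t': "reaches E M (h2 t') (R2 j)" using M(2) by blast
    have "t \<ge> j0" using n[OF that] t by (force simp: not_less[symmetric])
    then show ?thesis
      using reaches_rtrancl[OF t] strong[of t t'] reaches_rtrancl[OF t'] by (meson rtrancl_trans)
  qed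
  then have "coarse_ray E (\<lambda>i. R2 (n + i))" by (rule coarse_ray_of_strong_anti_ray[OF R2])
  note both = coarse_rays_below[OF R1 this few]
  show ?thesis
    by (rule conjI[OF below_tail[OF disjI1[OF conjunct1[OF both]]] below_tail_left[OF disjI1[OF conjunct2[OF both]]]])
qed

text \<open>The case of two anti-rays is that of two rays in the reversed digraph.\<close>
theorem boundary_collapses:
  assumes "coarse_ray E R1 \<or> coarse_ray (E\<inverse>) R1" "coarse_ray E R2 \<or> coarse_ray (E\<inverse>) R2"
    and "\<not> many_directions E" "\<not> many_directions (E\<inverse>)"
  shows "below E R1 R2"
  using assms coarse_rays_below coarse_ray_anti_ray_below
    one_ended_thin_digraph.coarse_rays_below[OF one_ended_converse, of R1 R2] by auto

end

section \<open>Vertex lists, ends and boundary\<close>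

lemma dipath_iff_nth: "dipath E p \<longleftrightarrow> p \<noteq> [] \<and> (\<forall>i. Suc i < length p \<longrightarrow> (p ! i, p ! Suc i) \<in> E)"
  unfolding dipath_def by (auto simp: successively_conv_nth)

lemma dipath_relpow:
  assumes "dipath E p" "i \<le> j" "j < length p"
  shows "(p ! i, p ! j) \<in> E ^^ (j - i)"
  using path_relpow[of "length p - 1" "\<lambda>i. p ! i" E i j] assms unfolding dipath_iff_nth by auto

lemma dipath_betw_relpow:
  assumes "dipath_betw E x p y"
  shows "(x, y) \<in> E ^^ plen p"
  using dipath_relpow[of E p 0 "length p - 1"] assms
  unfolding dipath_betw_def plen_def dipath_def by (auto simp: hd_conv_nth last_conv_nth)

lemma dipath_of_function:
  assumes "\<forall>i<n. (f i, f (Suc i)) \<in> E"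
  shows "dipath_betw E (f 0) (map f [0..<Suc n]) (f n)" "plen (map f [0..<Suc n]) = n"
    "set (map f [0..<Suc n]) = f ` {..n}"
proof -
  show "dipath_betw E (f 0) (map f [0..<Suc n]) (f n)"
    unfolding dipath_betw_def dipath_iff_nth using assms
    by (auto simp: nth_append hd_append hd_map less_Suc_eq_le nth_map simp del: upt_Suc simp: hd_conv_nth last_conv_nth)
  show "plen (map f [0..<Suc n]) = n" unfolding plen_def by simp
  have "{0..<Suc n} = {..n}" by auto
  then show "set (map f [0..<Suc n]) = f ` {..n}" by (simp del: upt_Suc)
qed

lemma ddist_eq_dst: "(x, y) \<in> E\<^sup>* \<Longrightarrow> ddist E x y = enat (dst E x y)"
proof -
  assume "(x, y) \<in> E\<^sup>*"
  then obtain f where f: "f 0 = x" "f (dst E x y) = y" "\<forall>i<dst E x y. (f i, f (Suc i)) \<in> E"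
    using dst_relpow unfolding relpow_fun_conv by metis
  show ?thesis
    unfolding ddist_def
  proof (rule antisym)
    show "(INF p\<in>{p. dipath_betw E x p y}. enat (plen p)) \<le> enat (dst E x y)"
      by (rule INF_lower2[of "map f [0..<Suc (dst E x y)]"]) (use dipath_of_function[OF f(3)] f in auto)
    show "enat (dst E x y) \<le> (INF p\<in>{p. dipath_betw E x p y}. enat (plen p))"
      by (rule INF_greatest) (auto dest: dipath_betw_relpow dst_le_relpow)
  qed
qed

lemma ddist_infinite: "(x, y) \<notin> E\<^sup>* \<Longrightarrow> ddist E x y = \<infinity>"
proof -
  assume "(x, y) \<notin> E\<^sup>*"
  then have "{p. dipath_betw E x p y} = {}"
    by (auto dest!: dipath_betw_relpow relpow_imp_rtrancl)
  then show ?thesis unfolding ddist_def by (simp add: top_enat_def)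
qed

lemma reaches_of_ddist:
  assumes "ereal_of_enat (ddist E x y) \<le> ereal r"
  shows "reaches E (nat \<lceil>r\<rceil>) x y"
proof -
  have r: "(x, y) \<in> E\<^sup>*"
    using assms ddist_infinite[of x y E] by (cases "(x, y) \<in> E\<^sup>*") auto
  then have "real (dst E x y) \<le> r" using assms ddist_eq_dst[OF r] by simp
  then have "dst E x y \<le> nat \<lceil>r\<rceil>" by linarith
  then show ?thesis unfolding reaches_iff using r by simp
qed

lemma ddist_of_reaches: "reaches E n x y \<Longrightarrow> real n \<le> r \<Longrightarrow> ereal_of_enat (ddist E x y) \<le> ereal r"
  unfolding reaches_iff using ddist_eq_dst[of x y E] by auto

lemma geodesic_of_segment:
  assumes "segment E x y X"
  shows "\<exists>p. geodesic E p \<and> hd p = x \<and> last p = y \<and> set p = X"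
proof -
  obtain f n where f: "geodesic_upto E f n" "f 0 = x" "f n = y" "X = f ` {..n}"
    using assms unfolding segment_def by auto
  have e: "\<forall>i<n. (f i, f (Suc i)) \<in> E" using f(1) unfolding geodesic_upto_def by blast
  note p = dipath_of_function[OF e]
  have "ddist E x y = enat n"
    using ddist_eq_dst[OF segment_reach[OF assms]] f unfolding geodesic_upto_def by simp
  then have "geodesic E (map f [0..<Suc n])"
    using p(1,2) f unfolding geodesic_def dipath_betw_def by simp
  then show ?thesis using p(1,3) f(2-4) unfolding dipath_betw_def by metis
qed

lemma hyperbolic_digraph_thin:
  assumes "hyperbolic_digraph E"
  shows "\<exists>\<delta>. \<forall>x y z X Y Z v. segment E x y X \<longrightarrow> segment E x z Y \<or> segment E z x Y \<longrightarrow>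
    segment E y z Z \<or> segment E z y Z \<longrightarrow> v \<in> X \<longrightarrow>
    (\<exists>q\<in>Y. reaches E \<delta> q v) \<or> (\<exists>q\<in>Z. reaches E \<delta> v q)"
proof -
  obtain r where r: "\<And>x y z s t u. geodesic_triangle E x y z s t u \<Longrightarrow> thin_triangle E r s t u"
    using assms unfolding hyperbolic_digraph_def by blast
  show ?thesis
  proof (rule exI[of _ "nat \<lceil>r\<rceil>"], intro allI impI)
    fix x y z X Y Z v
    assume X: "segment E x y X" and Y: "segment E x z Y \<or> segment E z x Y"
      and Z: "segment E y z Z \<or> segment E z y Z" and v: "v \<in> X"
    obtain P where P: "geodesic E P" "hd P = x" "last P = y" "set P = X"
      using geodesic_of_segment[OF X] by blast
    obtain Q where Q: "geodesic E Q" "hd Q = x \<and> last Q = z \<or> hd Q = z \<and> last Q = x" "set Q = Y"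
      using Y geodesic_of_segment[of E x z Y] geodesic_of_segment[of E z x Y] by metis
    obtain R where R: "geodesic E R" "hd R = y \<and> last R = z \<or> hd R = z \<and> last R = y" "set R = Z"
      using Z geodesic_of_segment[of E y z Z] geodesic_of_segment[of E z y Z] by metis
    have "geodesic_triangle E x y z P R Q"
      unfolding geodesic_triangle_def geodesic_side_def using P Q R by auto
    then have "thin_triangle E r P R Q" by (rule r)
    moreover have "{#P, Q, R#} = {#P, R, Q#}" by (simp add: add_mset_commute)
    ultimately have "hd P \<in> {hd Q, last Q} \<longrightarrow> last P \<in> {hd R, last R} \<longrightarrow>
        set P \<subseteq> out_ball_set E r (set Q) \<union> in_ball_set E r (set R)"
      unfolding thin_triangle_def by simp
    then have "set P \<subseteq> out_ball_set E r (set Q) \<union> in_ball_set E r (set R)"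
      using P(2,3) Q(2) R(2) by auto
    then have "v \<in> out_ball_set E r Y \<union> in_ball_set E r Z" using P Q R v by auto
    then show "(\<exists>q\<in>Y. reaches E (nat \<lceil>r\<rceil>) q v) \<or> (\<exists>q\<in>Z. reaches E (nat \<lceil>r\<rceil>) v q)"
      unfolding out_ball_set_def in_ball_set_def out_ball_def in_ball_def
      by (auto dest!: reaches_of_ddist)
  qed
qed

lemma quasi_geodesic_index_bound:
  assumes "ereal (real (j - i)) \<le> ereal \<gamma> * ereal_of_enat (ddist E x y) + ereal c"
    and "reaches E m x y" "0 \<le> \<gamma>" "0 \<le> c"
  shows "j - i \<le> nat \<lceil>\<gamma>\<rceil> * m + nat \<lceil>c\<rceil>"
proof -
  have d: "dst E x y \<le> m" "ddist E x y = enat (dst E x y)"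
    using assms(2) ddist_eq_dst unfolding reaches_iff by auto
  then have "real (j - i) \<le> \<gamma> * real (dst E x y) + c" using assms(1) by simp
  also have "\<dots> \<le> real (nat \<lceil>\<gamma>\<rceil>) * real m + real (nat \<lceil>c\<rceil>)"
    using assms(3,4) d(1) by (intro add_mono mult_mono) auto
  finally have "real (j - i) \<le> real (nat \<lceil>\<gamma>\<rceil> * m + nat \<lceil>c\<rceil>)" by simp
  then show ?thesis by linarith
qed

lemma quasi_geodesic_ray_coarse:
  assumes "quasi_geodesic_ray E R"
  shows "coarse_ray E R"
proof -
  obtain \<gamma> c where q: "ray E R" "\<gamma> \<ge> 1" "c \<ge> 0" "\<And>i j. i \<le> j \<Longrightarrow> quasi_geodesic E \<gamma> c (map R [i..<Suc j])"
    using assms unfolding quasi_geodesic_ray_def by blast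
  have "quasi_geodesic_upto E 1 (nat \<lceil>\<gamma>\<rceil>) (nat \<lceil>c\<rceil>) R N" for N
    unfolding quasi_geodesic_upto_def
  proof (intro conjI allI impI)
    fix i show "reaches E 1 (R i) (R (Suc i))" using q(1) reaches_edge unfolding ray_def by fastforce
  next
    fix i j m assume ij: "i \<le> j" "reaches E m (R i) (R j)"
    have "ereal (real (j - i - 0)) \<le> ereal \<gamma> * ereal_of_enat (ddist E (map R [i..<Suc j] ! 0) (map R [i..<Suc j] ! (j - i))) + ereal c"
      by (rule q(4)[OF ij(1), unfolded quasi_geodesic_def, THEN conjunct2, rule_format])
        (use ij(1) in \<open>simp_all del: upt_Suc\<close>)
    then have "ereal (real (j - i)) \<le> ereal \<gamma> * ereal_of_enat (ddist E (R i) (R j)) + ereal c"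
      using ij(1) by (simp del: upt_Suc)
    then show "j - i \<le> nat \<lceil>\<gamma>\<rceil> * m + nat \<lceil>c\<rceil>"
      using quasi_geodesic_index_bound[OF _ ij(2)] q(2,3) by simp
  qed
  then show ?thesis unfolding coarse_ray_def by blast
qed

lemma quasi_geodesic_anti_ray_coarse:
  assumes "quasi_geodesic_anti_ray E R"
  shows "coarse_ray (E\<inverse>) R"
proof -
  obtain \<gamma> c where q: "anti_ray E R" "\<gamma> \<ge> 1" "c \<ge> 0"
    "\<And>i j. i \<le> j \<Longrightarrow> quasi_geodesic E \<gamma> c (rev (map R [i..<Suc j]))"
    using assms unfolding quasi_geodesic_anti_ray_def by blast
  have "quasi_geodesic_upto (E\<inverse>) 1 (nat \<lceil>\<gamma>\<rceil>) (nat \<lceil>c\<rceil>) R N" for N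
    unfolding quasi_geodesic_upto_def
  proof (intro conjI allI impI)
    fix i show "reaches (E\<inverse>) 1 (R i) (R (Suc i))"
      using q(1) reaches_edge unfolding anti_ray_def by fastforce
  next
    fix i j m assume ij: "i \<le> j" "reaches (E\<inverse>) m (R i) (R j)"
    let ?l = "rev (map R [i..<Suc j])"
    have "ereal (real (j - i - 0)) \<le> ereal \<gamma> * ereal_of_enat (ddist E (?l ! 0) (?l ! (j - i))) + ereal c"
      by (rule q(4)[OF ij(1), unfolded quasi_geodesic_def, THEN conjunct2, rule_format])
        (use ij(1) in \<open>simp_all del: upt_Suc\<close>)
    moreover have "?l ! 0 = R j" "?l ! (j - i) = R i"
      using ij(1) by (auto simp: rev_nth simp del: upt_Suc)
    ultimately have "ereal (real (j - i)) \<le> ereal \<gamma> * ereal_of_enat (ddist E (R j) (R i)) + ereal c"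
      by simp
    then show "j - i \<le> nat \<lceil>\<gamma>\<rceil> * m + nat \<lceil>c\<rceil>"
      using quasi_geodesic_index_bound[of j i \<gamma> E "R j" "R i" c m] ij(2) q(2,3) by simp
  qed
  then show ?thesis unfolding coarse_ray_def by blast
qed

lemma geodesic_ray_quasi_geodesic:
  assumes "geodesic_ray E g"
  shows "quasi_geodesic_ray E g"
proof -
  have "quasi_geodesic E 1 0 (map g [i..<Suc j])" if "i \<le> j" for i j
    unfolding quasi_geodesic_def
  proof (intro conjI allI impI)
    show "dipath E (map g [i..<Suc j])"
      unfolding dipath_iff_nth using geodesic_ray_edge[OF assms] that by (auto simp del: upt_Suc)
    fix a b assume ab: "a \<le> b" "b < length (map g [i..<Suc j])"
    then have "map g [i..<Suc j] ! a = g (i + a)" "map g [i..<Suc j] ! b = g (i + b)"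
      by (auto simp del: upt_Suc)
    moreover have "ddist E (g (i + a)) (g (i + b)) = enat (b - a)"
      using ddist_eq_dst[OF geodesic_rayD(3)[OF assms, of "i + a" "i + b"]]
        geodesic_rayD(2)[OF assms, of "i + a" "i + b"] ab(1) by simp
    ultimately show "ereal (real (b - a)) \<le>
        ereal 1 * ereal_of_enat (ddist E (map g [i..<Suc j] ! a) (map g [i..<Suc j] ! b)) + ereal 0"
      by simp
  qed
  then show ?thesis
    unfolding quasi_geodesic_ray_def using geodesic_ray_is_ray[OF assms]
    by (intro conjI exI[of _ 1] exI[of _ 0]) auto
qed

lemma geodesic_ray_quasi_geodesic_anti:
  assumes "geodesic_ray (E\<inverse>) g"
  shows "quasi_geodesic_anti_ray E g"
proof -
  have "quasi_geodesic E 1 0 (rev (map g [i..<Suc j]))" if "i \<le> j" for i j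
    unfolding quasi_geodesic_def
  proof (intro conjI allI impI)
    have nth: "rev (map g [i..<Suc j]) ! a = g (j - a)" if "a \<le> j - i" for a
      using that \<open>i \<le> j\<close> by (simp add: rev_nth del: upt_Suc)
    show "dipath E (rev (map g [i..<Suc j]))"
      unfolding dipath_iff_nth
    proof (intro conjI allI impI)
      fix a assume "Suc a < length (rev (map g [i..<Suc j]))"
      then have a: "Suc a \<le> j - i" using that by (simp del: upt_Suc)
      then have "(g (j - Suc a), g (Suc (j - Suc a))) \<in> E\<inverse>" "Suc (j - Suc a) = j - a"
        using geodesic_ray_edge[OF assms] by auto
      then show "(rev (map g [i..<Suc j]) ! a, rev (map g [i..<Suc j]) ! Suc a) \<in> E"
        using nth[of a] nth[of "Suc a"] a by simp
    qed (use that in simp)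
    fix a b assume ab: "a \<le> b" "b < length (rev (map g [i..<Suc j]))"
    then have b: "b \<le> j - i" using that by (simp del: upt_Suc)
    have "(g (j - a), g (j - b)) \<in> E\<^sup>*" "dst E (g (j - a)) (g (j - b)) = b - a"
      using geodesic_rayD(2,3)[OF assms, of "j - b" "j - a"] ab(1) b that
      by (auto simp: rtrancl_converse)
    then have "ddist E (g (j - a)) (g (j - b)) = enat (b - a)"
      using ddist_eq_dst by metis
    then show "ereal (real (b - a)) \<le>
        ereal 1 * ereal_of_enat (ddist E (rev (map g [i..<Suc j]) ! a) (rev (map g [i..<Suc j]) ! b)) + ereal 0"
      using nth[of a] nth[of b] b ab(1) by simp
  qed
  then show ?thesis
    unfolding quasi_geodesic_anti_ray_def using geodesic_ray_converse_is_anti_ray[OF assms]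
    by (intro conjI exI[of _ 1] exI[of _ 0]) auto
qed

lemma coarse_ray_change_digraph:
  assumes "coarse_ray X R"
    and "\<And>x y. (x, y) \<in> X \<Longrightarrow> reaches E k x y" "\<And>x y. (x, y) \<in> E \<Longrightarrow> reaches X k x y"
  shows "coarse_ray E R"
proof -
  obtain k' \<gamma> c where q: "\<And>N. quasi_geodesic_upto X k' \<gamma> c R N"
    using assms(1) unfolding coarse_ray_def by blast
  have "quasi_geodesic_upto E (k * k') (\<gamma> * k) c R N" for N
    unfolding quasi_geodesic_upto_def
  proof (intro conjI allI impI)
    fix i assume "i < N"
    then show "reaches E (k * k') (R i) (R (Suc i))"
      using q[of N] reaches_step_mono[OF assms(2)] unfolding quasi_geodesic_upto_def by blast
  next
    fix i j m assume "i \<le> j" "reaches E m (R i) (R j)"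
    then have "j - i \<le> \<gamma> * (k * m) + c"
      using q[of j] reaches_step_mono[OF assms(3)] unfolding quasi_geodesic_upto_def by blast
    then show "j - i \<le> \<gamma> * k * m + c" by (simp add: mult.assoc)
  qed
  then show ?thesis unfolding coarse_ray_def by blast
qed

lemma below_change_digraph:
  assumes "below X R Q" "\<And>x y. (x, y) \<in> X \<Longrightarrow> reaches E k x y"
  shows "below E R Q"
  using assms(1) reaches_step_mono[OF assms(2)] unfolding below_def by meson

text \<open>A finite set meets only finitely many of infinitely many disjoint paths.\<close>
lemma end_le_avoiding:
  assumes "end_le X R1 R2" "finite F"
  shows "\<exists>i j. R1 i \<notin> F \<and> R2 j \<notin> F \<and> (R1 i, R2 j) \<in> (avoiding X F)\<^sup>*"
proof -
  obtain \<P> where P: "infinite \<P>" "\<And>p. p \<in> \<P> \<Longrightarrow> dipath_betw_sets X (range R1) p (range R2)"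
    "pairwise (\<lambda>p q. disjnt (set p) (set q)) \<P>"
    using assms(1) unfolding end_le_def by blast
  have "\<exists>p\<in>\<P>. set p \<inter> F = {}"
  proof (rule ccontr)
    assume "\<not> (\<exists>p\<in>\<P>. set p \<inter> F = {})"
    then have "\<forall>p\<in>\<P>. \<exists>v. v \<in> set p \<and> v \<in> F" by blast
    then obtain f where f: "\<forall>p\<in>\<P>. f p \<in> set p \<and> f p \<in> F" by metis
    have "inj_on f \<P>"
    proof (rule inj_onI)
      fix p q assume "p \<in> \<P>" "q \<in> \<P>" "f p = f q"
      then show "p = q"
        using f P(3) unfolding pairwise_def disjnt_def by (metis IntI empty_iff)
    qed
    moreover have "f ` \<P> \<subseteq> F" using f by blast
    ultimately show False using P(1) assms(2) inj_on_finite by blast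
  qed
  then obtain p where p: "p \<in> \<P>" "set p \<inter> F = {}" by blast
  have d: "dipath X p" "hd p \<in> range R1" "last p \<in> range R2"
    using P(2)[OF p(1)] unfolding dipath_betw_sets_def by auto
  then have "dipath (avoiding X F) p"
    using p(2) unfolding dipath_iff_nth avoiding_def by (auto simp: disjoint_iff)
  then have "(hd p, last p) \<in> (avoiding X F) ^^ plen p"
    by (intro dipath_betw_relpow) (simp add: dipath_betw_def)
  then have "(hd p, last p) \<in> (avoiding X F)\<^sup>*" by (rule relpow_imp_rtrancl)
  moreover have "hd p \<in> set p" "last p \<in> set p" using d(1) unfolding dipath_def by auto
  then have "hd p \<notin> F" "last p \<notin> F" using p(2) by auto
  ultimately show ?thesis using d(2,3) by fastforce
qed

text \<open>The paths of length \<open>0\<close> are disjoint.\<close>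
lemma end_le_refl:
  assumes "inj R"
  shows "end_le X R R"
  unfolding end_le_def
proof (intro exI[of _ "range (\<lambda>i. [R i])"] conjI)
  have "inj (\<lambda>i. [R i])" using assms by (auto simp: inj_def)
  then show "infinite (range (\<lambda>i. [R i]))" by (rule range_inj_infinite)
  show "\<forall>p\<in>range (\<lambda>i. [R i]). dipath_betw_sets X (range R) p (range R)"
    unfolding dipath_betw_sets_def dipath_def by auto
  show "pairwise (\<lambda>p q. disjnt (set p) (set q)) (range (\<lambda>i. [R i]))"
    unfolding pairwise_def by auto
qed

lemma one_end_avoiding:
  assumes "card (digraph_ends X) = 1"
  shows "all_rays X \<noteq> {}"
    and "R1 \<in> all_rays X \<Longrightarrow> R2 \<in> all_rays X \<Longrightarrow> finite F \<Longrightarrow>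
      \<exists>i j. R1 i \<notin> F \<and> R2 j \<notin> F \<and> (R1 i, R2 j) \<in> (avoiding X F)\<^sup>*"
proof -
  show "all_rays X \<noteq> {}" using assms unfolding digraph_ends_def by auto
  assume R: "R1 \<in> all_rays X" "R2 \<in> all_rays X" and F: "finite F"
  have "inj R2" using R(2) unfolding all_rays_def ray_def anti_ray_def by auto
  then have "R2 \<in> end_rel X `` {R2}" using R(2) end_le_refl unfolding end_rel_def by auto
  moreover have "end_rel X `` {R1} \<in> digraph_ends X" "end_rel X `` {R2} \<in> digraph_ends X"
    using R unfolding digraph_ends_def by (auto intro: quotientI)
  then have "end_rel X `` {R1} = end_rel X `` {R2}"
    using assms by (metis card_1_singletonE singletonD)
  ultimately have "end_le X R1 R2" unfolding end_rel_def by auto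
  then show "\<exists>i j. R1 i \<notin> F \<and> R2 j \<notin> F \<and> (R1 i, R2 j) \<in> (avoiding X F)\<^sup>*"
    using end_le_avoiding F by blast
qed

text \<open>A path of length \<open>M\<close> that starts far out on \<open>R1\<close> cannot enter a given ball, as only finitely many
  vertices reach the ball within \<open>M\<close> steps.\<close>
lemma bd_le_of_below:
  assumes fin: "\<And>n v. finite {u. reaches E n u v}" "\<And>n v. finite {u. reaches E n v u}"
    and R: "proper_seq R1" and below: "below E R1 R2"
  shows "bd_le E R1 R2"
proof -
  obtain M where M: "\<And>n. \<exists>i\<ge>n. \<exists>j\<ge>n. reaches E M (R1 i) (R2 j)" using below unfolding below_def by blast
  have "\<exists>p. dipath_betw_sets E (range R1) p (range R2) \<and> real (plen p) \<le> real M \<and>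
      set p \<inter> (out_ball E r x \<union> in_ball E r x) = {}" for r x
  proof -
    let ?B = "out_ball E r x \<union> in_ball E r x"
    have "?B \<subseteq> {u. reaches E (nat \<lceil>r\<rceil>) x u} \<union> {u. reaches E (nat \<lceil>r\<rceil>) u x}"
      unfolding out_ball_def in_ball_def by (auto dest!: reaches_of_ddist)
    then have "finite ?B" using fin finite_subset by (meson finite_UnI)
    then have "finite (\<Union>v\<in>?B. {u. reaches E M u v})" using fin by auto
    then obtain n where n: "\<And>i. i \<ge> n \<Longrightarrow> R1 i \<notin> (\<Union>v\<in>?B. {u. reaches E M u v})"
      using proper_seq_avoids[OF R] by blast
    obtain i j where ij: "i \<ge> n" "reaches E M (R1 i) (R2 j)" using M by blast
    obtain m where m: "m \<le> M" "(R1 i, R2 j) \<in> E ^^ m" using ij(2) unfolding reaches_def by blast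
    obtain f where f: "f 0 = R1 i" "f m = R2 j" "\<forall>i<m. (f i, f (Suc i)) \<in> E"
      using m(2) unfolding relpow_fun_conv by blast
    note p = dipath_of_function[OF f(3)]
    have "f l \<notin> ?B" if "l \<le> m" for l
    proof -
      have "(R1 i, f l) \<in> E ^^ l" using path_relpow[OF f(3), of 0 l] that f(1) by simp
      then have "reaches E M (R1 i) (f l)" using that m(1) unfolding reaches_def by (intro exI[of _ l]) simp
      then show ?thesis using n[OF ij(1)] by blast
    qed
    then have "set (map f [0..<Suc m]) \<inter> ?B = {}" unfolding p(3) by auto
    moreover have "dipath_betw_sets E (range R1) (map f [0..<Suc m]) (range R2)"
      using p(1) f(1,2) unfolding dipath_betw_def dipath_betw_sets_def by auto
    moreover have "real (plen (map f [0..<Suc m])) \<le> real M" using p(2) m(1) by simp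
    ultimately show ?thesis by blast
  qed
  then show ?thesis unfolding bd_le_def by (intro exI[of _ "real M"]) simp
qed

text \<open>The balls around \<open>R1 0\<close> contain initial pieces of \<open>R1\<close>, so avoiding them forces a large index on
  \<open>R1\<close>. The index on \<open>R2\<close> is large as well, since only finitely many vertices reach a given one
  within bounded distance.\<close>
lemma below_of_bd_le:
  assumes fin: "\<And>n v. finite {u. reaches E n u v}"
    and R: "R1 \<in> all_rays E" and bd: "bd_le E R1 R2"
  shows "below E R1 R2"
proof -
  obtain M where M: "\<And>r x. r \<ge> 0 \<Longrightarrow> \<exists>p. dipath_betw_sets E (range R1) p (range R2) \<and>
        real (plen p) \<le> M \<and> set p \<inter> (out_ball E r x \<union> in_ball E r x) = {}"
    using bd unfolding bd_le_def by blast
  have "inj R1" using R unfolding all_rays_def ray_def anti_ray_def by auto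
  then have proper: "proper_seq R1"
    unfolding proper_seq_def by (simp add: finite_vimageI[of "{_}" R1, unfolded vimage_def, simplified])
  have start: "R1 i \<in> out_ball E (real n) (R1 0) \<union> in_ball E (real n) (R1 0)" if "i \<le> n" for i n
  proof -
    have "reaches E i (R1 0) (R1 i) \<or> reaches E i (R1 i) (R1 0)"
    proof (cases "ray E R1")
      case True
      then have "(R1 0, R1 i) \<in> E ^^ i" using path_relpow[of i R1 E 0 i] unfolding ray_def by simp
      then show ?thesis unfolding reaches_def by blast
    next
      case False
      then have "(R1 0, R1 i) \<in> (E\<inverse>) ^^ i"
        using R path_relpow[of i R1 "E\<inverse>" 0 i] unfolding all_rays_def anti_ray_def by simp
      then show ?thesis unfolding reaches_def relpow_converse by blast
    qed
    then show ?thesis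
      unfolding out_ball_def in_ball_def using ddist_of_reaches that by fastforce
  qed
  have "\<exists>i\<ge>n. \<exists>j\<ge>n. reaches E (nat \<lceil>M\<rceil>) (R1 i) (R2 j)" for n
  proof -
    have "finite (\<Union>t<n. {u. reaches E (nat \<lceil>M\<rceil>) u (R2 t)})" using fin by auto
    then obtain n' where n': "\<And>i. i \<ge> n' \<Longrightarrow> R1 i \<notin> (\<Union>t<n. {u. reaches E (nat \<lceil>M\<rceil>) u (R2 t)})"
      using proper_seq_avoids[OF proper] by blast
    obtain p where p: "dipath_betw_sets E (range R1) p (range R2)" "real (plen p) \<le> M"
      "set p \<inter> (out_ball E (real (n + n')) (R1 0) \<union> in_ball E (real (n + n')) (R1 0)) = {}"
      using M[of "real (n + n')" "R1 0"] by auto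
    obtain i j where ij: "hd p = R1 i" "last p = R2 j" using p(1) unfolding dipath_betw_sets_def by auto
    have "hd p \<in> set p" using p(1) unfolding dipath_betw_sets_def dipath_def by auto
    then have "\<not> i \<le> n + n'" using start[of i "n + n'"] p(3) ij(1) by auto
    moreover have "(R1 i, R2 j) \<in> E ^^ plen p"
      using dipath_betw_relpow[of E "R1 i" p "R2 j"] p(1) ij unfolding dipath_betw_def dipath_betw_sets_def by simp
    then have r: "reaches E (nat \<lceil>M\<rceil>) (R1 i) (R2 j)"
      unfolding reaches_def using p(2) by (intro exI[of _ "plen p"]) linarith
    moreover have "n \<le> j"
    proof (rule ccontr)
      assume "\<not> n \<le> j"
      then show False using n'[of i] r \<open>\<not> i \<le> n + n'\<close> by auto
    qed
    ultimately show ?thesis by (intro exI[of _ i] conjI exI[of _ j]) auto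
  qed
  then show ?thesis unfolding below_def by blast
qed

section \<open>Cayley digraphs\<close>

lemma span_reaches: "s \<in> subsemigroup_span A \<Longrightarrow> \<exists>m. \<forall>x. reaches (cayley_digraph A) m x (x * s)"
proof (induction rule: subsemigroup_span.induct)
  case (base a)
  then have "(x, x * a) \<in> cayley_digraph A" for x unfolding cayley_digraph_def by blast
  then show ?case by (intro exI[of _ "Suc 0"] allI reaches_edge)
next
  case (mult s t)
  then obtain m n where mn: "\<And>x. reaches (cayley_digraph A) m x (x * s)" "\<And>x. reaches (cayley_digraph A) n x (x * t)"
    by blast
  have "reaches (cayley_digraph A) (m + n) x (x * (s * t))" for x
    using reaches_trans[OF mn(1)[of x] mn(2)[of "x * s"]] by (simp add: mult.assoc)
  then show ?case by blast
qed

lemma cayley_step_reaches: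
  assumes "finite_generating_set A" "finite B"
  shows "\<exists>k. \<forall>x y. (x, y) \<in> cayley_digraph B \<longrightarrow> reaches (cayley_digraph A) k x y"
proof -
  have "\<exists>m. \<forall>x. reaches (cayley_digraph A) m x (x * s)" for s
    using span_reaches[of s A] assms(1) unfolding finite_generating_set_def by simp
  then obtain m where m: "\<And>s x. reaches (cayley_digraph A) (m s) x (x * s)" by metis
  have "reaches (cayley_digraph A) (sum m B) x y" if xy: "(x, y) \<in> cayley_digraph B" for x y
  proof -
    obtain s where s: "s \<in> B" "y = x * s" using xy unfolding cayley_digraph_def by blast
    have "m s \<le> sum m B" using s(1) assms(2) by (intro member_le_sum) auto
    then show ?thesis unfolding s(2) by (rule reaches_mono[OF m])
  qed
  then show ?thesis by blast
qed

lemma cayley_digraphs_comparable: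
  assumes "finite_generating_set A" "finite_generating_set B"
  shows "\<exists>k. (\<forall>x y. (x, y) \<in> cayley_digraph A \<longrightarrow> reaches (cayley_digraph B) k x y) \<and>
    (\<forall>x y. (x, y) \<in> cayley_digraph B \<longrightarrow> reaches (cayley_digraph A) k x y)"
proof -
  obtain k where k: "\<And>x y. (x, y) \<in> cayley_digraph A \<Longrightarrow> reaches (cayley_digraph B) k x y"
    using cayley_step_reaches[of B A] assms unfolding finite_generating_set_def by blast
  obtain l where l: "\<And>x y. (x, y) \<in> cayley_digraph B \<Longrightarrow> reaches (cayley_digraph A) l x y"
    using cayley_step_reaches[of A B] assms unfolding finite_generating_set_def by blast
  show ?thesis
    using reaches_mono[OF k, of _ _ "k + l"] reaches_mono[OF l, of _ _ "k + l"] by (intro exI[of _ "k + l"]) simp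
qed

lemma cayley_reach_from_generator:
  assumes "finite_generating_set A"
  shows "\<exists>a\<in>A. (a, v) \<in> (cayley_digraph A)\<^sup>*"
proof -
  have "v \<in> subsemigroup_span A" using assms unfolding finite_generating_set_def by simp
  then show ?thesis
  proof (induction rule: subsemigroup_span.induct)
    case (mult x y)
    obtain m where "reaches (cayley_digraph A) m x (x * y)" using span_reaches[OF mult.hyps(2)] by blast
    then have "(x, x * y) \<in> (cayley_digraph A)\<^sup>*" by (rule reaches_rtrancl)
    then show ?case using mult.IH(1) by (meson rtrancl_trans)
  qed blast
qed

text \<open>Right cancellation says that each generator labels at most one incoming edge of a vertex.\<close>
lemma cayley_degrees:
  fixes A :: "'a::semigroup_mult set"
  assumes "finite A" "right_cancellative TYPE('a)"
  shows "finite {y. (x, y) \<in> cayley_digraph A}" "card {y. (x, y) \<in> cayley_digraph A} \<le> card A"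
    "finite {y. (y, x) \<in> cayley_digraph A}" "card {y. (y, x) \<in> cayley_digraph A} \<le> card A"
proof -
  have "{y. (x, y) \<in> cayley_digraph A} = (\<lambda>a. x * a) ` A" unfolding cayley_digraph_def by blast
  then show "finite {y. (x, y) \<in> cayley_digraph A}" "card {y. (x, y) \<in> cayley_digraph A} \<le> card A"
    using assms(1) card_image_le by auto
  have "{y. (y, x) \<in> cayley_digraph A} \<subseteq> (\<lambda>a. THE y. y * a = x) ` A"
  proof
    fix y assume "y \<in> {y. (y, x) \<in> cayley_digraph A}"
    then obtain a where a: "a \<in> A" "y * a = x" unfolding cayley_digraph_def by blast
    then have "(THE y. y * a = x) = y"
      using assms(2) unfolding right_cancellative_def by (intro the_equality) auto
    then show "y \<in> (\<lambda>a. THE y. y * a = x) ` A" using a(1) by blast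
  qed
  then show "finite {y. (y, x) \<in> cayley_digraph A}" "card {y. (y, x) \<in> cayley_digraph A} \<le> card A"
    using assms(1) by (auto intro: finite_subset surj_card_le)
qed

lemma infinite_qg_boundary:
  assumes "infinite H" "H \<subseteq> qg_rays E" "\<And>h. h \<in> H \<Longrightarrow> bd_le E h h"
    and sep: "\<And>h h'. h \<in> H \<Longrightarrow> h' \<in> H \<Longrightarrow> bd_le E h h' \<Longrightarrow> bd_le E h' h \<Longrightarrow> h = h'"
  shows "infinite (qg_boundary E)"
proof -
  have "inj_on (\<lambda>h. bd_rel E `` {h}) H"
  proof (rule inj_onI)
    fix h h' assume h: "h \<in> H" "h' \<in> H" "bd_rel E `` {h} = bd_rel E `` {h'}"
    have "h' \<in> bd_rel E `` {h'}" using assms(2,3) h(2) unfolding bd_rel_def by blast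
    then have "h' \<in> bd_rel E `` {h}" using h(3) by simp
    then show "h = h'" using sep h(1,2) unfolding bd_rel_def by blast
  qed
  then have "infinite ((\<lambda>h. bd_rel E `` {h}) ` H)" using assms(1) finite_image_iff by blast
  moreover have "(\<lambda>h. bd_rel E `` {h}) ` H \<subseteq> qg_boundary E"
    using assms(2) unfolding qg_boundary_def by (auto intro: quotientI)
  ultimately show ?thesis using infinite_super by blast
qed

lemma card_qg_boundary_one:
  assumes "R \<in> qg_rays E" "\<And>R1 R2. R1 \<in> qg_rays E \<Longrightarrow> R2 \<in> qg_rays E \<Longrightarrow> bd_le E R1 R2"
  shows "card (qg_boundary E) = 1"
proof -
  have "bd_rel E = qg_rays E \<times> qg_rays E" using assms(2) unfolding bd_rel_def by auto
  then have "qg_boundary E = {qg_rays E}"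
    using assms(1) unfolding qg_boundary_def quotient_def by auto
  then show ?thesis by simp
qed

theorem corollary11p1:
  fixes A :: "'a::semigroup_mult set"
  assumes "finite_generating_set A"
    and "right_cancellative TYPE('a)"
    and "hyperbolic_semigroup TYPE('a)"
    and "one_ended_semigroup TYPE('a)"
  shows "card (qg_boundary (cayley_digraph A)) = 1 \<or> infinite (qg_boundary (cayley_digraph A))"
proof -
  obtain B :: "'a set" where B: "finite_generating_set B" "hyperbolic_digraph (cayley_digraph B)"
    using assms(3) unfolding hyperbolic_semigroup_def by blast
  obtain C :: "'a set" where C: "finite_generating_set C" "card (digraph_ends (cayley_digraph C)) = 1"
    using assms(4) unfolding one_ended_semigroup_def by blast
  define D where "D = cayley_digraph A"
  define E where "E = cayley_digraph B"
  define X where "X = cayley_digraph C"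
  have finB: "finite B" using B(1) unfolding finite_generating_set_def by simp
  obtain \<delta> where \<delta>: "\<forall>x y z X Y Z v. segment E x y X \<longrightarrow> segment E x z Y \<or> segment E z x Y \<longrightarrow>
    segment E y z Z \<or> segment E z y Z \<longrightarrow> v \<in> X \<longrightarrow>
    (\<exists>q\<in>Y. reaches E \<delta> q v) \<or> (\<exists>q\<in>Z. reaches E \<delta> v q)"
    using hyperbolic_digraph_thin[OF B(2)] unfolding E_def by (rule exE)
  obtain k where k: "\<And>x y. (x, y) \<in> X \<Longrightarrow> reaches E k x y" "\<And>x y. (x, y) \<in> E \<Longrightarrow> reaches X k x y"
    using cayley_digraphs_comparable[OF C(1) B(1)] unfolding E_def X_def by blast
  obtain l where l: "\<And>x y. (x, y) \<in> D \<Longrightarrow> reaches E l x y" "\<And>x y. (x, y) \<in> E \<Longrightarrow> reaches D l x y"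
    using cayley_digraphs_comparable[OF assms(1) B(1)] unfolding E_def D_def by blast
  interpret thin_digraph E \<delta> "card B"
  proof
    show "segment E x y X \<Longrightarrow> segment E x z Y \<or> segment E z x Y \<Longrightarrow>
      segment E y z Z \<or> segment E z y Z \<Longrightarrow> v \<in> X \<Longrightarrow>
      (\<exists>q\<in>Y. reaches E \<delta> q v) \<or> (\<exists>q\<in>Z. reaches E \<delta> v q)" for x y z X Y Z v
      by (rule \<delta>[rule_format])
  qed (use cayley_degrees[OF finB assms(2)] in \<open>auto simp: E_def\<close>)
  interpret one_ended_thin_digraph E \<delta> "card B" X k
    by unfold_locales (use k one_end_avoiding(2)[OF C(2)] in \<open>auto simp: X_def\<close>)
  have ray: "R \<in> all_rays D" "coarse_ray E R \<or> coarse_ray (E\<inverse>) R" "proper_seq R" if "R \<in> qg_rays D" for R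
  proof -
    have R: "quasi_geodesic_ray D R \<or> quasi_geodesic_anti_ray D R" using that unfolding qg_rays_def by simp
    then show "R \<in> all_rays D"
      unfolding all_rays_def quasi_geodesic_ray_def quasi_geodesic_anti_ray_def by blast
    show co: "coarse_ray E R \<or> coarse_ray (E\<inverse>) R"
      using R
    proof
      assume "quasi_geodesic_ray D R"
      from coarse_ray_change_digraph[OF quasi_geodesic_ray_coarse[OF this] l] show ?thesis ..
    next
      assume "quasi_geodesic_anti_ray D R"
      then have "coarse_ray (E\<inverse>) R"
        by (intro coarse_ray_change_digraph[OF quasi_geodesic_anti_ray_coarse, of D R "E\<inverse>" l]) (use l in auto)
      then show ?thesis ..
    qed
    show "proper_seq R" using co by (auto dest: coarse_ray_proper)
  qed
  have fin: "finite {u. reaches D n u v}" "finite {u. reaches D n v u}" for n v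
  proof -
    have "{u. reaches D n u v} \<subseteq> {u. reaches E (l * n) u v}" "{u. reaches D n v u} \<subseteq> {u. reaches E (l * n) v u}"
      using reaches_step_mono[OF l(1)] by auto
    from finite_subset[OF this(1) finite_in_ball] finite_subset[OF this(2) finite_out_ball]
    show "finite {u. reaches D n u v}" "finite {u. reaches D n v u}" .
  qed
  have bd: "bd_le D R1 R2 \<longleftrightarrow> below E R1 R2" if R: "R1 \<in> qg_rays D" "R2 \<in> qg_rays D" for R1 R2
  proof
    assume "bd_le D R1 R2"
    then show "below E R1 R2"
      using below_change_digraph[OF below_of_bd_le[OF fin(1) ray(1)[OF R(1)]] l(1)] by blast
  next
    assume "below E R1 R2"
    then show "bd_le D R1 R2"
      using bd_le_of_below[OF fin ray(3)[OF R(1)] below_change_digraph[OF _ l(2)]] by blast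
  qed
  have refl: "below E R R" for R unfolding below_def by (meson order_refl reaches_refl)
  show ?thesis
  proof (cases "many_directions E \<or> many_directions (E\<inverse>)")
    case True
    have "\<exists>H. infinite H \<and> H \<subseteq> qg_rays D \<and> (\<forall>h\<in>H. \<forall>h'\<in>H. h \<noteq> h' \<longrightarrow> \<not> below E h h')"
      using True
    proof
      assume "many_directions E"
      then obtain H where "infinite H" "\<forall>h\<in>H. geodesic_ray D h" "\<forall>h\<in>H. \<forall>h'\<in>H. h \<noteq> h' \<longrightarrow> \<not> below E h h'"
        using many_directions_change_digraph[of D l, OF _ l] by auto
      then show ?thesis
        using geodesic_ray_quasi_geodesic[of D] unfolding qg_rays_def by (intro exI[of _ H]) auto
    next
      assume "many_directions (E\<inverse>)"
      then obtain H where "infinite H" "\<forall>h\<in>H. geodesic_ray (D\<inverse>) h"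
        "\<forall>h\<in>H. \<forall>h'\<in>H. h \<noteq> h' \<longrightarrow> \<not> below (E\<inverse>) h h'"
        using thin_digraph.many_directions_change_digraph[OF thin_converse, of "D\<inverse>" l] l by auto
      then show ?thesis
        using geodesic_ray_quasi_geodesic_anti[of D] unfolding qg_rays_def below_converse by (intro exI[of _ H]) auto
    qed
    then obtain H where H: "infinite H" "H \<subseteq> qg_rays D" "\<And>h h'. h \<in> H \<Longrightarrow> h' \<in> H \<Longrightarrow> below E h h' \<Longrightarrow> h = h'"
      by blast
    have "infinite (qg_boundary D)"
      by (rule infinite_qg_boundary[OF H(1,2)]) (use H(2,3) bd refl in blast)+
    then show ?thesis unfolding D_def by simp
  next
    case False
    \<comment> \<open>All boundary relations hold; it remains to find one quasi-geodesic ray.\<close>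
    have "infinite (UNIV :: 'a set)"
    proof -
      obtain R where "R \<in> all_rays X" using one_end_avoiding(1)[OF C(2)] unfolding X_def by blast
      then have "inj R" unfolding all_rays_def ray_def anti_ray_def by auto
      then show ?thesis by (rule infinite_super[OF subset_UNIV range_inj_infinite])
    qed
    moreover have "UNIV = (\<Union>b\<in>B. {v. (b, v) \<in> E\<^sup>*})"
      using cayley_reach_from_generator[OF B(1)] unfolding E_def by blast
    ultimately have "infinite (\<Union>b\<in>B. {v. (b, v) \<in> E\<^sup>*})" by simp
    then have "\<not> (\<forall>b\<in>B. finite {v. (b, v) \<in> E\<^sup>*})" by (subst (asm) finite_UN[OF finB])
    then obtain b where "infinite {v. (b, v) \<in> E\<^sup>*}" by (auto simp only: ball_simps)
    from geodesic_ray_exists[OF this] obtain g where g: "geodesic_ray E g" by blast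
    obtain h where "geodesic_ray D h" using geodesic_ray_change_digraph[OF l g] by blast
    from geodesic_ray_quasi_geodesic[OF this] have "h \<in> qg_rays D" unfolding qg_rays_def by simp
    moreover have "bd_le D R1 R2" if "R1 \<in> qg_rays D" "R2 \<in> qg_rays D" for R1 R2
      using bd[OF that] boundary_collapses[OF ray(2)[OF that(1)] ray(2)[OF that(2)]] False by blast
    ultimately have "card (qg_boundary D) = 1" by (rule card_qg_boundary_one)
    then show ?thesis unfolding D_def by simp
  qed
qed

end
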